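(* Let $\Gamma = A_1,\ldots,A_n$ be main formulas of $\mathrm{SL}$ and suppose the main sequent $\Gamma \vdash_S \{\alpha\}A\{\beta\}$ is derivable in $\mathrm{SL}$. Then there is a term $t$ of $\mathrm{ST}$ with typing $\Delta, x_1:\tau(A_1),\ldots,x_n:\tau(A_n) \vdash t : \tau(A)$, where $\Delta$ assigns type $D$ to the free (first-order) variables of $\Gamma$, $\alpha$, $A$, $\beta$ and the $x_i$ are fresh variables, such that the formula $[t]\ \mathrm{sr}\ \{\alpha\}A\{\beta\}$ is provable in $S^\omega$ from the assumptions $x_1\ \mathrm{sr}\ A_1,\ldots,x_n\ \mathrm{sr}\ A_n$ (with $x_i:[\tau(A_i)]$). More generally, the same holds for derivations in $\mathrm{SL}+\Delta_H+\Delta_S$, with $t$ a term of $\mathrm{ST}+\Lambda_S$ and provability in $S^\omega+\Gamma_S$, provided that: (i) for every axiom $\gamma_1,\ldots,\gamma_k\vdash_H \alpha'$ in $\Delta_H$, the formula $[\gamma_1](\pi)\wedge\cdots\wedge[\gamma_k](\pi)\to[\alpha'](\pi)$ (for a state variable $\pi$) is in $\Gamma_S$; and (ii) for every axiom $B_1,\ldots,B_m\vdash_S\{\alpha'\}B\{\beta'\}$ in $\Delta_S$ there is a term $u$ of $\mathrm{ST}+\Lambda_S$ (with free variables among the first-order variables, typed $D$, and fresh $y_j:\tau(B_j)$) such that $[u]\ \mathrm{sr}\ \{\alpha'\}B\{\beta'\}$ is provable in $S^\omega+\Gamma_S$ from $y_j\ \mathrm{sr}\ B_j$ ($j=1,\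ldots,m$).
   Context: The logic $\mathrm{SL}$. Fix a first-order signature with function symbols $f$ of fixed arities (at least one constant symbol $c$), ordinary predicate symbols $P$ and state predicate symbols $p$ of fixed arities. Terms are ordinary first-order terms. State formulas: $\top$, $\bot$, $p(t_1,\ldots,t_n)$, closed under $\wedge,\vee,\to$ ($\neg\alpha:=\alpha\to\bot$). Main formulas: $\top$, $\bot$, $P(t_1,\ldots,t_n)$, $A\wedge B$, $A\vee B$, $\exists x A$, and for main $A,B$ and state $\alpha,\beta$ also $A\Rightarrow\{\alpha\}B\{\beta\}$ and $\forall x\{\alpha\}A\{\beta\}$. A state sequent $\Gamma\vdash_H\alpha$ ($\Gamma$ a finite set of state formulas) is derivable by the natural-deduction rules of intuitionistic propositional logic plus excluded middle $\Gamma\vdash_H\alpha\vee\neg\alpha$, plus axioms in a set $\Delta_H$. Main sequents $\Gamma\vdash_S\{\alpha\}A\{\beta\}$ ($\Gamma$ a finite set of main formulas) are generated by: $\Gamma\vdash_S\{\alpha\}A\{\alpha\}$ if $A\in\Gamma$; $\Gamma\vdash_S\{\alpha\}\top\{\alpha\}$; ($\wedge I$) from $\{\alpha\}A\{\beta\}$ and $\{\beta\}B\{\gamma\}$ infer $\{\alpha\}A\wedge B\{\gamma\}$; ($\wedge E$) from $\{\alpha\}A\wedge B\{\beta\}$ infer $\{\alpha\}A\{\beta\}$ and $\{\alpha\}B\{\beta\}$; ($\vee I$) from $\{\alpha\}A\{\beta\}$ (resp. $\{\alpha\}B\{\beta\}$) infer $\{\alpha\}A\vee B\{\beta\}$; ($\vee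 E$) from $\Gamma\vdash_S\{\alpha\}A\vee B\{\beta\}$, $\Gamma,A\vdash_S\{\beta\}C\{\gamma\}$, $\Gamma,B\vdash_S\{\beta\}C\{\gamma\}$ infer $\Gamma\vdash_S\{\alpha\}C\{\gamma\}$; ($\Rightarrow I$) from $\Gamma,A\vdash_S\{\alpha\}B\{\beta\}$ infer $\Gamma\vdash_S\{\gamma\}(A\Rightarrow\{\alpha\}B\{\beta\})\{\gamma\}$ for any $\gamma$; ($\Rightarrow E$) from $\{\alpha\}(A\Rightarrow\{\gamma\}B\{\delta\})\{\beta\}$ and $\{\beta\}A\{\gamma\}$ infer $\{\alpha\}B\{\delta\}$; ($\bot E$) from $\{\alpha\}\bot\{\beta\}$ infer $\{\alpha\}A\{\gamma\}$ for any $A,\gamma$; ($\forall I$) from $\Gamma\vdash_S\{\alpha[y/x]\}A[y/x]\{\beta[y/x]\}$ infer $\Gamma\vdash_S\{\gamma\}\forall x\{\alpha\}A\{\beta\}\{\gamma\}$ for any $\gamma$, where $y\equiv x$ or $y$ is not free in $A,\alpha,\beta$, and $y$ is not free in $\Gamma$; ($\forall E$) from $\{\alpha\}\forall x\{\beta\}A\{\gamma\}\{\beta[t/x]\}$ infer $\{\alpha\}A[t/x]\{\gamma[t/x]\}$; ($\exists I$) from $\{\alpha\}A[t/x]\{\beta\}$ infer $\{\alpha\}\exists xA\{\beta\}$; ($\exists E$) from $\Gamma\vdash_S\{\alpha\}\exists xA\{\beta\}$ and $\Gamma,A[y/x]\vdash_S\{\beta\}C\{\gamma\}$ infer $\Gamma\vdash_S\{\alpha\}C\{\gamma\}$,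 where $y\equiv x$ or $y$ not free in $A$, and $y$ not free in $C,\alpha,\beta,\gamma,\Gamma$; (cons) from $\alpha\vdash_H\beta$, $\Gamma\vdash_S\{\beta\}A\{\gamma\}$, $\gamma\vdash_H\delta$ infer $\Gamma\vdash_S\{\alpha\}A\{\delta\}$; (cond) from $\vdash_H\alpha\vee\beta$, $\Gamma\vdash_S\{\alpha\wedge\gamma\}A\{\delta\}$, $\Gamma\vdash_S\{\beta\wedge\gamma\}A\{\delta\}$ infer $\Gamma\vdash_S\{\gamma\}A\{\delta\}$; plus axioms in a set $\Delta_S$. $\mathrm{SL}$ is the case $\Delta_H=\Delta_S=\emptyset$. The calculus $\mathrm{ST}(+\Lambda_S)$. Types $X::=D\mid C\mid X\times X\mid X+X\mid X\to X$. Typed terms: variables; $\mathsf{skip}:C$; $\mathsf{default}_X:X$; constants $c\in\Lambda_S$ of given types; $f:D^n\to D$ for each $n$-ary function symbol; $s\circ t:X\times Y$ for $s:X,t:Y$; $p_0(t):X$, $p_1(t):Y$ for $t:X\times Y$; $\iota_0(t):X+Y$ for $t:X$, $\iota_1(t):X+Y$ for $t:Y$; $\mathsf{case}(r;s;t):Z$ for $r:X+Y$, $s:X\to Z$, $t:Y\to Z$; $\lambda x.t$ and application; $\mathsf{if}\ \alpha\ \mathsf{then}\ s\ \mathsf{else}\ t:X$ for $s,t:X$ and $\alpha$ a state formula whose free variables are typed $D$. A first-order term is read as an $\mathrm{ST}$ term of type $D$ via $f(t_1,\ldots,t_n)\mapsto f(t_1\circ\cdots\circ t_n)$. The metatheory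 $S^\omega(+\Gamma_S)$: an extensional many-sorted higher-order (intuitionistic) logic with equality at all types, types $D,1,\mathbb{B},S,X\times Y,X\to Y$ ($S$ the type of states, $\pi,\pi_1,\ldots$ state variables), constants $f:D^n\to D$ for function symbols (first-order terms read via $f(t_1,\ldots,t_n)\mapsto f\langle t_1,\ldots,t_n\rangle$), $():1$ with $x=()$, $\mathsf{true},\mathsf{false}:\mathbb{B}$ with $x=\mathsf{true}\vee x=\mathsf{false}$, pairing $\langle s,t\rangle$ (with $\langle a,b,c\rangle:=\langle a,\langle b,c\rangle\rangle$) and projections $\mathsf{proj}_0,\mathsf{proj}_1$, $\lambda$-abstraction with $\beta$-rule, a case operator with $\mathsf{case}(\mathsf{false})(x)(y)=x$, $\mathsf{case}(\mathsf{true})(x)(y)=y$; atomic formulas $P(t_1,\ldots,t_n)$ (arguments of type $D$) and $p(t_1,\ldots,t_n,\pi)$ (extra argument of type $S$); for each state formula $\alpha$ with free variables $x_1,\ldots,x_n$ a constant $\chi_\alpha$ with $[\alpha](\pi)\to\chi_\alpha\langle x_1,\ldots,x_n\rangle\pi yz=y$ and $\neg[\alpha](\pi)\to\chi_\alpha\langle x_1,\ldots,x_n\rangle\pi yz=z$. $\Gamma_S$ is a set of extra constants and axioms (used to interpret $\Lambda_S$). Embeddings. For state formulas: $[\top](\pi)=\top$, $[\bot](\pi)=\bot$, $[p(t_1,\ldots,t_n)](\pi)=p(t_1,\ldots,t_n,\pi)$, commuting with $\wedge,\vee,\to$. Types: $[D]=D$, $[C]=1$, $[X\times Y]=[X]\times[Y]$,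 $[X+Y]=\mathbb{B}\times[X]\times[Y]$, $[X\to Y]=[X]\to S\to[Y]\times S$. Fixed canonical closed terms $0_X:[X]$ (e.g. $0_D=c$, $0_{X\to Y}=\lambda x,\pi.\langle 0_Y,\pi\rangle$). A term $t:X$ maps to $[t]:S\to[X]\times S$ ("let $\langle a,\pi_1\rangle:=u$" means $a=\mathsf{proj}_0u,\pi_1=\mathsf{proj}_1u$): $[x]\pi=\langle x,\pi\rangle$; $[\mathsf{skip}]\pi=\langle(),\pi\rangle$; $[f]\pi=\langle\lambda x,\pi'.\langle fx,\pi'\rangle,\pi\rangle$; $[c]\pi$ given for $c\in\Lambda_S$ by $\Gamma_S$; $[s\circ t]\pi=\langle a,b,\pi_2\rangle$ where $\langle a,\pi_1\rangle=[s]\pi$, $\langle b,\pi_2\rangle=[t]\pi_1$; $[p_0t]\pi=\langle a,\pi_1\rangle$, $[p_1t]\pi=\langle b,\pi_1\rangle$ where $\langle a,b,\pi_1\rangle=[t]\pi$; $[\iota_0t]\pi=\langle\mathsf{false},a,0_Y,\pi_1\rangle$, $[\iota_1t]\pi=\langle\mathsf{true},0_X,a,\pi_1\rangle$ where $\langle a,\pi_1\rangle=[t]\pi$; $[\mathsf{case}(r;s;t)]\pi=\mathsf{case}(e)(fa\pi_2)(gb\pi_3)$ where $\langle e,a,b,\pi_1\rangle=[r]\pi$, $\langle f,\pi_2\rangle=[s]\pi_1$, $\langle g,\pi_3\rangle=[t]\pi_1$; $[\lambda x.t]\pi=\langle\lambda x^{[X]}.[t],\pi\rangle$; $[ts]\pi=fa\pi_2$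 where $\langle f,\pi_1\rangle=[t]\pi$, $\langle a,\pi_2\rangle=[s]\pi_1$; $[\mathsf{default}_X]\pi=\langle0_X,\pi\rangle$; $[\mathsf{if}\ \alpha\ \mathsf{then}\ s\ \mathsf{else}\ t]\pi=\chi_\alpha\langle x_1,\ldots,x_n\rangle\pi([s]\pi)([t]\pi)$. Realizability. Types: $\tau(\top)=\tau(\bot)=\tau(P(\vec t))=C$, $\tau(A\wedge B)=\tau(A)\times\tau(B)$, $\tau(A\vee B)=\tau(A)+\tau(B)$, $\tau(\exists xA)=D\times\tau(A)$, $\tau(A\Rightarrow\{\alpha\}B\{\beta\})=\tau(A)\to\tau(B)$, $\tau(\forall x\{\alpha\}A\{\beta\})=D\to\tau(A)$. For $x:[\tau(A)]$: $x\ \mathrm{sr}\ Q:=Q$ for $Q$ atomic, $\top$ or $\bot$; $x\ \mathrm{sr}\ A\wedge B:=(\mathsf{proj}_0x\ \mathrm{sr}\ A)\wedge(\mathsf{proj}_1x\ \mathrm{sr}\ B)$; $x\ \mathrm{sr}\ A\vee B:=(\mathsf{proj}_0x=\mathsf{false}\to\mathsf{proj}_0(\mathsf{proj}_1x)\ \mathrm{sr}\ A)\wedge(\mathsf{proj}_0x=\mathsf{true}\to\mathsf{proj}_1(\mathsf{proj}_1x)\ \mathrm{sr}\ B)$; $x\ \mathrm{sr}\ \exists yA:=(\mathsf{proj}_1x\ \mathrm{sr}\ A)[\mathsf{proj}_0x/y]$; $f\ \mathrm{sr}\ (A\Rightarrow\{\alpha\}B\{\beta\}):=\forall x(x\ \mathrm{sr}\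 A\to fx\ \mathrm{sr}\ \{\alpha\}B\{\beta\})$; $f\ \mathrm{sr}\ \forall x\{\alpha\}A\{\beta\}:=\forall x^D(fx\ \mathrm{sr}\ \{\alpha\}A\{\beta\})$; and for $x:S\to[\tau(A)]\times S$: $x\ \mathrm{sr}\ \{\alpha\}A\{\beta\}:=\forall\pi^S([\alpha](\pi)\to(\mathsf{proj}_0(x\pi)\ \mathrm{sr}\ A)\wedge[\beta](\mathsf{proj}_1(x\pi)))$.
   Formalization: S^ω is taken to include true ≠ false and, for each state formula α, [α](π) ∨ ¬[α](π); without these the listed intuitionistic axioms do not prove realizability for ∨-introduction or for the excluded middle of state formulas. *)

theory Defs
  imports Main
begin

section \<open>The language of SL\<close>

text \<open>
  Binding is locally nameless: free variables are names, bound variables are de Bruijn indices.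
  So formulas are identified up to renaming of bound variables, and substitution of index-free
  terms cannot capture. A symbol belongs to the signature iff its arity is not \<^term>\<open>None\<close>.
\<close>

type_synonym name = nat

record ('f, 'P, 'p) signature =
  fun_ar :: "'f \<rightharpoonup> nat"
  pred_ar :: "'P \<rightharpoonup> nat"
  state_ar :: "'p \<rightharpoonup> nat"
  const :: 'f

definition wf_signature :: "('f, 'P, 'p) signature \<Rightarrow> bool" where
  "wf_signature \<Sigma> \<longleftrightarrow> fun_ar \<Sigma> (const \<Sigma>) = Some 0"

datatype 'f fo_term = Free name | Bound nat | Fn 'f "'f fo_term list"

datatype ('f, 'p) sform =
    STop | SBot
  | SAtom 'p "'f fo_term list"
  | SAnd "('f, 'p) sform" "('f, 'p) sform"
  | SOr "('f, 'p) sform" "('f, 'p) sform"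
  | SImp "('f, 'p) sform" "('f, 'p) sform"

abbreviation SNot :: "('f, 'p) sform \<Rightarrow> ('f, 'p) sform" where
  "SNot \<alpha> \<equiv> SImp \<alpha> SBot"

text \<open>
  \<open>MImp A \<alpha> B \<beta>\<close> is \<open>A \<Rightarrow> {\<alpha>} B {\<beta>}\<close>, and \<open>MAll \<alpha> A \<beta>\<close> is \<open>\<forall>x {\<alpha>} A {\<beta>}\<close>, which binds \<open>x\<close>
  in all of \<open>\<alpha>\<close>, \<open>A\<close> and \<open>\<beta>\<close>.
\<close>

datatype ('f, 'P, 'p) mform =
    MTop | MBot
  | MAtom 'P "'f fo_term list"
  | MAnd "('f, 'P, 'p) mform" "('f, 'P, 'p) mform"
  | MOr "('f, 'P, 'p) mform" "('f, 'P, 'p) mform"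
  | MEx "('f, 'P, 'p) mform"
  | MImp "('f, 'P, 'p) mform" "('f, 'p) sform" "('f, 'P, 'p) mform" "('f, 'p) sform"
  | MAll "('f, 'p) sform" "('f, 'P, 'p) mform" "('f, 'p) sform"

text \<open>Well-formedness below \<open>k\<close> binders: arities are respected and indices are smaller than \<open>k\<close>.\<close>

fun wf_term :: "('f, 'P, 'p) signature \<Rightarrow> nat \<Rightarrow> 'f fo_term \<Rightarrow> bool" where
  "wf_term \<Sigma> k (Free x) \<longleftrightarrow> True"
| "wf_term \<Sigma> k (Bound i) \<longleftrightarrow> i < k"
| "wf_term \<Sigma> k (Fn f ts) \<longleftrightarrow> fun_ar \<Sigma> f = Some (length ts) \<and> (\<forall>t\<in>set ts. wf_term \<Sigma> k t)"

fun wf_sform :: "('f, 'P, 'p) signature \<Rightarrow> nat \<Rightarrow> ('f, 'p) sform \<Rightarrow> bool" where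
  "wf_sform \<Sigma> k STop \<longleftrightarrow> True"
| "wf_sform \<Sigma> k SBot \<longleftrightarrow> True"
| "wf_sform \<Sigma> k (SAtom p ts) \<longleftrightarrow> state_ar \<Sigma> p = Some (length ts) \<and> (\<forall>t\<in>set ts. wf_term \<Sigma> k t)"
| "wf_sform \<Sigma> k (SAnd \<alpha> \<beta>) \<longleftrightarrow> wf_sform \<Sigma> k \<alpha> \<and> wf_sform \<Sigma> k \<beta>"
| "wf_sform \<Sigma> k (SOr \<alpha> \<beta>) \<longleftrightarrow> wf_sform \<Sigma> k \<alpha> \<and> wf_sform \<Sigma> k \<beta>"
| "wf_sform \<Sigma> k (SImp \<alpha> \<beta>) \<longleftrightarrow> wf_sform \<Sigma> k \<alpha> \<and> wf_sform \<Sigma> k \<beta>"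

fun wf_mform :: "('f, 'P, 'p) signature \<Rightarrow> nat \<Rightarrow> ('f, 'P, 'p) mform \<Rightarrow> bool" where
  "wf_mform \<Sigma> k MTop \<longleftrightarrow> True"
| "wf_mform \<Sigma> k MBot \<longleftrightarrow> True"
| "wf_mform \<Sigma> k (MAtom P ts) \<longleftrightarrow> pred_ar \<Sigma> P = Some (length ts) \<and> (\<forall>t\<in>set ts. wf_term \<Sigma> k t)"
| "wf_mform \<Sigma> k (MAnd A B) \<longleftrightarrow> wf_mform \<Sigma> k A \<and> wf_mform \<Sigma> k B"
| "wf_mform \<Sigma> k (MOr A B) \<longleftrightarrow> wf_mform \<Sigma> k A \<and> wf_mform \<Sigma> k B"
| "wf_mform \<Sigma> k (MEx A) \<longleftrightarrow> wf_mform \<Sigma> (Suc k) A"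
| "wf_mform \<Sigma> k (MImp A \<alpha> B \<beta>) \<longleftrightarrow>
     wf_mform \<Sigma> k A \<and> wf_sform \<Sigma> k \<alpha> \<and> wf_mform \<Sigma> k B \<and> wf_sform \<Sigma> k \<beta>"
| "wf_mform \<Sigma> k (MAll \<alpha> A \<beta>) \<longleftrightarrow>
     wf_sform \<Sigma> (Suc k) \<alpha> \<and> wf_mform \<Sigma> (Suc k) A \<and> wf_sform \<Sigma> (Suc k) \<beta>"

fun fv_term :: "'f fo_term \<Rightarrow> name set" where
  "fv_term (Free x) = {x}"
| "fv_term (Bound i) = {}"
| "fv_term (Fn f ts) = (\<Union>t\<in>set ts. fv_term t)"

fun fv_sform :: "('f, 'p) sform \<Rightarrow> name set" where
  "fv_sform STop = {}"
| "fv_sform SBot = {}"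
| "fv_sform (SAtom p ts) = (\<Union>t\<in>set ts. fv_term t)"
| "fv_sform (SAnd \<alpha> \<beta>) = fv_sform \<alpha> \<union> fv_sform \<beta>"
| "fv_sform (SOr \<alpha> \<beta>) = fv_sform \<alpha> \<union> fv_sform \<beta>"
| "fv_sform (SImp \<alpha> \<beta>) = fv_sform \<alpha> \<union> fv_sform \<beta>"

fun fv_mform :: "('f, 'P, 'p) mform \<Rightarrow> name set" where
  "fv_mform MTop = {}"
| "fv_mform MBot = {}"
| "fv_mform (MAtom P ts) = (\<Union>t\<in>set ts. fv_term t)"
| "fv_mform (MAnd A B) = fv_mform A \<union> fv_mform B"
| "fv_mform (MOr A B) = fv_mform A \<union> fv_mform B"
| "fv_mform (MEx A) = fv_mform A"
| "fv_mform (MImp A \<alpha> B \<beta>) = fv_mform A \<union> fv_sform \<alpha> \<union> fv_mform B \<union> fv_sform \<beta>"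
| "fv_mform (MAll \<alpha> A \<beta>) = fv_sform \<alpha> \<union> fv_mform A \<union> fv_sform \<beta>"

text \<open>
  If \<open>A\<close> is the body of a binder for \<open>x\<close>, then \<open>A[t/x]\<close> is \<open>inst_mform 0 t A\<close>. There is no lifting
  of \<open>t\<close>, since only index-free terms are substituted.
\<close>

fun inst_term :: "nat \<Rightarrow> 'f fo_term \<Rightarrow> 'f fo_term \<Rightarrow> 'f fo_term" where
  "inst_term k t (Free x) = Free x"
| "inst_term k t (Bound i) = (if i = k then t else Bound i)"
| "inst_term k t (Fn f ts) = Fn f (map (inst_term k t) ts)"

fun inst_sform :: "nat \<Rightarrow> 'f fo_term \<Rightarrow> ('f, 'p) sform \<Rightarrow> ('f, 'p) sform" where
  "inst_sform k t STop = STop"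
| "inst_sform k t SBot = SBot"
| "inst_sform k t (SAtom p ts) = SAtom p (map (inst_term k t) ts)"
| "inst_sform k t (SAnd \<alpha> \<beta>) = SAnd (inst_sform k t \<alpha>) (inst_sform k t \<beta>)"
| "inst_sform k t (SOr \<alpha> \<beta>) = SOr (inst_sform k t \<alpha>) (inst_sform k t \<beta>)"
| "inst_sform k t (SImp \<alpha> \<beta>) = SImp (inst_sform k t \<alpha>) (inst_sform k t \<beta>)"

fun inst_mform :: "nat \<Rightarrow> 'f fo_term \<Rightarrow> ('f, 'P, 'p) mform \<Rightarrow> ('f, 'P, 'p) mform" where
  "inst_mform k t MTop = MTop"
| "inst_mform k t MBot = MBot"
| "inst_mform k t (MAtom P ts) = MAtom P (map (inst_term k t) ts)"
| "inst_mform k t (MAnd A B) = MAnd (inst_mform k t A) (inst_mform k t B)"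
| "inst_mform k t (MOr A B) = MOr (inst_mform k t A) (inst_mform k t B)"
| "inst_mform k t (MEx A) = MEx (inst_mform (Suc k) t A)"
| "inst_mform k t (MImp A \<alpha> B \<beta>) =
     MImp (inst_mform k t A) (inst_sform k t \<alpha>) (inst_mform k t B) (inst_sform k t \<beta>)"
| "inst_mform k t (MAll \<alpha> A \<beta>) =
     MAll (inst_sform (Suc k) t \<alpha>) (inst_mform (Suc k) t A) (inst_sform (Suc k) t \<beta>)"


section \<open>Derivability in SL\<close>

text \<open>
  An axiom \<open>\<gamma>\<^sub>1, \<dots>, \<gamma>\<^sub>k \<turnstile> \<alpha>\<close> keeps its antecedent as a list, and may be used in any context that
  contains its antecedent. The well-formedness premises in this section just ensure that only
  formulas over the signature (without dangling indices) occur in derivations.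
\<close>

inductive HL ::
  "('f, 'P, 'p) signature \<Rightarrow> (('f, 'p) sform list \<times> ('f, 'p) sform) set \<Rightarrow>
   ('f, 'p) sform set \<Rightarrow> ('f, 'p) sform \<Rightarrow> bool"
  for \<Sigma> :: "('f, 'P, 'p) signature" and \<Delta>H :: "(('f, 'p) sform list \<times> ('f, 'p) sform) set"
where
  H_assm: "\<alpha> \<in> \<Gamma> \<Longrightarrow> \<forall>\<gamma>\<in>\<Gamma>. wf_sform \<Sigma> 0 \<gamma> \<Longrightarrow> HL \<Sigma> \<Delta>H \<Gamma> \<alpha>"
| H_topI: "\<forall>\<gamma>\<in>\<Gamma>. wf_sform \<Sigma> 0 \<gamma> \<Longrightarrow> HL \<Sigma> \<Delta>H \<Gamma> STop"
| H_botE: "HL \<Sigma> \<Delta>H \<Gamma> SBot \<Longrightarrow> wf_sform \<Sigma> 0 \<alpha> \<Longrightarrow> HL \<Sigma> \<Delta>H \<Gamma> \<alpha>"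
| H_andI: "HL \<Sigma> \<Delta>H \<Gamma> \<alpha> \<Longrightarrow> HL \<Sigma> \<Delta>H \<Gamma> \<beta> \<Longrightarrow> HL \<Sigma> \<Delta>H \<Gamma> (SAnd \<alpha> \<beta>)"
| H_andE1: "HL \<Sigma> \<Delta>H \<Gamma> (SAnd \<alpha> \<beta>) \<Longrightarrow> HL \<Sigma> \<Delta>H \<Gamma> \<alpha>"
| H_andE2: "HL \<Sigma> \<Delta>H \<Gamma> (SAnd \<alpha> \<beta>) \<Longrightarrow> HL \<Sigma> \<Delta>H \<Gamma> \<beta>"
| H_orI1: "HL \<Sigma> \<Delta>H \<Gamma> \<alpha> \<Longrightarrow> wf_sform \<Sigma> 0 \<beta> \<Longrightarrow> HL \<Sigma> \<Delta>H \<Gamma> (SOr \<alpha> \<beta>)"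
| H_orI2: "HL \<Sigma> \<Delta>H \<Gamma> \<beta> \<Longrightarrow> wf_sform \<Sigma> 0 \<alpha> \<Longrightarrow> HL \<Sigma> \<Delta>H \<Gamma> (SOr \<alpha> \<beta>)"
| H_orE: "HL \<Sigma> \<Delta>H \<Gamma> (SOr \<alpha> \<beta>) \<Longrightarrow> HL \<Sigma> \<Delta>H (insert \<alpha> \<Gamma>) \<gamma> \<Longrightarrow> HL \<Sigma> \<Delta>H (insert \<beta> \<Gamma>) \<gamma> \<Longrightarrow>
    HL \<Sigma> \<Delta>H \<Gamma> \<gamma>"
| H_impI: "HL \<Sigma> \<Delta>H (insert \<alpha> \<Gamma>) \<beta> \<Longrightarrow> HL \<Sigma> \<Delta>H \<Gamma> (SImp \<alpha> \<beta>)"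
| H_impE: "HL \<Sigma> \<Delta>H \<Gamma> (SImp \<alpha> \<beta>) \<Longrightarrow> HL \<Sigma> \<Delta>H \<Gamma> \<alpha> \<Longrightarrow> HL \<Sigma> \<Delta>H \<Gamma> \<beta>"
| H_lem: "\<forall>\<gamma>\<in>\<Gamma>. wf_sform \<Sigma> 0 \<gamma> \<Longrightarrow> wf_sform \<Sigma> 0 \<alpha> \<Longrightarrow> HL \<Sigma> \<Delta>H \<Gamma> (SOr \<alpha> (SNot \<alpha>))"
| H_ax: "(\<gamma>s, \<alpha>) \<in> \<Delta>H \<Longrightarrow> set \<gamma>s \<subseteq> \<Gamma> \<Longrightarrow> \<forall>\<gamma>\<in>\<Gamma>. wf_sform \<Sigma> 0 \<gamma> \<Longrightarrow> wf_sform \<Sigma> 0 \<alpha> \<Longrightarrow>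
    HL \<Sigma> \<Delta>H \<Gamma> \<alpha>"

type_synonym ('f, 'P, 'p) main_axiom =
  "('f, 'P, 'p) mform list \<times> ('f, 'p) sform \<times> ('f, 'P, 'p) mform \<times> ('f, 'p) sform"

text \<open>
  \<open>SL \<Sigma> \<Delta>H \<Delta>S \<Gamma> \<alpha> A \<beta>\<close> is derivability of \<open>\<Gamma> \<turnstile> {\<alpha>} A {\<beta>}\<close>. In \<open>S_allI\<close> and \<open>S_exE\<close> the alternative that
  the eigenvariable \<open>y\<close> is the bound variable itself is included: a bound variable does not occur
  free in the body.
\<close>

inductive SL ::
  "('f, 'P, 'p) signature \<Rightarrow> (('f, 'p) sform list \<times> ('f, 'p) sform) set \<Rightarrow>
   ('f, 'P, 'p) main_axiom set \<Rightarrow> ('f, 'P, 'p) mform set \<Rightarrow>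
   ('f, 'p) sform \<Rightarrow> ('f, 'P, 'p) mform \<Rightarrow> ('f, 'p) sform \<Rightarrow> bool"
  for \<Sigma> :: "('f, 'P, 'p) signature" and \<Delta>H :: "(('f, 'p) sform list \<times> ('f, 'p) sform) set"
    and \<Delta>S :: "('f, 'P, 'p) main_axiom set"
where
  S_assm: "A \<in> \<Gamma> \<Longrightarrow> \<forall>B\<in>\<Gamma>. wf_mform \<Sigma> 0 B \<Longrightarrow> wf_sform \<Sigma> 0 \<alpha> \<Longrightarrow> SL \<Sigma> \<Delta>H \<Delta>S \<Gamma> \<alpha> A \<alpha>"
| S_topI: "\<forall>B\<in>\<Gamma>. wf_mform \<Sigma> 0 B \<Longrightarrow> wf_sform \<Sigma> 0 \<alpha> \<Longrightarrow> SL \<Sigma> \<Delta>H \<Delta>S \<Gamma> \<alpha> MTop \<alpha>"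
| S_andI: "SL \<Sigma> \<Delta>H \<Delta>S \<Gamma> \<alpha> A \<beta> \<Longrightarrow> SL \<Sigma> \<Delta>H \<Delta>S \<Gamma> \<beta> B \<gamma> \<Longrightarrow> SL \<Sigma> \<Delta>H \<Delta>S \<Gamma> \<alpha> (MAnd A B) \<gamma>"
| S_andE1: "SL \<Sigma> \<Delta>H \<Delta>S \<Gamma> \<alpha> (MAnd A B) \<beta> \<Longrightarrow> SL \<Sigma> \<Delta>H \<Delta>S \<Gamma> \<alpha> A \<beta>"
| S_andE2: "SL \<Sigma> \<Delta>H \<Delta>S \<Gamma> \<alpha> (MAnd A B) \<beta> \<Longrightarrow> SL \<Sigma> \<Delta>H \<Delta>S \<Gamma> \<alpha> B \<beta>"
| S_orI1: "SL \<Sigma> \<Delta>H \<Delta>S \<Gamma> \<alpha> A \<beta> \<Longrightarrow> wf_mform \<Sigma> 0 B \<Longrightarrow> SL \<Sigma> \<Delta>H \<Delta>S \<Gamma> \<alpha> (MOr A B) \<beta>"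
| S_orI2: "SL \<Sigma> \<Delta>H \<Delta>S \<Gamma> \<alpha> B \<beta> \<Longrightarrow> wf_mform \<Sigma> 0 A \<Longrightarrow> SL \<Sigma> \<Delta>H \<Delta>S \<Gamma> \<alpha> (MOr A B) \<beta>"
| S_orE: "SL \<Sigma> \<Delta>H \<Delta>S \<Gamma> \<alpha> (MOr A B) \<beta> \<Longrightarrow> SL \<Sigma> \<Delta>H \<Delta>S (insert A \<Gamma>) \<beta> C \<gamma> \<Longrightarrow>
    SL \<Sigma> \<Delta>H \<Delta>S (insert B \<Gamma>) \<beta> C \<gamma> \<Longrightarrow> SL \<Sigma> \<Delta>H \<Delta>S \<Gamma> \<alpha> C \<gamma>"
| S_impI: "SL \<Sigma> \<Delta>H \<Delta>S (insert A \<Gamma>) \<alpha> B \<beta> \<Longrightarrow> wf_sform \<Sigma> 0 \<gamma> \<Longrightarrow>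
    SL \<Sigma> \<Delta>H \<Delta>S \<Gamma> \<gamma> (MImp A \<alpha> B \<beta>) \<gamma>"
| S_impE: "SL \<Sigma> \<Delta>H \<Delta>S \<Gamma> \<alpha> (MImp A \<gamma> B \<delta>) \<beta> \<Longrightarrow> SL \<Sigma> \<Delta>H \<Delta>S \<Gamma> \<beta> A \<gamma> \<Longrightarrow> SL \<Sigma> \<Delta>H \<Delta>S \<Gamma> \<alpha> B \<delta>"
| S_botE: "SL \<Sigma> \<Delta>H \<Delta>S \<Gamma> \<alpha> MBot \<beta> \<Longrightarrow> wf_mform \<Sigma> 0 A \<Longrightarrow> wf_sform \<Sigma> 0 \<gamma> \<Longrightarrow> SL \<Sigma> \<Delta>H \<Delta>S \<Gamma> \<alpha> A \<gamma>"
| S_allI: "SL \<Sigma> \<Delta>H \<Delta>S \<Gamma> (inst_sform 0 (Free y) \<alpha>) (inst_mform 0 (Free y) A) (inst_sform 0 (Free y) \<beta>) \<Longrightarrow>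
    y \<notin> fv_mform A \<union> fv_sform \<alpha> \<union> fv_sform \<beta> \<Longrightarrow> y \<notin> (\<Union>B\<in>\<Gamma>. fv_mform B) \<Longrightarrow>
    wf_sform \<Sigma> 0 \<gamma> \<Longrightarrow> SL \<Sigma> \<Delta>H \<Delta>S \<Gamma> \<gamma> (MAll \<alpha> A \<beta>) \<gamma>"
| S_allE: "SL \<Sigma> \<Delta>H \<Delta>S \<Gamma> \<alpha> (MAll \<beta> A \<gamma>) (inst_sform 0 t \<beta>) \<Longrightarrow> wf_term \<Sigma> 0 t \<Longrightarrow>
    SL \<Sigma> \<Delta>H \<Delta>S \<Gamma> \<alpha> (inst_mform 0 t A) (inst_sform 0 t \<gamma>)"
| S_exI: "SL \<Sigma> \<Delta>H \<Delta>S \<Gamma> \<alpha> (inst_mform 0 t A) \<beta> \<Longrightarrow> wf_term \<Sigma> 0 t \<Longrightarrow> SL \<Sigma> \<Delta>H \<Delta>S \<Gamma> \<alpha> (MEx A) \<beta>"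
| S_exE: "SL \<Sigma> \<Delta>H \<Delta>S \<Gamma> \<alpha> (MEx A) \<beta> \<Longrightarrow>
    SL \<Sigma> \<Delta>H \<Delta>S (insert (inst_mform 0 (Free y) A) \<Gamma>) \<beta> C \<gamma> \<Longrightarrow> y \<notin> fv_mform A \<Longrightarrow>
    y \<notin> fv_mform C \<union> fv_sform \<alpha> \<union> fv_sform \<beta> \<union> fv_sform \<gamma> \<union> (\<Union>B\<in>\<Gamma>. fv_mform B) \<Longrightarrow>
    SL \<Sigma> \<Delta>H \<Delta>S \<Gamma> \<alpha> C \<gamma>"
| S_cons: "HL \<Sigma> \<Delta>H {\<alpha>} \<beta> \<Longrightarrow> SL \<Sigma> \<Delta>H \<Delta>S \<Gamma> \<beta> A \<gamma> \<Longrightarrow> HL \<Sigma> \<Delta>H {\<gamma>} \<delta> \<Longrightarrow> SL \<Sigma> \<Delta>H \<Delta>S \<Gamma> \<alpha> A \<delta>"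
| S_cond: "HL \<Sigma> \<Delta>H {} (SOr \<alpha> \<beta>) \<Longrightarrow> SL \<Sigma> \<Delta>H \<Delta>S \<Gamma> (SAnd \<alpha> \<gamma>) A \<delta> \<Longrightarrow>
    SL \<Sigma> \<Delta>H \<Delta>S \<Gamma> (SAnd \<beta> \<gamma>) A \<delta> \<Longrightarrow> SL \<Sigma> \<Delta>H \<Delta>S \<Gamma> \<gamma> A \<delta>"
| S_ax: "(Bs, \<alpha>, A, \<beta>) \<in> \<Delta>S \<Longrightarrow> set Bs \<subseteq> \<Gamma> \<Longrightarrow> \<forall>B\<in>\<Gamma>. wf_mform \<Sigma> 0 B \<Longrightarrow>
    wf_sform \<Sigma> 0 \<alpha> \<Longrightarrow> wf_mform \<Sigma> 0 A \<Longrightarrow> wf_sform \<Sigma> 0 \<beta> \<Longrightarrow> SL \<Sigma> \<Delta>H \<Delta>S \<Gamma> \<alpha> A \<beta>"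


section \<open>The languages of ST and of the metatheory\<close>

datatype ty = TD | TC | TProd ty ty | TSum ty ty | TFun ty ty

datatype mty = MD | MUnit | MBool | MState | MProd mty mty | MFun mty mty

text \<open>
  Powers associate to the right, so \<open>D\<^sup>n\<close> is \<open>D \<times> (D \<times> \<dots>)\<close> and \<open>D\<^sup>1\<close> is \<open>D\<close>. For \<open>n = 0\<close> we read
  \<open>D\<^sup>n \<rightarrow> X\<close> as \<open>X\<close>, and dually applying something to the empty tuple leaves it unchanged. (The
  values of \<open>pow\<close> and \<open>tuple\<close> for the empty case are never used.)
\<close>

fun tpow :: "nat \<Rightarrow> ty" where
  "tpow 0 = TC"
| "tpow (Suc 0) = TD"
| "tpow (Suc (Suc n)) = TProd TD (tpow (Suc n))"

definition tpow_fun :: "nat \<Rightarrow> ty \<Rightarrow> ty" where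
  "tpow_fun n X = (if n = 0 then X else TFun (tpow n) X)"

fun mpow :: "nat \<Rightarrow> mty" where
  "mpow 0 = MUnit"
| "mpow (Suc 0) = MD"
| "mpow (Suc (Suc n)) = MProd MD (mpow (Suc n))"

definition mpow_fun :: "nat \<Rightarrow> mty \<Rightarrow> mty" where
  "mpow_fun n X = (if n = 0 then X else MFun (mpow n) X)"

text \<open>
  Terms of ST have named variables. The type arguments are the ones that the usual notation leaves
  implicit: \<open>Inj0 Y t\<close> and \<open>Inj1 X t\<close> carry the type of the missing component, \<open>CaseOf\<close> and \<open>Ite\<close>
  the type of the result. The parameter \<open>'k\<close> is for the constants in \<open>\<Lambda>\<^sub>S\<close>.
\<close>

datatype ('f, 'p, 'k) st_term =
    Var name
  | Skip
  | Default ty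
  | Const 'k
  | Fun 'f
  | Comp "('f, 'p, 'k) st_term" "('f, 'p, 'k) st_term"
  | Prj0 "('f, 'p, 'k) st_term"
  | Prj1 "('f, 'p, 'k) st_term"
  | Inj0 ty "('f, 'p, 'k) st_term"
  | Inj1 ty "('f, 'p, 'k) st_term"
  | CaseOf ty "('f, 'p, 'k) st_term" "('f, 'p, 'k) st_term" "('f, 'p, 'k) st_term"
  | Abs name ty "('f, 'p, 'k) st_term"
  | Ap "('f, 'p, 'k) st_term" "('f, 'p, 'k) st_term"
  | Ite ty "('f, 'p) sform" "('f, 'p, 'k) st_term" "('f, 'p, 'k) st_term"

text \<open>
  The metatheory is again locally nameless. A free variable \<open>FV x X\<close> carries its sort, and variables
  with the same name but different sorts are different. \<open>Case X\<close> and \<open>Chi \<alpha> X\<close> are the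
  constants \<open>case\<close> and \<open>\<chi>\<^sub>\<alpha>\<close> with result type \<open>X\<close>; \<open>Ext\<close> is for the extra constants of \<open>\<Gamma>\<^sub>S\<close>.
\<close>

datatype ('f, 'p, 'g) mterm =
    FV name mty
  | BV nat
  | FunC 'f
  | Unt | TT | FF
  | Pair "('f, 'p, 'g) mterm" "('f, 'p, 'g) mterm"
  | P0 "('f, 'p, 'g) mterm"
  | P1 "('f, 'p, 'g) mterm"
  | Lam mty "('f, 'p, 'g) mterm"
  | App "('f, 'p, 'g) mterm" "('f, 'p, 'g) mterm"
  | Case mty
  | Chi "('f, 'p) sform" mty
  | Ext 'g

datatype ('f, 'P, 'p, 'g) fm =
    Top | Bot
  | PAtom 'P "('f, 'p, 'g) mterm list"
  | SAtm 'p "('f, 'p, 'g) mterm list" "('f, 'p, 'g) mterm"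
  | Eq mty "('f, 'p, 'g) mterm" "('f, 'p, 'g) mterm"
  | And "('f, 'P, 'p, 'g) fm" "('f, 'P, 'p, 'g) fm"
  | Or "('f, 'P, 'p, 'g) fm" "('f, 'P, 'p, 'g) fm"
  | Imp "('f, 'P, 'p, 'g) fm" "('f, 'P, 'p, 'g) fm"
  | All mty "('f, 'P, 'p, 'g) fm"
  | Exi mty "('f, 'P, 'p, 'g) fm"

abbreviation Neg :: "('f, 'P, 'p, 'g) fm \<Rightarrow> ('f, 'P, 'p, 'g) fm" where
  "Neg \<phi> \<equiv> Imp \<phi> Bot"

text \<open>
  The data of an extension: the constants \<open>\<Lambda>\<^sub>S\<close> of ST with their types; the constants and
  axioms in \<open>\<Gamma>\<^sub>S\<close>; and the terms \<open>[c]\<close> of the metatheory that interpret the constants in \<open>\<Lambda>\<^sub>S\<close>.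
\<close>

record ('f, 'P, 'p, 'k, 'g) extension =
  st_const :: "'k \<rightharpoonup> ty"
  meta_const :: "'g \<rightharpoonup> mty"
  meta_ax :: "('f, 'P, 'p, 'g) fm set"
  interp :: "'k \<Rightarrow> ('f, 'p, 'g) mterm"

definition no_extension :: "('f, 'P, 'p, 'k, 'g) extension" where
  "no_extension =
     \<lparr>st_const = Map.empty, meta_const = Map.empty, meta_ax = {}, interp = (\<lambda>_. Unt)\<rparr>"

inductive st_typing ::
  "('f, 'P, 'p) signature \<Rightarrow> ('f, 'P, 'p, 'k, 'g) extension \<Rightarrow>
   (name \<rightharpoonup> ty) \<Rightarrow> ('f, 'p, 'k) st_term \<Rightarrow> ty \<Rightarrow> bool"
  for \<Sigma> :: "('f, 'P, 'p) signature" and E :: "('f, 'P, 'p, 'k, 'g) extension"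
where
  "\<Delta> x = Some X \<Longrightarrow> st_typing \<Sigma> E \<Delta> (Var x) X"
| "st_typing \<Sigma> E \<Delta> Skip TC"
| "st_typing \<Sigma> E \<Delta> (Default X) X"
| "st_const E c = Some X \<Longrightarrow> st_typing \<Sigma> E \<Delta> (Const c) X"
| "fun_ar \<Sigma> f = Some n \<Longrightarrow> st_typing \<Sigma> E \<Delta> (Fun f) (tpow_fun n TD)"
| "st_typing \<Sigma> E \<Delta> s X \<Longrightarrow> st_typing \<Sigma> E \<Delta> t Y \<Longrightarrow> st_typing \<Sigma> E \<Delta> (Comp s t) (TProd X Y)"
| "st_typing \<Sigma> E \<Delta> t (TProd X Y) \<Longrightarrow> st_typing \<Sigma> E \<Delta> (Prj0 t) X"
| "st_typing \<Sigma> E \<Delta> t (TProd X Y) \<Longrightarrow> st_typing \<Sigma> E \<Delta> (Prj1 t) Y"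
| "st_typing \<Sigma> E \<Delta> t X \<Longrightarrow> st_typing \<Sigma> E \<Delta> (Inj0 Y t) (TSum X Y)"
| "st_typing \<Sigma> E \<Delta> t Y \<Longrightarrow> st_typing \<Sigma> E \<Delta> (Inj1 X t) (TSum X Y)"
| "st_typing \<Sigma> E \<Delta> r (TSum X Y) \<Longrightarrow> st_typing \<Sigma> E \<Delta> s (TFun X Z) \<Longrightarrow>
     st_typing \<Sigma> E \<Delta> t (TFun Y Z) \<Longrightarrow> st_typing \<Sigma> E \<Delta> (CaseOf Z r s t) Z"
| "st_typing \<Sigma> E (\<Delta>(x \<mapsto> X)) t Y \<Longrightarrow> st_typing \<Sigma> E \<Delta> (Abs x X t) (TFun X Y)"
| "st_typing \<Sigma> E \<Delta> t (TFun X Y) \<Longrightarrow> st_typing \<Sigma> E \<Delta> s X \<Longrightarrow> st_typing \<Sigma> E \<Delta> (Ap t s) Y"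
| "wf_sform \<Sigma> 0 \<alpha> \<Longrightarrow> \<forall>x\<in>fv_sform \<alpha>. \<Delta> x = Some TD \<Longrightarrow>
     st_typing \<Sigma> E \<Delta> s X \<Longrightarrow> st_typing \<Sigma> E \<Delta> t X \<Longrightarrow> st_typing \<Sigma> E \<Delta> (Ite X \<alpha> s t) X"

text \<open>In the next two predicates the list gives the types of the indices \<open>BV 0, BV 1, \<dots>\<close>.\<close>

inductive mtyping ::
  "('f, 'P, 'p) signature \<Rightarrow> ('f, 'P, 'p, 'k, 'g) extension \<Rightarrow>
   mty list \<Rightarrow> ('f, 'p, 'g) mterm \<Rightarrow> mty \<Rightarrow> bool"
  for \<Sigma> :: "('f, 'P, 'p) signature" and E :: "('f, 'P, 'p, 'k, 'g) extension"
where
  "mtyping \<Sigma> E bs (FV x X) X"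
| "i < length bs \<Longrightarrow> mtyping \<Sigma> E bs (BV i) (bs ! i)"
| "fun_ar \<Sigma> f = Some n \<Longrightarrow> mtyping \<Sigma> E bs (FunC f) (mpow_fun n MD)"
| "mtyping \<Sigma> E bs Unt MUnit"
| "mtyping \<Sigma> E bs TT MBool"
| "mtyping \<Sigma> E bs FF MBool"
| "mtyping \<Sigma> E bs u X \<Longrightarrow> mtyping \<Sigma> E bs v Y \<Longrightarrow> mtyping \<Sigma> E bs (Pair u v) (MProd X Y)"
| "mtyping \<Sigma> E bs u (MProd X Y) \<Longrightarrow> mtyping \<Sigma> E bs (P0 u) X"
| "mtyping \<Sigma> E bs u (MProd X Y) \<Longrightarrow> mtyping \<Sigma> E bs (P1 u) Y"
| "mtyping \<Sigma> E (X # bs) u Y \<Longrightarrow> mtyping \<Sigma> E bs (Lam X u) (MFun X Y)"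
| "mtyping \<Sigma> E bs u (MFun X Y) \<Longrightarrow> mtyping \<Sigma> E bs v X \<Longrightarrow> mtyping \<Sigma> E bs (App u v) Y"
| "mtyping \<Sigma> E bs (Case X) (MFun MBool (MFun X (MFun X X)))"
| "wf_sform \<Sigma> 0 \<alpha> \<Longrightarrow>
     mtyping \<Sigma> E bs (Chi \<alpha> X) (mpow_fun (card (fv_sform \<alpha>)) (MFun MState (MFun X (MFun X X))))"
| "meta_const E g = Some X \<Longrightarrow> mtyping \<Sigma> E bs (Ext g) X"

fun wf_fm ::
  "('f, 'P, 'p) signature \<Rightarrow> ('f, 'P, 'p, 'k, 'g) extension \<Rightarrow>
   mty list \<Rightarrow> ('f, 'P, 'p, 'g) fm \<Rightarrow> bool" where
  "wf_fm \<Sigma> E bs Top \<longleftrightarrow> True"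
| "wf_fm \<Sigma> E bs Bot \<longleftrightarrow> True"
| "wf_fm \<Sigma> E bs (PAtom P us) \<longleftrightarrow>
     pred_ar \<Sigma> P = Some (length us) \<and> (\<forall>u\<in>set us. mtyping \<Sigma> E bs u MD)"
| "wf_fm \<Sigma> E bs (SAtm p us v) \<longleftrightarrow>
     state_ar \<Sigma> p = Some (length us) \<and> (\<forall>u\<in>set us. mtyping \<Sigma> E bs u MD) \<and> mtyping \<Sigma> E bs v MState"
| "wf_fm \<Sigma> E bs (Eq X u v) \<longleftrightarrow> mtyping \<Sigma> E bs u X \<and> mtyping \<Sigma> E bs v X"
| "wf_fm \<Sigma> E bs (And \<phi> \<psi>) \<longleftrightarrow> wf_fm \<Sigma> E bs \<phi> \<and> wf_fm \<Sigma> E bs \<psi>"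
| "wf_fm \<Sigma> E bs (Or \<phi> \<psi>) \<longleftrightarrow> wf_fm \<Sigma> E bs \<phi> \<and> wf_fm \<Sigma> E bs \<psi>"
| "wf_fm \<Sigma> E bs (Imp \<phi> \<psi>) \<longleftrightarrow> wf_fm \<Sigma> E bs \<phi> \<and> wf_fm \<Sigma> E bs \<psi>"
| "wf_fm \<Sigma> E bs (All X \<phi>) \<longleftrightarrow> wf_fm \<Sigma> E (X # bs) \<phi>"
| "wf_fm \<Sigma> E bs (Exi X \<phi>) \<longleftrightarrow> wf_fm \<Sigma> E (X # bs) \<phi>"

fun fv_mterm :: "('f, 'p, 'g) mterm \<Rightarrow> (name \<times> mty) set" where
  "fv_mterm (FV x X) = {(x, X)}"
| "fv_mterm (Pair u v) = fv_mterm u \<union> fv_mterm v"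
| "fv_mterm (P0 u) = fv_mterm u"
| "fv_mterm (P1 u) = fv_mterm u"
| "fv_mterm (Lam X u) = fv_mterm u"
| "fv_mterm (App u v) = fv_mterm u \<union> fv_mterm v"
| "fv_mterm _ = {}"

fun fv_fm :: "('f, 'P, 'p, 'g) fm \<Rightarrow> (name \<times> mty) set" where
  "fv_fm Top = {}"
| "fv_fm Bot = {}"
| "fv_fm (PAtom P us) = (\<Union>u\<in>set us. fv_mterm u)"
| "fv_fm (SAtm p us v) = (\<Union>u\<in>set us. fv_mterm u) \<union> fv_mterm v"
| "fv_fm (Eq X u v) = fv_mterm u \<union> fv_mterm v"
| "fv_fm (And \<phi> \<psi>) = fv_fm \<phi> \<union> fv_fm \<psi>"
| "fv_fm (Or \<phi> \<psi>) = fv_fm \<phi> \<union> fv_fm \<psi>"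
| "fv_fm (Imp \<phi> \<psi>) = fv_fm \<phi> \<union> fv_fm \<psi>"
| "fv_fm (All X \<phi>) = fv_fm \<phi>"
| "fv_fm (Exi X \<phi>) = fv_fm \<phi>"

text \<open>
  Instantiation of an index by an index-free term; raising by one of the indices from \<open>k\<close> on;
  and \<open>\<lambda>\<close>-abstraction of a named variable in an index-free term.
\<close>

fun inst_mterm :: "nat \<Rightarrow> ('f, 'p, 'g) mterm \<Rightarrow> ('f, 'p, 'g) mterm \<Rightarrow> ('f, 'p, 'g) mterm" where
  "inst_mterm k w (BV i) = (if i = k then w else BV i)"
| "inst_mterm k w (Pair u v) = Pair (inst_mterm k w u) (inst_mterm k w v)"
| "inst_mterm k w (P0 u) = P0 (inst_mterm k w u)"
| "inst_mterm k w (P1 u) = P1 (inst_mterm k w u)"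
| "inst_mterm k w (Lam X u) = Lam X (inst_mterm (Suc k) w u)"
| "inst_mterm k w (App u v) = App (inst_mterm k w u) (inst_mterm k w v)"
| "inst_mterm k w u = u"

fun inst_fm :: "nat \<Rightarrow> ('f, 'p, 'g) mterm \<Rightarrow> ('f, 'P, 'p, 'g) fm \<Rightarrow> ('f, 'P, 'p, 'g) fm" where
  "inst_fm k w Top = Top"
| "inst_fm k w Bot = Bot"
| "inst_fm k w (PAtom P us) = PAtom P (map (inst_mterm k w) us)"
| "inst_fm k w (SAtm p us v) = SAtm p (map (inst_mterm k w) us) (inst_mterm k w v)"
| "inst_fm k w (Eq X u v) = Eq X (inst_mterm k w u) (inst_mterm k w v)"
| "inst_fm k w (And \<phi> \<psi>) = And (inst_fm k w \<phi>) (inst_fm k w \<psi>)"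
| "inst_fm k w (Or \<phi> \<psi>) = Or (inst_fm k w \<phi>) (inst_fm k w \<psi>)"
| "inst_fm k w (Imp \<phi> \<psi>) = Imp (inst_fm k w \<phi>) (inst_fm k w \<psi>)"
| "inst_fm k w (All X \<phi>) = All X (inst_fm (Suc k) w \<phi>)"
| "inst_fm k w (Exi X \<phi>) = Exi X (inst_fm (Suc k) w \<phi>)"

fun lift :: "nat \<Rightarrow> ('f, 'p, 'g) mterm \<Rightarrow> ('f, 'p, 'g) mterm" where
  "lift k (BV i) = BV (if i < k then i else Suc i)"
| "lift k (Pair u v) = Pair (lift k u) (lift k v)"
| "lift k (P0 u) = P0 (lift k u)"
| "lift k (P1 u) = P1 (lift k u)"
| "lift k (Lam X u) = Lam X (lift (Suc k) u)"
| "lift k (App u v) = App (lift k u) (lift k v)"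
| "lift k u = u"

fun bind :: "nat \<Rightarrow> name \<Rightarrow> mty \<Rightarrow> ('f, 'p, 'g) mterm \<Rightarrow> ('f, 'p, 'g) mterm" where
  "bind k x X (FV y Y) = (if y = x \<and> Y = X then BV k else FV y Y)"
| "bind k x X (Pair u v) = Pair (bind k x X u) (bind k x X v)"
| "bind k x X (P0 u) = P0 (bind k x X u)"
| "bind k x X (P1 u) = P1 (bind k x X u)"
| "bind k x X (Lam Y u) = Lam Y (bind (Suc k) x X u)"
| "bind k x X (App u v) = App (bind k x X u) (bind k x X v)"
| "bind k x X u = u"

definition lam :: "name \<Rightarrow> mty \<Rightarrow> ('f, 'p, 'g) mterm \<Rightarrow> ('f, 'p, 'g) mterm" where
  "lam x X u = Lam X (bind 0 x X u)"

fun tuple :: "('f, 'p, 'g) mterm list \<Rightarrow> ('f, 'p, 'g) mterm" where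
  "tuple [] = Unt"
| "tuple [u] = u"
| "tuple (u # v # us) = Pair u (tuple (v # us))"

definition app_tuple :: "('f, 'p, 'g) mterm \<Rightarrow> ('f, 'p, 'g) mterm list \<Rightarrow> ('f, 'p, 'g) mterm" where
  "app_tuple h us = (if us = [] then h else App h (tuple us))"

text \<open>
  \<open>chi_app \<alpha> X \<pi> y z\<close> is \<open>\<chi>\<^sub>\<alpha> \<langle>x\<^sub>1, \<dots>, x\<^sub>n\<rangle> \<pi> y z\<close>, where \<open>x\<^sub>1, \<dots>, x\<^sub>n\<close> are the free variables of
  \<open>\<alpha>\<close> in increasing order.
\<close>

definition chi_app ::
  "('f, 'p) sform \<Rightarrow> mty \<Rightarrow> ('f, 'p, 'g) mterm \<Rightarrow> ('f, 'p, 'g) mterm \<Rightarrow> ('f, 'p, 'g) mterm \<Rightarrow>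
   ('f, 'p, 'g) mterm" where
  "chi_app \<alpha> X \<pi> y z =
     App (App (App (app_tuple (Chi \<alpha> X)
       (map (\<lambda>x. FV x MD) (sorted_list_of_set (fv_sform \<alpha>)))) \<pi>) y) z"


section \<open>Embeddings\<close>

text \<open>
  First-order terms and state formulas are read in an environment \<open>e\<close>, the list of the metaterms
  that are substituted for \<open>Bound 0, Bound 1, \<dots>\<close>. It is empty for formulas without dangling indices.
\<close>

fun emb_term :: "('f, 'p, 'g) mterm list \<Rightarrow> 'f fo_term \<Rightarrow> ('f, 'p, 'g) mterm" where
  "emb_term e (Free x) = FV x MD"
| "emb_term e (Bound i) = e ! i"
| "emb_term e (Fn f ts) = app_tuple (FunC f) (map (emb_term e) ts)"

fun emb_sform ::
  "('f, 'p, 'g) mterm list \<Rightarrow> ('f, 'p) sform \<Rightarrow> ('f, 'p, 'g) mterm \<Rightarrow> ('f, 'P, 'p, 'g) fm" where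
  "emb_sform e STop \<pi> = Top"
| "emb_sform e SBot \<pi> = Bot"
| "emb_sform e (SAtom p ts) \<pi> = SAtm p (map (emb_term e) ts) \<pi>"
| "emb_sform e (SAnd \<alpha> \<beta>) \<pi> = And (emb_sform e \<alpha> \<pi>) (emb_sform e \<beta> \<pi>)"
| "emb_sform e (SOr \<alpha> \<beta>) \<pi> = Or (emb_sform e \<alpha> \<pi>) (emb_sform e \<beta> \<pi>)"
| "emb_sform e (SImp \<alpha> \<beta>) \<pi> = Imp (emb_sform e \<alpha> \<pi>) (emb_sform e \<beta> \<pi>)"

fun emb_ty :: "ty \<Rightarrow> mty" where
  "emb_ty TD = MD"
| "emb_ty TC = MUnit"
| "emb_ty (TProd X Y) = MProd (emb_ty X) (emb_ty Y)"
| "emb_ty (TSum X Y) = MProd MBool (MProd (emb_ty X) (emb_ty Y))"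
| "emb_ty (TFun X Y) = MFun (emb_ty X) (MFun MState (MProd (emb_ty Y) MState))"

fun zero :: "('f, 'P, 'p) signature \<Rightarrow> ty \<Rightarrow> ('f, 'p, 'g) mterm" where
  "zero \<Sigma> TD = FunC (const \<Sigma>)"
| "zero \<Sigma> TC = Unt"
| "zero \<Sigma> (TProd X Y) = Pair (zero \<Sigma> X) (zero \<Sigma> Y)"
| "zero \<Sigma> (TSum X Y) = Pair FF (Pair (zero \<Sigma> X) (zero \<Sigma> Y))"
| "zero \<Sigma> (TFun X Y) = Lam (emb_ty X) (Lam MState (Pair (zero \<Sigma> Y) (BV 0)))"

text \<open>
  The typing context \<open>\<Delta>\<close> determines the sorts of the free variables of \<open>[t]\<close>. Each \<open>[t]\<close> is free of
  dangling indices, so it can be put below \<open>\<lambda>\<pi>\<close> without lifting; there \<open>BV 0\<close> is \<open>\<pi>\<close>.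
  A result \<open>\<langle>a, b, \<pi>\<rangle>\<close> of type \<open>[X \<times> Y] \<times> S\<close> is \<open>\<langle>\<langle>a, b\<rangle>, \<pi>\<rangle>\<close>, and similarly for sum types.
\<close>

fun emb ::
  "('f, 'P, 'p) signature \<Rightarrow> ('f, 'P, 'p, 'k, 'g) extension \<Rightarrow> (name \<rightharpoonup> ty) \<Rightarrow>
   ('f, 'p, 'k) st_term \<Rightarrow> ('f, 'p, 'g) mterm" where
  "emb \<Sigma> E \<Delta> (Var x) = Lam MState (Pair (FV x (emb_ty (the (\<Delta> x)))) (BV 0))"
| "emb \<Sigma> E \<Delta> Skip = Lam MState (Pair Unt (BV 0))"
| "emb \<Sigma> E \<Delta> (Default X) = Lam MState (Pair (zero \<Sigma> X) (BV 0))"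
| "emb \<Sigma> E \<Delta> (Const c) = interp E c"
| "emb \<Sigma> E \<Delta> (Fun f) =
     (let n = the (fun_ar \<Sigma> f)
      in Lam MState (Pair
           (if n = 0 then FunC f
            else Lam (mpow n) (Lam MState (Pair (App (FunC f) (BV 1)) (BV 0))))
           (BV 0)))"
| "emb \<Sigma> E \<Delta> (Comp s t) = Lam MState
     (let u = App (emb \<Sigma> E \<Delta> s) (BV 0); a = P0 u; \<pi>1 = P1 u;
          v = App (emb \<Sigma> E \<Delta> t) \<pi>1; b = P0 v; \<pi>2 = P1 v
      in Pair (Pair a b) \<pi>2)"
| "emb \<Sigma> E \<Delta> (Prj0 t) = Lam MState
     (let u = App (emb \<Sigma> E \<Delta> t) (BV 0) in Pair (P0 (P0 u)) (P1 u))"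
| "emb \<Sigma> E \<Delta> (Prj1 t) = Lam MState
     (let u = App (emb \<Sigma> E \<Delta> t) (BV 0) in Pair (P1 (P0 u)) (P1 u))"
| "emb \<Sigma> E \<Delta> (Inj0 Y t) = Lam MState
     (let u = App (emb \<Sigma> E \<Delta> t) (BV 0); a = P0 u; \<pi>1 = P1 u
      in Pair (Pair FF (Pair a (zero \<Sigma> Y))) \<pi>1)"
| "emb \<Sigma> E \<Delta> (Inj1 X t) = Lam MState
     (let u = App (emb \<Sigma> E \<Delta> t) (BV 0); a = P0 u; \<pi>1 = P1 u
      in Pair (Pair TT (Pair (zero \<Sigma> X) a)) \<pi>1)"
| "emb \<Sigma> E \<Delta> (CaseOf Z r s t) = Lam MState
     (let u = App (emb \<Sigma> E \<Delta> r) (BV 0);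
          e = P0 (P0 u); a = P0 (P1 (P0 u)); b = P1 (P1 (P0 u)); \<pi>1 = P1 u;
          v = App (emb \<Sigma> E \<Delta> s) \<pi>1; f = P0 v; \<pi>2 = P1 v;
          w = App (emb \<Sigma> E \<Delta> t) \<pi>1; g = P0 w; \<pi>3 = P1 w
      in App (App (App (Case (MProd (emb_ty Z) MState)) e) (App (App f a) \<pi>2)) (App (App g b) \<pi>3))"
| "emb \<Sigma> E \<Delta> (Abs x X t) =
     Lam MState (Pair (lam x (emb_ty X) (emb \<Sigma> E (\<Delta>(x \<mapsto> X)) t)) (BV 0))"
| "emb \<Sigma> E \<Delta> (Ap t s) = Lam MState
     (let u = App (emb \<Sigma> E \<Delta> t) (BV 0); f = P0 u; \<pi>1 = P1 u;
          v = App (emb \<Sigma> E \<Delta> s) \<pi>1; a = P0 v; \<pi>2 = P1 v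
      in App (App f a) \<pi>2)"
| "emb \<Sigma> E \<Delta> (Ite X \<alpha> s t) = Lam MState
     (chi_app \<alpha> (MProd (emb_ty X) MState) (BV 0)
        (App (emb \<Sigma> E \<Delta> s) (BV 0)) (App (emb \<Sigma> E \<Delta> t) (BV 0)))"

definition wf_extension ::
  "('f, 'P, 'p) signature \<Rightarrow> ('f, 'P, 'p, 'k, 'g) extension \<Rightarrow> bool" where
  "wf_extension \<Sigma> E \<longleftrightarrow>
     (\<forall>\<phi>\<in>meta_ax E. wf_fm \<Sigma> E [] \<phi>) \<and>
     (\<forall>c X. st_const E c = Some X \<longrightarrow>
        fv_mterm (interp E c) = {} \<and>
        mtyping \<Sigma> E [] (interp E c) (MFun MState (MProd (emb_ty X) MState)))"


section \<open>Provability in the metatheory\<close>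

text \<open>
  Intuitionistic natural deduction with equality. The axioms in \<open>\<Gamma>\<^sub>S\<close> are not assumptions: their free
  variables may be generalized. Three principles are implicit in the description of the
  metatheory: surjective pairing (as part of extensionality), \<open>true \<noteq> false\<close>, and decidability
  of (embedded) state formulas. Without \<open>true \<noteq> false\<close> the realizers of disjunctions are not
  correct, and without decidability the excluded middle for state formulas is not sound: for
  intuitionistic logic it does not follow from the equations for \<open>\<chi>\<^sub>\<alpha>\<close>.
\<close>

inductive prv ::
  "('f, 'P, 'p) signature \<Rightarrow> ('f, 'P, 'p, 'k, 'g) extension \<Rightarrow>
   ('f, 'P, 'p, 'g) fm set \<Rightarrow> ('f, 'P, 'p, 'g) fm \<Rightarrow> bool"
  for \<Sigma> :: "('f, 'P, 'p) signature" and E :: "('f, 'P, 'p, 'k, 'g) extension"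
where
  M_assm: "\<phi> \<in> \<Phi> \<Longrightarrow> wf_fm \<Sigma> E [] \<phi> \<Longrightarrow> prv \<Sigma> E \<Phi> \<phi>"
| M_weaken: "prv \<Sigma> E \<Phi> \<phi> \<Longrightarrow> \<Phi> \<subseteq> \<Psi> \<Longrightarrow> prv \<Sigma> E \<Psi> \<phi>"
| M_ax: "\<phi> \<in> meta_ax E \<Longrightarrow> wf_fm \<Sigma> E [] \<phi> \<Longrightarrow> prv \<Sigma> E \<Phi> \<phi>"

| M_topI: "prv \<Sigma> E \<Phi> Top"
| M_botE: "prv \<Sigma> E \<Phi> Bot \<Longrightarrow> wf_fm \<Sigma> E [] \<phi> \<Longrightarrow> prv \<Sigma> E \<Phi> \<phi>"
| M_andI: "prv \<Sigma> E \<Phi> \<phi> \<Longrightarrow> prv \<Sigma> E \<Phi> \<psi> \<Longrightarrow> prv \<Sigma> E \<Phi> (And \<phi> \<psi>)"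
| M_andE1: "prv \<Sigma> E \<Phi> (And \<phi> \<psi>) \<Longrightarrow> prv \<Sigma> E \<Phi> \<phi>"
| M_andE2: "prv \<Sigma> E \<Phi> (And \<phi> \<psi>) \<Longrightarrow> prv \<Sigma> E \<Phi> \<psi>"
| M_orI1: "prv \<Sigma> E \<Phi> \<phi> \<Longrightarrow> wf_fm \<Sigma> E [] \<psi> \<Longrightarrow> prv \<Sigma> E \<Phi> (Or \<phi> \<psi>)"
| M_orI2: "prv \<Sigma> E \<Phi> \<psi> \<Longrightarrow> wf_fm \<Sigma> E [] \<phi> \<Longrightarrow> prv \<Sigma> E \<Phi> (Or \<phi> \<psi>)"
| M_orE: "prv \<Sigma> E \<Phi> (Or \<phi> \<psi>) \<Longrightarrow> prv \<Sigma> E (insert \<phi> \<Phi>) \<chi> \<Longrightarrow> prv \<Sigma> E (insert \<psi> \<Phi>) \<chi> \<Longrightarrow> prv \<Sigma> E \<Phi> \<chi>"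
| M_impI: "prv \<Sigma> E (insert \<phi> \<Phi>) \<psi> \<Longrightarrow> wf_fm \<Sigma> E [] \<phi> \<Longrightarrow> prv \<Sigma> E \<Phi> (Imp \<phi> \<psi>)"
| M_impE: "prv \<Sigma> E \<Phi> (Imp \<phi> \<psi>) \<Longrightarrow> prv \<Sigma> E \<Phi> \<phi> \<Longrightarrow> prv \<Sigma> E \<Phi> \<psi>"
| M_allI: "prv \<Sigma> E \<Phi> (inst_fm 0 (FV y X) \<phi>) \<Longrightarrow> (y, X) \<notin> fv_fm \<phi> \<union> (\<Union>\<psi>\<in>\<Phi>. fv_fm \<psi>) \<Longrightarrow>
    prv \<Sigma> E \<Phi> (All X \<phi>)"
| M_allE: "prv \<Sigma> E \<Phi> (All X \<phi>) \<Longrightarrow> mtyping \<Sigma> E [] u X \<Longrightarrow> prv \<Sigma> E \<Phi> (inst_fm 0 u \<phi>)"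
| M_exI: "prv \<Sigma> E \<Phi> (inst_fm 0 u \<phi>) \<Longrightarrow> mtyping \<Sigma> E [] u X \<Longrightarrow> wf_fm \<Sigma> E [X] \<phi> \<Longrightarrow> prv \<Sigma> E \<Phi> (Exi X \<phi>)"
| M_exE: "prv \<Sigma> E \<Phi> (Exi X \<phi>) \<Longrightarrow> prv \<Sigma> E (insert (inst_fm 0 (FV y X) \<phi>) \<Phi>) \<psi> \<Longrightarrow>
    (y, X) \<notin> fv_fm \<phi> \<union> fv_fm \<psi> \<union> (\<Union>\<chi>\<in>\<Phi>. fv_fm \<chi>) \<Longrightarrow> prv \<Sigma> E \<Phi> \<psi>"

| M_refl: "mtyping \<Sigma> E [] u X \<Longrightarrow> prv \<Sigma> E \<Phi> (Eq X u u)"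
| M_subst: "prv \<Sigma> E \<Phi> (Eq X u v) \<Longrightarrow> prv \<Sigma> E \<Phi> (inst_fm 0 u \<phi>) \<Longrightarrow> wf_fm \<Sigma> E [X] \<phi> \<Longrightarrow>
    prv \<Sigma> E \<Phi> (inst_fm 0 v \<phi>)"

| M_beta: "mtyping \<Sigma> E [X] u Y \<Longrightarrow> mtyping \<Sigma> E [] v X \<Longrightarrow>
    prv \<Sigma> E \<Phi> (Eq Y (App (Lam X u) v) (inst_mterm 0 v u))"
| M_ext: "mtyping \<Sigma> E [] u (MFun X Y) \<Longrightarrow> mtyping \<Sigma> E [] v (MFun X Y) \<Longrightarrow>
    prv \<Sigma> E \<Phi> (All X (Eq Y (App u (BV 0)) (App v (BV 0)))) \<Longrightarrow> prv \<Sigma> E \<Phi> (Eq (MFun X Y) u v)"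
| M_proj0: "mtyping \<Sigma> E [] u X \<Longrightarrow> mtyping \<Sigma> E [] v Y \<Longrightarrow> prv \<Sigma> E \<Phi> (Eq X (P0 (Pair u v)) u)"
| M_proj1: "mtyping \<Sigma> E [] u X \<Longrightarrow> mtyping \<Sigma> E [] v Y \<Longrightarrow> prv \<Sigma> E \<Phi> (Eq Y (P1 (Pair u v)) v)"
| M_pair: "mtyping \<Sigma> E [] u (MProd X Y) \<Longrightarrow> prv \<Sigma> E \<Phi> (Eq (MProd X Y) (Pair (P0 u) (P1 u)) u)"
| M_unit: "mtyping \<Sigma> E [] u MUnit \<Longrightarrow> prv \<Sigma> E \<Phi> (Eq MUnit u Unt)"

| M_bool: "mtyping \<Sigma> E [] u MBool \<Longrightarrow> prv \<Sigma> E \<Phi> (Or (Eq MBool u TT) (Eq MBool u FF))"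
| M_distinct: "prv \<Sigma> E \<Phi> (Neg (Eq MBool TT FF))"
| M_case_FF: "mtyping \<Sigma> E [] u X \<Longrightarrow> mtyping \<Sigma> E [] v X \<Longrightarrow>
    prv \<Sigma> E \<Phi> (Eq X (App (App (App (Case X) FF) u) v) u)"
| M_case_TT: "mtyping \<Sigma> E [] u X \<Longrightarrow> mtyping \<Sigma> E [] v X \<Longrightarrow>
    prv \<Sigma> E \<Phi> (Eq X (App (App (App (Case X) TT) u) v) v)"

| M_chi_pos: "wf_sform \<Sigma> 0 \<alpha> \<Longrightarrow> mtyping \<Sigma> E [] \<pi> MState \<Longrightarrow> mtyping \<Sigma> E [] u X \<Longrightarrow> mtyping \<Sigma> E [] v X \<Longrightarrow>
    prv \<Sigma> E \<Phi> (Imp (emb_sform [] \<alpha> \<pi>) (Eq X (chi_app \<alpha> X \<pi> u v) u))"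
| M_chi_neg: "wf_sform \<Sigma> 0 \<alpha> \<Longrightarrow> mtyping \<Sigma> E [] \<pi> MState \<Longrightarrow> mtyping \<Sigma> E [] u X \<Longrightarrow> mtyping \<Sigma> E [] v X \<Longrightarrow>
    prv \<Sigma> E \<Phi> (Imp (Neg (emb_sform [] \<alpha> \<pi>)) (Eq X (chi_app \<alpha> X \<pi> u v) v))"
| M_state_dec: "wf_sform \<Sigma> 0 \<alpha> \<Longrightarrow> mtyping \<Sigma> E [] \<pi> MState \<Longrightarrow>
    prv \<Sigma> E \<Phi> (Or (emb_sform [] \<alpha> \<pi>) (Neg (emb_sform [] \<alpha> \<pi>)))"


section \<open>Realizability\<close>

fun tau :: "('f, 'P, 'p) mform \<Rightarrow> ty" where
  "tau MTop = TC"
| "tau MBot = TC"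
| "tau (MAtom P ts) = TC"
| "tau (MAnd A B) = TProd (tau A) (tau B)"
| "tau (MOr A B) = TSum (tau A) (tau B)"
| "tau (MEx A) = TProd TD (tau A)"
| "tau (MImp A \<alpha> B \<beta>) = TFun (tau A) (tau B)"
| "tau (MAll \<alpha> A \<beta>) = TFun TD (tau A)"

text \<open>
  \<open>sr e u A\<close> is \<open>u sr A\<close> and \<open>hsr e u \<alpha> A \<beta>\<close> is \<open>u sr {\<alpha>} A {\<beta>}\<close>, in an environment \<open>e\<close> as above. The
  substitution in \<open>(proj\<^sub>1 u sr A)[proj\<^sub>0 u/y]\<close> amounts to an extension of the environment. Terms
  are lifted when they move below a quantifier.
\<close>

fun sr ::
    "('f, 'p, 'g) mterm list \<Rightarrow> ('f, 'p, 'g) mterm \<Rightarrow> ('f, 'P, 'p) mform \<Rightarrow> ('f, 'P, 'p, 'g) fm"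
  and hsr ::
    "('f, 'p, 'g) mterm list \<Rightarrow> ('f, 'p, 'g) mterm \<Rightarrow> ('f, 'p) sform \<Rightarrow> ('f, 'P, 'p) mform \<Rightarrow>
     ('f, 'p) sform \<Rightarrow> ('f, 'P, 'p, 'g) fm" where
  "sr e u MTop = Top"
| "sr e u MBot = Bot"
| "sr e u (MAtom P ts) = PAtom P (map (emb_term e) ts)"
| "sr e u (MAnd A B) = And (sr e (P0 u) A) (sr e (P1 u) B)"
| "sr e u (MOr A B) =
     And (Imp (Eq MBool (P0 u) FF) (sr e (P0 (P1 u)) A))
         (Imp (Eq MBool (P0 u) TT) (sr e (P1 (P1 u)) B))"
| "sr e u (MEx A) = sr (P0 u # e) (P1 u) A"
| "sr e u (MImp A \<alpha> B \<beta>) =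
     (let e' = map (lift 0) e; u' = lift 0 u; x = BV 0
      in All (emb_ty (tau A)) (Imp (sr e' x A) (hsr e' (App u' x) \<alpha> B \<beta>)))"
| "sr e u (MAll \<alpha> A \<beta>) =
     (let e' = map (lift 0) e; u' = lift 0 u; x = BV 0
      in All MD (hsr (x # e') (App u' x) \<alpha> A \<beta>))"
| "hsr e u \<alpha> A \<beta> =
     (let e' = map (lift 0) e; u' = lift 0 u; \<pi> = BV 0
      in All MState (Imp (emb_sform e' \<alpha> \<pi>)
           (And (sr e' (P0 (App u' \<pi>)) A) (emb_sform e' \<beta> (P1 (App u' \<pi>))))))"


section \<open>Contexts and assumptions of realizers\<close>

definition fv_sequent ::
  "('f, 'P, 'p) mform list \<Rightarrow> ('f, 'p) sform \<Rightarrow> ('f, 'P, 'p) mform \<Rightarrow> ('f, 'p) sform \<Rightarrow> name set" where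
  "fv_sequent As \<alpha> A \<beta> =
     (\<Union>B\<in>set As. fv_mform B) \<union> fv_sform \<alpha> \<union> fv_mform A \<union> fv_sform \<beta>"

text \<open>The context \<open>\<Delta>, x\<^sub>1 : \<tau>(A\<^sub>1), \<dots>, x\<^sub>n : \<tau>(A\<^sub>n)\<close> where \<open>\<Delta>\<close> assigns \<open>D\<close> to the names in \<open>V\<close>.\<close>

definition realizer_ctx :: "name set \<Rightarrow> name list \<Rightarrow> ('f, 'P, 'p) mform list \<Rightarrow> (name \<rightharpoonup> ty)" where
  "realizer_ctx V xs As = (\<lambda>y. if y \<in> V then Some TD else None) ++ map_of (zip xs (map tau As))"

definition realizer_assms ::
  "name list \<Rightarrow> ('f, 'P, 'p) mform list \<Rightarrow> ('f, 'P, 'p, 'g) fm set" where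
  "realizer_assms xs As = {sr [] (FV x (emb_ty (tau A))) A |x A. (x, A) \<in> set (zip xs As)}"

fun conj_list :: "('f, 'P, 'p, 'g) fm list \<Rightarrow> ('f, 'P, 'p, 'g) fm" where
  "conj_list [] = Top"
| "conj_list [\<phi>] = \<phi>"
| "conj_list (\<phi> # \<psi> # \<phi>s) = And \<phi> (conj_list (\<psi> # \<phi>s))"

end

theory Submission
  imports Defs
begin

text \<open>
  Provability of \<open>u sr {\<alpha>} A {\<beta>}\<close> from \<open>\<Phi>\<close> has a Kripke-style reading: whenever a finite \<open>\<Psi> \<supseteq> \<Phi>\<close> proves
  \<open>[\<alpha>](s)\<close> for a state term \<open>s\<close>, it proves that the value of \<open>u s\<close> realizes \<open>A\<close> and that its final state
  satisfies \<open>[\<beta>]\<close>. In this reading, each rule of SL is matched by a term constructor of ST, whose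
  evaluation order threads the state through the premises in the same way as the rule does.

  A derivation may use first-order variables that are absent from its conclusion. Realizers are
  therefore built by induction in contexts with finitely many additional variables of type \<open>D\<close>,
  and for all sufficiently fresh names of the assumptions. At the end, \<open>\<forall>\<close>-introduction and elimination
  replace the additional variables by the constant of the signature, and \<open>\<Rightarrow>\<close>-introduction and
  elimination rename the assumptions. The latter also plugs the given realizers of axioms
  into the context at hand.
\<close>

subsection \<open>Typing and substitution\<close>

text \<open>No operation substitutes metaterms for the named variables of \<open>[t]\<close>.
  Arguments reach a program only through its own variable (\<open>beta_lam\<close>) and the
  quantifier rules of the metatheory, so the rules that discharge an assumption are proved for a
  generic variable, which is then generalized.

  The set \<open>\<Psi>\<close> in the Kripke reading grows because the precondition of a generic
  state is assumed, and it is kept finite so that a fresh name for that state exists.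

  The hard rule is the elimination of \<exists>: its witness at run time is a projection of a
  variable, which no first-order term denotes, whereas instances in SL are formed with first-order
  terms only. Environments bridge the gap.

  Sorts keep names apart: first-order variables have sort \<open>MD\<close>, states
  \<open>MState\<close>, and no realizer has either sort.\<close>

lemmas mtyping_FV = mtyping.intros(1)
  and mtyping_BV = mtyping.intros(2)
  and mtyping_FunC = mtyping.intros(3)
  and mtyping_Unt = mtyping.intros(4)
  and mtyping_TT = mtyping.intros(5)
  and mtyping_FF = mtyping.intros(6)
  and mtyping_Pair = mtyping.intros(7)
  and mtyping_P0 = mtyping.intros(8)
  and mtyping_P1 = mtyping.intros(9)
  and mtyping_Lam = mtyping.intros(10)
  and mtyping_App = mtyping.intros(11)
  and mtyping_Case = mtyping.intros(12)
  and mtyping_Chi = mtyping.intros(13)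

lemmas st_typing_Fun = st_typing.intros(5)
  and st_typing_Comp = st_typing.intros(6)
  and st_typing_Prj0 = st_typing.intros(7)
  and st_typing_Prj1 = st_typing.intros(8)
  and st_typing_Ap = st_typing.intros(13)

lemma mtyping_BV0: "mtyping \<Sigma> E (X # bs) (BV 0) X"
  using mtyping_BV[of 0 "X # bs"] by simp

lemma mtyping_BV1: "mtyping \<Sigma> E (X # Y # bs) (BV (Suc 0)) Y"
  using mtyping_BV[of "Suc 0" "X # Y # bs"] by simp

lemma mtyping_weaken:
  "mtyping \<Sigma> E bs u X \<Longrightarrow> mtyping \<Sigma> E (bs @ cs) u X"
proof (induction rule: mtyping.induct)
  case (2 i bs)
  then show ?case using mtyping_BV[of i "bs @ cs"] by (simp add: nth_append)
qed (auto intro: mtyping.intros)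

lemma mtyping_closed_weaken:
  "mtyping \<Sigma> E [] u X \<Longrightarrow> mtyping \<Sigma> E bs u X"
  using mtyping_weaken[of \<Sigma> E "[]"] by simp

lemma mtyping_inst_id:
  "mtyping \<Sigma> E bs u X \<Longrightarrow> length bs \<le> k \<Longrightarrow> inst_mterm k w u = u"
  by (induction arbitrary: k rule: mtyping.induct) auto

lemma mtyping_lift_id:
  "mtyping \<Sigma> E bs u X \<Longrightarrow> length bs \<le> k \<Longrightarrow> lift k u = u"
  by (induction arbitrary: k rule: mtyping.induct) auto

text \<open>As simp rules, this and \<open>closed_lift\<close> erase the instantiations and lifts of
  every metaterm that is known to be typed without indices. Later computations with embedded
  programs rely on it.\<close>

lemma closed_inst [simp]: "mtyping \<Sigma> E [] u X \<Longrightarrow> inst_mterm k w u = u"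
  by (rule mtyping_inst_id) auto

lemma closed_lift [simp]: "mtyping \<Sigma> E [] u X \<Longrightarrow> lift k u = u"
  by (rule mtyping_lift_id) auto

text \<open>The prefix \<open>bs1\<close> collects the binders passed so far; the new type enters
  behind it, exactly where \<open>lift\<close> starts to shift.\<close>

lemma mtyping_lift_aux:
  "mtyping \<Sigma> E bs u X \<Longrightarrow> bs = bs1 @ bs2 \<Longrightarrow> mtyping \<Sigma> E (bs1 @ Y # bs2) (lift (length bs1) u) X"
proof (induction arbitrary: bs1 rule: mtyping.induct)
  case (2 i bs)
  show ?case
  proof (cases "i < length bs1")
    case True
    then show ?thesis
      using 2 mtyping_BV[of i "bs1 @ Y # bs2"] by (simp add: nth_append)
  next
    case False
    then show ?thesis
      using 2 mtyping_BV[of "Suc i" "bs1 @ Y # bs2"] by (simp add: nth_append Suc_diff_le)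
  qed
next
  case (10 X bs u Z)
  have "mtyping \<Sigma> E ((X # bs1) @ Y # bs2) (lift (length (X # bs1)) u) Z"
    using 10 by (metis append_Cons)
  then show ?case by (auto intro: mtyping.intros)
qed (auto intro: mtyping.intros)

lemma mtyping_lift: "mtyping \<Sigma> E bs u X \<Longrightarrow> mtyping \<Sigma> E (Y # bs) (lift 0 u) X"
  using mtyping_lift_aux[of \<Sigma> E bs u X "[]" bs Y] by simp

text \<open>The instantiated index is the outermost one, hence the last entry of the list, so the
  remaining indices keep their numbers. As \<open>v\<close> is closed, it can be placed under any
  \<open>Lam\<close> without lifting.\<close>

lemma mtyping_inst_aux:
  "mtyping \<Sigma> E cs u Y \<Longrightarrow> cs = bs @ [X] \<Longrightarrow> mtyping \<Sigma> E [] v X \<Longrightarrow>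
    mtyping \<Sigma> E bs (inst_mterm (length bs) v u) Y"
proof (induction arbitrary: bs rule: mtyping.induct)
  case (2 i cs)
  show ?case
  proof (cases "i < length bs")
    case True
    then show ?thesis using 2 mtyping_BV[of i bs] by (simp add: nth_append)
  next
    case False
    then have "i = length bs" using 2 by simp
    then show ?thesis using 2 by (simp add: nth_append mtyping_closed_weaken)
  qed
next
  case (10 Z cs u Y)
  have "mtyping \<Sigma> E (Z # bs) (inst_mterm (length (Z # bs)) v u) Y"
    using 10 by (metis append_Cons)
  then show ?case by (auto intro: mtyping.intros)
qed (auto intro: mtyping.intros)

lemma mtyping_inst:
  "mtyping \<Sigma> E [X] u Y \<Longrightarrow> mtyping \<Sigma> E [] v X \<Longrightarrow> mtyping \<Sigma> E [] (inst_mterm 0 v u) Y"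
  using mtyping_inst_aux[of \<Sigma> E "[X]" u Y "[]" X v] by simp

lemma mtyping_bind:
  "mtyping \<Sigma> E bs u Y \<Longrightarrow> mtyping \<Sigma> E (bs @ [X]) (bind (length bs) x X u) Y"
proof (induction rule: mtyping.induct)
  case (1 bs y Z)
  then show ?case using mtyping_BV[of "length bs" "bs @ [X]"]
    by (auto intro: mtyping.intros)
next
  case (2 i bs)
  then show ?case using mtyping_BV[of i "bs @ [X]"] by (simp add: nth_append)
qed (auto intro: mtyping.intros)

lemma mtyping_lam:
  "mtyping \<Sigma> E [] u Y \<Longrightarrow> mtyping \<Sigma> E [] (lam x X u) (MFun X Y)"
  using mtyping_bind[of \<Sigma> E "[]"] by (auto simp: lam_def intro: mtyping.intros)

text \<open>Typing excludes the index \<open>length bs\<close> from \<open>u\<close>, so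
  instantiation meets only the occurrences that \<open>bind\<close> has created.\<close>

lemma inst_bind_aux:
  "mtyping \<Sigma> E bs u Y \<Longrightarrow> inst_mterm (length bs) (FV x X) (bind (length bs) x X u) = u"
  by (induction rule: mtyping.induct) auto

lemma inst_bind:
  "mtyping \<Sigma> E [] u Y \<Longrightarrow> inst_mterm 0 (FV x X) (bind 0 x X u) = u"
  using inst_bind_aux[of \<Sigma> E "[]"] by simp

lemma fv_bind: "fv_mterm (bind k x X u) = fv_mterm u - {(x, X)}"
  by (induction u arbitrary: k) auto

lemma fv_lift [simp]: "fv_mterm (lift k u) = fv_mterm u"
  by (induction u arbitrary: k) auto

lemma finite_fv_mterm [simp]: "finite (fv_mterm u)"
  by (induction u) auto

lemma finite_fv_fm [simp]: "finite (fv_fm \<phi>)"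
  by (induction \<phi>) auto

lemma finite_fv_term [simp]: "finite (fv_term t)"
  by (induction t) auto

lemma finite_fv_sform [simp]: "finite (fv_sform \<alpha>)"
  by (induction \<alpha>) auto

lemma finite_fv_mform [simp]: "finite (fv_mform A)"
  by (induction A) auto

text \<open>Lifting from \<open>j \<le> k\<close> on moves the index \<open>k\<close> to
  \<open>Suc k\<close>, and the closed \<open>w\<close> is itself unaffected. This is the step
  needed whenever instantiation passes below a quantifier of a realizability formula.\<close>

lemma inst_lift:
  assumes "mtyping \<Sigma> E [] w X"
  shows "j \<le> k \<Longrightarrow> inst_mterm (Suc k) w (lift j u) = lift j (inst_mterm k w u)"
  using assms by (induction u arbitrary: j k) auto

lemma mtyping_tuple:
  "\<forall>u\<in>set us. mtyping \<Sigma> E bs u MD \<Longrightarrow> mtyping \<Sigma> E bs (tuple us) (mpow (length us))"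
  by (induction us rule: tuple.induct) (auto intro: mtyping.intros)

lemma mtyping_app_tuple:
  "mtyping \<Sigma> E bs h (mpow_fun (length us) X) \<Longrightarrow> \<forall>u\<in>set us. mtyping \<Sigma> E bs u MD \<Longrightarrow>
    mtyping \<Sigma> E bs (app_tuple h us) X"
  using mtyping_tuple[of us \<Sigma> E bs]
  by (auto simp: app_tuple_def mpow_fun_def intro: mtyping.intros)

lemma inst_tuple: "inst_mterm k w (tuple us) = tuple (map (inst_mterm k w) us)"
  by (induction us rule: tuple.induct) auto

lemma inst_app_tuple:
  "inst_mterm k w (app_tuple h us) = app_tuple (inst_mterm k w h) (map (inst_mterm k w) us)"
  by (simp add: app_tuple_def inst_tuple)

lemma lift_tuple: "lift k (tuple us) = tuple (map (lift k) us)"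
  by (induction us rule: tuple.induct) auto

lemma lift_app_tuple: "lift k (app_tuple h us) = app_tuple (lift k h) (map (lift k) us)"
  by (simp add: app_tuple_def lift_tuple)

lemma fv_tuple: "fv_mterm (tuple us) = (\<Union>u\<in>set us. fv_mterm u)"
  by (induction us rule: tuple.induct) auto

lemma fv_app_tuple: "fv_mterm (app_tuple h us) = fv_mterm h \<union> (\<Union>u\<in>set us. fv_mterm u)"
  by (simp add: app_tuple_def fv_tuple)

subsection \<open>Embedded formulas and realizability formulas\<close>

text \<open>Well-formedness keeps the lookup \<open>e ! i\<close> within the list, where it commutes
  with \<open>map\<close>.\<close>

lemma emb_term_inst:
  "wf_term \<Sigma> (length e) t \<Longrightarrow> inst_mterm k w (emb_term e t) = emb_term (map (inst_mterm k w) e) t"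
  by (induction t) (auto simp: inst_app_tuple cong: map_cong)

lemma emb_term_lift:
  "wf_term \<Sigma> (length e) t \<Longrightarrow> lift k (emb_term e t) = emb_term (map (lift k) e) t"
  by (induction t) (auto simp: lift_app_tuple cong: map_cong)

lemma mtyping_emb_term:
  "wf_term \<Sigma> (length e) t \<Longrightarrow> \<forall>v\<in>set e. mtyping \<Sigma> E bs v MD \<Longrightarrow> mtyping \<Sigma> E bs (emb_term e t) MD"
proof (induction t)
  case (Fn f ts)
  then show ?case
    by (auto intro!: mtyping_app_tuple mtyping_FunC)
qed (auto intro: mtyping.intros)

lemma emb_term_closed_lift:
  "wf_term \<Sigma> 0 t \<Longrightarrow> lift k (emb_term [] t) = emb_term [] t"
  using emb_term_lift[of \<Sigma> "[]"] by simp

lemma emb_term_append: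
  "wf_term \<Sigma> (length e) t \<Longrightarrow> emb_term (e @ e') t = emb_term e t"
  by (induction t) (auto simp: nth_append cong: map_cong)

text \<open>The index \<open>length e\<close> is the first one beyond the environment, so the
  substituted term becomes the entry appended at the end. Being closed, it has the same embedding in
  every environment.\<close>

lemma emb_term_inst_term:
  assumes "wf_term \<Sigma> 0 t"
  shows "wf_term \<Sigma> (Suc (length e)) s \<Longrightarrow>
    emb_term e (inst_term (length e) t s) = emb_term (e @ [emb_term [] t]) s"
proof (induction s)
  case (Bound i)
  then show ?case
    using emb_term_append[of \<Sigma> "[]" t e] assms by (auto simp: nth_append)
qed (auto cong: map_cong)

lemma fv_emb_term:
  "wf_term \<Sigma> (length e) t \<Longrightarrow>
    fv_mterm (emb_term e t) \<subseteq> fv_term t \<times> {MD} \<union> (\<Union>v\<in>set e. fv_mterm v)"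
proof (induction t)
  case (Bound i)
  then have "e ! i \<in> set e" by simp
  then show ?case by auto
next
  case (Fn f ts)
  then show ?case by (fastforce simp: fv_app_tuple)
qed auto

lemma emb_sform_inst:
  "wf_sform \<Sigma> (length e) \<alpha> \<Longrightarrow>
    inst_fm k w (emb_sform e \<alpha> \<pi>) = emb_sform (map (inst_mterm k w) e) \<alpha> (inst_mterm k w \<pi>)"
  by (induction \<alpha>) (auto simp: emb_term_inst)

lemma wf_emb_sform:
  "wf_sform \<Sigma> (length e) \<alpha> \<Longrightarrow> \<forall>v\<in>set e. mtyping \<Sigma> E bs v MD \<Longrightarrow> mtyping \<Sigma> E bs \<pi> MState \<Longrightarrow>
    wf_fm \<Sigma> E bs (emb_sform e \<alpha> \<pi>)"
  by (induction \<alpha>) (auto intro: mtyping_emb_term)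

lemma emb_sform_inst_sform:
  assumes "wf_term \<Sigma> 0 t"
  shows "wf_sform \<Sigma> (Suc (length e)) \<alpha> \<Longrightarrow>
    emb_sform e (inst_sform (length e) t \<alpha>) \<pi> = emb_sform (e @ [emb_term [] t]) \<alpha> \<pi>"
  using assms by (induction \<alpha>) (auto intro: emb_term_inst_term)

lemma fv_emb_sform:
  "wf_sform \<Sigma> (length e) \<alpha> \<Longrightarrow>
    fv_fm (emb_sform e \<alpha> \<pi>) \<subseteq> fv_sform \<alpha> \<times> {MD} \<union> (\<Union>v\<in>set e. fv_mterm v) \<union> fv_mterm \<pi>"
proof (induction \<alpha>)
  case (SAtom p ts)
  then show ?case using fv_emb_term[of \<Sigma> e] by fastforce
qed auto

text \<open>Below a quantifier the index \<open>k\<close> becomes \<open>Suc k\<close> while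
  \<open>e\<close> and \<open>u\<close> are lifted, and \<open>inst_lift\<close> matches the two.
  The formula itself contributes no index, since well-formedness refers all of its indices to
  \<open>e\<close>.\<close>

lemma sr_inst:
  assumes "mtyping \<Sigma> E [] w X"
  shows "wf_mform \<Sigma> (length e) A \<Longrightarrow>
    inst_fm k w (sr e u A) = sr (map (inst_mterm k w) e) (inst_mterm k w u) A"
proof (induction A arbitrary: e u k)
  case (MEx A)
  from MEx.prems MEx.IH[of "P0 u # e"] show ?case by simp
qed (use assms in \<open>auto simp: emb_term_inst emb_sform_inst inst_lift comp_def Let_def\<close>)

lemma hsr_inst:
  assumes "mtyping \<Sigma> E [] w X" "wf_sform \<Sigma> (length e) \<alpha>" "wf_mform \<Sigma> (length e) A"
    "wf_sform \<Sigma> (length e) \<beta>"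
  shows "inst_fm k w (hsr e u \<alpha> A \<beta>) = hsr (map (inst_mterm k w) e) (inst_mterm k w u) \<alpha> A \<beta>"
  using assms sr_inst[of \<Sigma> E w X]
  by (auto simp: emb_sform_inst inst_lift comp_def Let_def)

lemma wf_sr:
  "wf_mform \<Sigma> (length e) A \<Longrightarrow> \<forall>v\<in>set e. mtyping \<Sigma> E bs v MD \<Longrightarrow>
    mtyping \<Sigma> E bs u (emb_ty (tau A)) \<Longrightarrow> wf_fm \<Sigma> E bs (sr e u A)"
proof (induction A arbitrary: e u bs)
  case (MAtom P ts)
  then show ?case by (auto intro: mtyping_emb_term)
next
  case (MAnd A B)
  have u: "mtyping \<Sigma> E bs u (MProd (emb_ty (tau A)) (emb_ty (tau B)))"
    using MAnd.prems by simp
  show ?case using MAnd.prems by (auto intro!: MAnd.IH mtyping_P0[OF u] mtyping_P1[OF u])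
next
  case (MOr A B)
  have u: "mtyping \<Sigma> E bs u (MProd MBool (MProd (emb_ty (tau A)) (emb_ty (tau B))))"
    using MOr.prems by simp
  note u1 = mtyping_P1[OF u]
  show ?case using MOr.prems
    by (auto intro!: MOr.IH mtyping_TT mtyping_FF mtyping_P0[OF u] mtyping_P0[OF u1]
      mtyping_P1[OF u1])
next
  case (MEx A)
  have u: "mtyping \<Sigma> E bs u (MProd MD (emb_ty (tau A)))"
    using MEx.prems by simp
  show ?case using MEx.prems by (auto intro!: MEx.IH mtyping_P0[OF u] mtyping_P1[OF u])
next
  case (MImp A \<alpha> B \<beta>)
  note [simp] = mtyping_lift mtyping_BV0
  \<comment> \<open>Two quantifiers have been passed: index 1 is the argument \<open>x\<close>,
    index 0 the state \<open>\<pi>\<close>, and \<open>u\<close> has been lifted twice.\<close>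
  have *: "mtyping \<Sigma> E (MState # emb_ty (tau A) # bs)
      (App (App (lift 0 (lift 0 u)) (BV (Suc 0))) (BV 0)) (MProd (emb_ty (tau B)) MState)"
    using MImp.prems mtyping_BV[of "Suc 0" "MState # emb_ty (tau A) # bs" \<Sigma> E]
    by (auto intro!: mtyping_App mtyping_lift)
  show ?case using MImp.prems
    by (auto simp: Let_def intro!: MImp.IH wf_emb_sform intro: mtyping_P0[OF *] mtyping_P1[OF *])
next
  case (MAll \<alpha> A \<beta>)
  note [simp] = mtyping_lift mtyping_BV0 mtyping_BV1
  have *: "mtyping \<Sigma> E (MState # MD # bs)
      (App (App (lift 0 (lift 0 u)) (BV (Suc 0))) (BV 0)) (MProd (emb_ty (tau A)) MState)"
    using MAll.prems by (auto intro!: mtyping_App mtyping_lift)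
  show ?case using MAll.prems
    by (auto simp: Let_def intro!: MAll.IH wf_emb_sform intro: mtyping_P0[OF *] mtyping_P1[OF *])
qed auto

text \<open>Types of realizers ignore first-order terms, so a realizer of an instance and one of the
  body of the quantifier have the same type.\<close>

lemma tau_inst [simp]: "tau (inst_mform k t A) = tau A"
  by (induction A arbitrary: k) auto

text \<open>The substitution lemma behind the rules for quantifiers: a term substituted in SL can be
  moved into the environment of the realizability formula. The new entry is closed, so passing below
  quantifiers leaves it as it is.\<close>

lemma sr_inst_mform:
  assumes "wf_term \<Sigma> 0 t"
  shows "wf_mform \<Sigma> (Suc (length e)) A \<Longrightarrow>
    sr e u (inst_mform (length e) t A) = sr (e @ [emb_term [] t]) u A"
proof (induction A arbitrary: e u)
  case (MEx A)
  from MEx.prems MEx.IH[of "P0 u # e"] show ?case by simp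
next
  case (MImp A \<alpha> B \<beta>)
  then show ?case
    using MImp.IH(1)[of "map (lift 0) e"] MImp.IH(2)[of "map (lift 0) (map (lift 0) e)"]
    by (simp add: Let_def emb_term_closed_lift[OF assms]
      emb_sform_inst_sform[OF assms, of "map g e" for g, simplified])
next
  case (MAll \<alpha> A \<beta>)
  then show ?case
    using MAll.IH[of "BV (Suc 0) # map (lift 0) (map (lift 0) e)"]
    by (simp add: Let_def emb_term_closed_lift[OF assms]
        emb_sform_inst_sform[OF assms, of "x # map g e" for x g, simplified])
qed (use assms in \<open>auto intro: emb_term_inst_term\<close>)

lemma hsr_inst_mform:
  assumes "wf_term \<Sigma> 0 t" "wf_sform \<Sigma> (Suc 0) \<alpha>" "wf_mform \<Sigma> (Suc 0) A" "wf_sform \<Sigma> (Suc 0) \<beta>"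
  shows "hsr [] u (inst_sform 0 t \<alpha>) (inst_mform 0 t A) (inst_sform 0 t \<beta>) =
    hsr [emb_term [] t] u \<alpha> A \<beta>"
  using assms sr_inst_mform[of \<Sigma> t "[]"]
  by (simp add: Let_def emb_term_closed_lift emb_sform_inst_sform[of \<Sigma> t "[]", simplified])

text \<open>Supplies the eigenvariable conditions of \<open>M_allI\<close>: apart from the
  environment and the realizer, only first-order names occur, and these at sort
  \<open>MD\<close>.\<close>

lemma fv_sr:
  "wf_mform \<Sigma> (length e) A \<Longrightarrow>
    fv_fm (sr e u A) \<subseteq> fv_mform A \<times> {MD} \<union> (\<Union>v\<in>set e. fv_mterm v) \<union> fv_mterm u"
proof (induction A arbitrary: e u)
  case (MAtom P ts)
  then show ?case using fv_emb_term[of \<Sigma> e] by fastforce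
next
  case (MEx A)
  show ?case using MEx.prems MEx.IH[of "P0 u # e" "P1 u"] by auto
next
  case (MImp A \<alpha> B \<beta>)
  let ?e = "map (lift 0) e" let ?e' = "map (lift 0) ?e"
  let ?s = "App (App (lift 0 (lift 0 u)) (BV (Suc 0))) (BV 0)"
  show ?case
    using MImp.prems MImp.IH(1)[of ?e "BV 0"] MImp.IH(2)[of ?e' "P0 ?s"]
      fv_emb_sform[of \<Sigma> ?e' \<alpha> "BV 0"] fv_emb_sform[of \<Sigma> ?e' \<beta> "P1 ?s"]
    by (simp add: Let_def) blast
next
  case (MAll \<alpha> A \<beta>)
  let ?e = "BV (Suc 0) # map (lift 0) (map (lift 0) e)"
  let ?s = "App (App (lift 0 (lift 0 u)) (BV (Suc 0))) (BV 0)"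
  show ?case
    using MAll.prems MAll.IH[of ?e "P0 ?s"]
      fv_emb_sform[of \<Sigma> ?e \<alpha> "BV 0"] fv_emb_sform[of \<Sigma> ?e \<beta> "P1 ?s"]
    by (simp add: Let_def) blast
next
  case (MAnd A B)
  show ?case using MAnd.prems MAnd.IH(1)[of e "P0 u"] MAnd.IH(2)[of e "P1 u"] by auto
next
  case (MOr A B)
  show ?case using MOr.prems MOr.IH(1)[of e "P0 (P1 u)"] MOr.IH(2)[of e "P1 (P1 u)"] by auto
qed auto

lemma fv_hsr:
  assumes "wf_sform \<Sigma> (length e) \<alpha>" "wf_mform \<Sigma> (length e) A" "wf_sform \<Sigma> (length e) \<beta>"
  shows "fv_fm (hsr e u \<alpha> A \<beta>) \<subseteq>
    (fv_sform \<alpha> \<union> fv_mform A \<union> fv_sform \<beta>) \<times> {MD} \<union> (\<Union>v\<in>set e. fv_mterm v) \<union> fv_mterm u"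
proof -
  let ?e = "map (lift 0) e" let ?s = "App (lift 0 u) (BV 0)"
  show ?thesis
    using assms fv_sr[of \<Sigma> ?e A "P0 ?s"]
      fv_emb_sform[of \<Sigma> ?e \<alpha> "BV 0"] fv_emb_sform[of \<Sigma> ?e \<beta> "P1 ?s"]
    by (simp add: Let_def) blast
qed

lemma wf_term_mono: "wf_term \<Sigma> j t \<Longrightarrow> j \<le> k \<Longrightarrow> wf_term \<Sigma> k t"
  by (induction t) auto

text \<open>Both directions are used: introducing a quantifier passes from an instance to the body,
  and eliminating \<forall> passes from the body to an instance.\<close>

lemma wf_inst_term:
  "wf_term \<Sigma> 0 t \<Longrightarrow> wf_term \<Sigma> k (inst_term k t s) \<longleftrightarrow> wf_term \<Sigma> (Suc k) s"
  by (induction s) (auto intro: wf_term_mono)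

lemma wf_inst_sform:
  "wf_term \<Sigma> 0 t \<Longrightarrow> wf_sform \<Sigma> k (inst_sform k t \<alpha>) \<longleftrightarrow> wf_sform \<Sigma> (Suc k) \<alpha>"
  by (induction \<alpha>) (auto simp: wf_inst_term)

lemma wf_inst_mform:
  "wf_term \<Sigma> 0 t \<Longrightarrow> wf_mform \<Sigma> k (inst_mform k t A) \<longleftrightarrow> wf_mform \<Sigma> (Suc k) A"
  by (induction A arbitrary: k) (auto simp: wf_inst_term wf_inst_sform)

lemma HL_wf:
  "HL \<Sigma> \<Delta>H \<Gamma> \<alpha> \<Longrightarrow> wf_sform \<Sigma> 0 \<alpha> \<and> (\<forall>\<gamma>\<in>\<Gamma>. wf_sform \<Sigma> 0 \<gamma>)"
  by (induction rule: HL.induct) auto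

lemma SL_wf_ctx:
  "SL \<Sigma> \<Delta>H \<Delta>S \<Gamma> \<alpha> A \<beta> \<Longrightarrow> \<forall>B\<in>\<Gamma>. wf_mform \<Sigma> 0 B"
  by (induction rule: SL.induct) auto

subsection \<open>Embedded terms\<close>

lemma mtyping_zero:
  assumes "wf_signature \<Sigma>"
  shows "mtyping \<Sigma> E bs (zero \<Sigma> X) (emb_ty X)"
proof (induction X arbitrary: bs)
  case TD
  have "mtyping \<Sigma> E bs (FunC (const \<Sigma>)) (mpow_fun 0 MD)"
    using assms by (auto simp: wf_signature_def intro: mtyping_FunC)
  then show ?case by (simp add: mpow_fun_def)
next
  case (TFun X Y)
  then show ?case
    using mtyping_BV[of 0 "MState # emb_ty X # bs"]
    by (auto intro!: mtyping_Pair mtyping_Lam)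
qed (auto intro: mtyping.intros)

lemma emb_ty_tpow: "emb_ty (tpow n) = mpow n"
  by (induction n rule: tpow.induct) auto

lemma mtyping_chi_app:
  assumes "wf_sform \<Sigma> 0 \<alpha>" "mtyping \<Sigma> E bs \<pi> MState" "mtyping \<Sigma> E bs u X" "mtyping \<Sigma> E bs v X"
  shows "mtyping \<Sigma> E bs (chi_app \<alpha> X \<pi> u v) X"
proof -
  have "mtyping \<Sigma> E bs (app_tuple (Chi \<alpha> X) (map (\<lambda>x. FV x MD) (sorted_list_of_set (fv_sform \<alpha>))))
      (MFun MState (MFun X (MFun X X)))"
    using mtyping_Chi[of \<Sigma> \<alpha> E bs X] assms
    by (intro mtyping_app_tuple) (auto intro: mtyping.intros)
  then show ?thesis
    using assms unfolding chi_app_def by (blast intro: mtyping.intros)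
qed

lemma inst_chi_app:
  "inst_mterm k w (chi_app \<alpha> X \<pi> u v) =
    chi_app \<alpha> X (inst_mterm k w \<pi>) (inst_mterm k w u) (inst_mterm k w v)"
  by (simp add: chi_app_def inst_app_tuple comp_def)

section \<open>Free variables of ST terms and change of context\<close>

fun fv_st :: "('f, 'p, 'k) st_term \<Rightarrow> name set" where
  "fv_st (Var x) = {x}"
| "fv_st (Comp s t) = fv_st s \<union> fv_st t"
| "fv_st (Prj0 t) = fv_st t"
| "fv_st (Prj1 t) = fv_st t"
| "fv_st (Inj0 Y t) = fv_st t"
| "fv_st (Inj1 X t) = fv_st t"
| "fv_st (CaseOf Z r s t) = fv_st r \<union> fv_st s \<union> fv_st t"
| "fv_st (Abs x X t) = fv_st t - {x}"
| "fv_st (Ap t s) = fv_st t \<union> fv_st s"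
| "fv_st (Ite X \<alpha> s t) = fv_sform \<alpha> \<union> fv_st s \<union> fv_st t"
| "fv_st _ = {}"

lemma finite_fv_st: "finite (fv_st t)"
  by (induction t) auto

lemma st_typing_fv: "st_typing \<Sigma> E \<Delta> t X \<Longrightarrow> fv_st t \<subseteq> dom \<Delta>"
  by (induction rule: st_typing.induct) (auto split: if_splits)

lemma st_typing_cong:
  "st_typing \<Sigma> E \<Delta> t X \<Longrightarrow> \<forall>x\<in>fv_st t. \<Delta>' x = \<Delta> x \<Longrightarrow> st_typing \<Sigma> E \<Delta>' t X"
proof (induction arbitrary: \<Delta>' rule: st_typing.induct)
  case (12 \<Delta> x X t Y)
  then have "st_typing \<Sigma> E (\<Delta>'(x \<mapsto> X)) t Y" by (intro "12.IH") auto
  then show ?case by (rule st_typing.intros)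
qed (simp add: ball_Un st_typing.intros; fail | intro st_typing.intros; auto)+

text \<open>The embedding consults the context only at \<open>Var\<close>, in order to attach a sort
  to the variable.\<close>

lemma emb_cong:
  "\<forall>x\<in>fv_st t. \<Delta>' x = \<Delta> x \<Longrightarrow> emb \<Sigma> E \<Delta>' t = emb \<Sigma> E \<Delta> t"
proof (induction t arbitrary: \<Delta> \<Delta>')
  case (Abs x X t)
  have "emb \<Sigma> E (\<Delta>'(x \<mapsto> X)) t = emb \<Sigma> E (\<Delta>(x \<mapsto> X)) t"
    by (rule Abs.IH) (use Abs.prems in auto)
  then show ?case by simp
next
  case (CaseOf Z r s t)
  have "emb \<Sigma> E \<Delta>' r = emb \<Sigma> E \<Delta> r" "emb \<Sigma> E \<Delta>' s = emb \<Sigma> E \<Delta> s" "emb \<Sigma> E \<Delta>' t = emb \<Sigma> E \<Delta> t"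
    using CaseOf.prems by (auto intro: CaseOf.IH)
  then show ?case by simp
next
  case (Comp s t)
  have "emb \<Sigma> E \<Delta>' s = emb \<Sigma> E \<Delta> s" "emb \<Sigma> E \<Delta>' t = emb \<Sigma> E \<Delta> t"
    using Comp.prems by (auto intro: Comp.IH)
  then show ?case by simp
next
  case (Ap t s)
  have "emb \<Sigma> E \<Delta>' s = emb \<Sigma> E \<Delta> s" "emb \<Sigma> E \<Delta>' t = emb \<Sigma> E \<Delta> t"
    using Ap.prems by (auto intro: Ap.IH)
  then show ?case by simp
next
  case (Ite X \<alpha> s t)
  have "emb \<Sigma> E \<Delta>' s = emb \<Sigma> E \<Delta> s" "emb \<Sigma> E \<Delta>' t = emb \<Sigma> E \<Delta> t"
    using Ite.prems by (auto intro: Ite.IH)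
  then show ?case by simp
next
  case (Prj0 t)
  have "emb \<Sigma> E \<Delta>' t = emb \<Sigma> E \<Delta> t"
    using Prj0.prems by (auto intro: Prj0.IH)
  then show ?case by simp
next
  case (Prj1 t)
  have "emb \<Sigma> E \<Delta>' t = emb \<Sigma> E \<Delta> t"
    using Prj1.prems by (auto intro: Prj1.IH)
  then show ?case by simp
next
  case (Inj0 X t)
  have "emb \<Sigma> E \<Delta>' t = emb \<Sigma> E \<Delta> t"
    using Inj0.prems by (auto intro: Inj0.IH)
  then show ?case by simp
next
  case (Inj1 X t)
  have "emb \<Sigma> E \<Delta>' t = emb \<Sigma> E \<Delta> t"
    using Inj1.prems by (auto intro: Inj1.IH)
  then show ?case by simp
qed simp_all

lemma st_typing_agree:
  assumes "st_typing \<Sigma> E \<Delta> t X" "\<Delta> \<subseteq>\<^sub>m \<Delta>'"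
  shows "\<forall>x\<in>fv_st t. \<Delta>' x = \<Delta> x"
proof
  fix x assume "x \<in> fv_st t"
  then have "x \<in> dom \<Delta>" using st_typing_fv[OF assms(1)] by (rule subsetD[rotated])
  then show "\<Delta>' x = \<Delta> x" using assms(2) by (simp add: map_le_def)
qed

lemma st_typing_weaken:
  assumes "st_typing \<Sigma> E \<Delta> t X" "\<Delta> \<subseteq>\<^sub>m \<Delta>'"
  shows "st_typing \<Sigma> E \<Delta>' t X"
  by (rule st_typing_cong[OF assms(1) st_typing_agree[OF assms]])

lemma emb_weaken:
  assumes "st_typing \<Sigma> E \<Delta> t X" "\<Delta> \<subseteq>\<^sub>m \<Delta>'"
  shows "emb \<Sigma> E \<Delta>' t = emb \<Sigma> E \<Delta> t"
  by (rule emb_cong[OF st_typing_agree[OF assms]])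

lemma mtyping_emb:
  assumes "wf_signature \<Sigma>" "wf_extension \<Sigma> E"
  shows "st_typing \<Sigma> E \<Delta> t X \<Longrightarrow>
    mtyping \<Sigma> E [] (emb \<Sigma> E \<Delta> t) (MFun MState (MProd (emb_ty X) MState))"
proof (induction rule: st_typing.induct)
  case (4 c X \<Delta>)
  then show ?case using assms by (auto simp: wf_extension_def)
next
  case (5 f n \<Delta>)
  note [simp] = mtyping_BV0 mtyping_BV1
  have f: "mtyping \<Sigma> E bs (FunC f) (mpow_fun n MD)" for bs
    using 5 by (rule mtyping.intros)
  show ?case
    using 5 f mtyping_App[of \<Sigma> E "[MState, mpow n, MState]" "FunC f" "mpow n" MD "BV (Suc 0)"]
    by (auto simp: tpow_fun_def mpow_fun_def emb_ty_tpow intro!: mtyping_Pair mtyping_Lam)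
next
  case (12 \<Delta> x X t Y)
  show ?case
    unfolding emb.simps emb_ty.simps
    by (rule mtyping_Pair mtyping_Lam mtyping_BV0 mtyping_closed_weaken[OF mtyping_lam[OF 12(2)]])+
next
  case (11 \<Delta> r X Y s Z t)
  \<comment> \<open>Below the binder for the initial state, \<open>u\<close>, \<open>v\<close> and
    \<open>w\<close> type the outcomes of running \<open>r\<close>, \<open>s\<close> and
    \<open>t\<close>. All parts bound by \<open>let\<close> in the embedding are projections of
    these. The other cases follow the same pattern.\<close>
  note IH = 11(4-6)[THEN mtyping_closed_weaken, of "[MState]"]
  note u = mtyping_App[OF IH(1) mtyping_BV0, simplified]
  note v = mtyping_App[OF IH(2) mtyping_P1[OF u], simplified]
  note w = mtyping_App[OF IH(3) mtyping_P1[OF u], simplified]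
  note u0 = mtyping_P0[OF u]
  note u1 = mtyping_P1[OF u0]
  show ?case
    unfolding emb.simps Let_def
    by (rule mtyping_Lam mtyping_App mtyping_Case
          mtyping_P0[OF v] mtyping_P1[OF v] mtyping_P0[OF w] mtyping_P1[OF w] mtyping_P0[OF u0]
          mtyping_P0[OF u1] mtyping_P1[OF u1])+
next
  case (13 \<Delta> t X Y s)
  note IH = 13(3-4)[THEN mtyping_closed_weaken, of "[MState]"]
  note u = mtyping_App[OF IH(1) mtyping_BV0, simplified]
  note v = mtyping_App[OF IH(2) mtyping_P1[OF u], simplified]
  show ?case
    unfolding emb.simps Let_def
    by (rule mtyping_Lam mtyping_App
          mtyping_P0[OF v] mtyping_P1[OF v] mtyping_P0[OF u] mtyping_P1[OF u])+
next
  case (14 \<alpha> \<Delta> s X t)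
  note IH = 14(5-6)[THEN mtyping_closed_weaken, of "[MState]"]
  show ?case
    unfolding emb.simps
    by (rule mtyping_Lam mtyping_chi_app 14(1) mtyping_BV0 mtyping_App[OF IH(1) mtyping_BV0]
          mtyping_App[OF IH(2) mtyping_BV0])+
next
  case (6 \<Delta> s X t Y)
  note IH = 6(3-4)[THEN mtyping_closed_weaken, of "[MState]"]
  note u = mtyping_App[OF IH(1) mtyping_BV0, simplified]
  note v = mtyping_App[OF IH(2) mtyping_P1[OF u], simplified]
  show ?case
    unfolding emb.simps Let_def emb_ty.simps
    by (rule mtyping_Pair mtyping_Lam
          mtyping_P0[OF v] mtyping_P1[OF v] mtyping_P0[OF u] mtyping_P1[OF u])+
next
  case (7 \<Delta> t X Y)
  note u = mtyping_App[OF 7(2)[THEN mtyping_closed_weaken, of "[MState]"] mtyping_BV0, simplified]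
  note u0 = mtyping_P0[OF u]
  show ?case
    unfolding emb.simps Let_def
    by (rule mtyping_Pair mtyping_Lam mtyping_P0[OF u0] mtyping_P1[OF u])+
next
  case (8 \<Delta> t X Y)
  note u = mtyping_App[OF 8(2)[THEN mtyping_closed_weaken, of "[MState]"] mtyping_BV0, simplified]
  note u0 = mtyping_P0[OF u]
  show ?case
    unfolding emb.simps Let_def
    by (rule mtyping_Pair mtyping_Lam mtyping_P1[OF u0] mtyping_P1[OF u])+
next
  case (9 \<Delta> t X Y)
  note u = mtyping_App[OF 9(2)[THEN mtyping_closed_weaken, of "[MState]"] mtyping_BV0, simplified]
  show ?case
    unfolding emb.simps Let_def emb_ty.simps
    by (rule mtyping_FF mtyping_Pair mtyping_Lam mtyping_zero[OF assms(1)] mtyping_P0[OF u]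
      mtyping_P1[OF u])+
next
  case (10 \<Delta> t Y X)
  note u = mtyping_App[OF 10(2)[THEN mtyping_closed_weaken, of "[MState]"] mtyping_BV0, simplified]
  show ?case
    unfolding emb.simps Let_def emb_ty.simps
    by (rule mtyping_TT mtyping_Pair mtyping_Lam mtyping_zero[OF assms(1)] mtyping_P0[OF u]
      mtyping_P1[OF u])+
next
  case (1 \<Delta> x X)
  then show ?case
    using mtyping_BV[of 0 "[MState]" \<Sigma> E] by (auto intro!: mtyping_FV mtyping_Pair mtyping_Lam)
next
  case 2
  then show ?case
    using mtyping_BV[of 0 "[MState]" \<Sigma> E] by (auto intro!: mtyping_Unt mtyping_Pair mtyping_Lam)
next
  case 3
  then show ?case
    using mtyping_BV[of 0 "[MState]" \<Sigma> E]
    by (auto intro!: mtyping_Pair mtyping_Lam mtyping_zero[OF assms(1)])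
qed

subsection \<open>Reasoning in the metatheory\<close>

locale metatheory =
  fixes \<Sigma> :: "('f, 'P, 'p) signature" and E :: "('f, 'P, 'p, 'k, 'g) extension"
  assumes wf_sig: "wf_signature \<Sigma>" and wf_ext: "wf_extension \<Sigma> E"
begin

abbreviation typed :: "('f, 'p, 'g) mterm \<Rightarrow> mty \<Rightarrow> bool" where
  "typed \<equiv> mtyping \<Sigma> E []"

abbreviation proves :: "('f, 'P, 'p, 'g) fm set \<Rightarrow> ('f, 'P, 'p, 'g) fm \<Rightarrow> bool" where
  "proves \<equiv> prv \<Sigma> E"

abbreviation closed_env :: "('f, 'p, 'g) mterm list \<Rightarrow> bool" where
  "closed_env e \<equiv> \<forall>w\<in>set e. typed w MD"

lemma map_inst_closed_env: "closed_env e \<Longrightarrow> map (inst_mterm k w) e = e"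
  by (induction e) auto

lemma map_lift_closed_env: "closed_env e \<Longrightarrow> map (lift k) e = e"
  by (induction e) auto

lemma closed_env_weaken: "closed_env e \<Longrightarrow> \<forall>w\<in>set e. mtyping \<Sigma> E bs w MD"
  using mtyping_closed_weaken by blast

lemma typed_P0: "typed u (MProd X Y) \<Longrightarrow> typed (P0 u) X"
  and typed_P1: "typed u (MProd X Y) \<Longrightarrow> typed (P1 u) Y"
  and typed_Pair: "typed u X \<Longrightarrow> typed v Y \<Longrightarrow> typed (Pair u v) (MProd X Y)"
  and typed_App: "typed f (MFun X Y) \<Longrightarrow> typed u X \<Longrightarrow> typed (App f u) Y"
  and typed_FV: "typed (FV x X) X"
  by (auto intro: mtyping.intros)

lemma typed_emb: "st_typing \<Sigma> E \<Delta> t X \<Longrightarrow> typed (emb \<Sigma> E \<Delta> t) (MFun MState (MProd (emb_ty X) MState))"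
  using mtyping_emb wf_sig wf_ext by blast

section \<open>Equational reasoning inside the metatheory\<close>

lemma eq_sym: "proves \<Phi> (Eq X u v) \<Longrightarrow> typed u X \<Longrightarrow> proves \<Phi> (Eq X v u)"
  using M_subst[of \<Sigma> E \<Phi> X u v "Eq X (BV 0) u"]
  by (auto intro: M_refl mtyping_closed_weaken mtyping_BV0)

lemma eq_trans: "proves \<Phi> (Eq X u v) \<Longrightarrow> proves \<Phi> (Eq X v w) \<Longrightarrow> typed u X \<Longrightarrow> proves \<Phi> (Eq X u w)"
  using M_subst[of \<Sigma> E \<Phi> X v w "Eq X u (BV 0)"]
  by (auto intro: mtyping_closed_weaken mtyping_BV0)

text \<open>Here \<open>c\<close> is a metaterm whose hole is the index 0. The congruences for
  projections, application and pairing are obtained by choosing \<open>c\<close>.\<close>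

lemma eq_cong:
  assumes "proves \<Phi> (Eq X u v)" "mtyping \<Sigma> E [X] c Y" "typed u X"
  shows "proves \<Phi> (Eq Y (inst_mterm 0 u c) (inst_mterm 0 v c))"
proof -
  have c: "typed (inst_mterm 0 u c) Y"
    using assms by (blast intro: mtyping_inst)
  show ?thesis
    using M_subst[of \<Sigma> E \<Phi> X u v "Eq Y (inst_mterm 0 u c) c"] assms c
    by (auto intro: M_refl mtyping_closed_weaken)
qed

lemma eq_P0: "proves \<Phi> (Eq (MProd X Y) u v) \<Longrightarrow> typed u (MProd X Y) \<Longrightarrow> proves \<Phi> (Eq X (P0 u) (P0 v))"
  using eq_cong[of \<Phi> "MProd X Y" u v "P0 (BV 0)" X] by (auto intro: mtyping.intros mtyping_BV0)

lemma eq_P1: "proves \<Phi> (Eq (MProd X Y) u v) \<Longrightarrow> typed u (MProd X Y) \<Longrightarrow> proves \<Phi> (Eq Y (P1 u) (P1 v))"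
  using eq_cong[of \<Phi> "MProd X Y" u v "P1 (BV 0)" Y] by (auto intro: mtyping.intros mtyping_BV0)

lemma eq_App:
  assumes "proves \<Phi> (Eq (MFun X Y) f g)" "proves \<Phi> (Eq X u v)"
    and "typed f (MFun X Y)" "typed g (MFun X Y)" "typed u X"
  shows "proves \<Phi> (Eq Y (App f u) (App g v))"
proof (rule eq_trans)
  have "mtyping \<Sigma> E [MFun X Y] (App (BV 0) u) Y"
    using assms by (blast intro: mtyping_App mtyping_BV0 mtyping_closed_weaken)
  from eq_cong[OF assms(1) this assms(3)] show "proves \<Phi> (Eq Y (App f u) (App g u))"
    using assms by simp
  have "mtyping \<Sigma> E [X] (App g (BV 0)) Y"
    using assms by (blast intro: mtyping_App mtyping_BV0 mtyping_closed_weaken)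
  from eq_cong[OF assms(2) this assms(5)] show "proves \<Phi> (Eq Y (App g u) (App g v))"
    using assms by simp
qed (use assms in \<open>blast intro: typed_App\<close>)

lemma eq_Pair:
  assumes "proves \<Phi> (Eq X u u')" "proves \<Phi> (Eq Y v v')"
    and "typed u X" "typed u' X" "typed v Y"
  shows "proves \<Phi> (Eq (MProd X Y) (Pair u v) (Pair u' v'))"
proof (rule eq_trans)
  have "mtyping \<Sigma> E [X] (Pair (BV 0) v) (MProd X Y)"
    using assms by (blast intro: mtyping_Pair mtyping_BV0 mtyping_closed_weaken)
  from eq_cong[OF assms(1) this assms(3)] show "proves \<Phi> (Eq (MProd X Y) (Pair u v) (Pair u' v))"
    using assms by simp
  have "mtyping \<Sigma> E [Y] (Pair u' (BV 0)) (MProd X Y)"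
    using assms by (blast intro: mtyping_Pair mtyping_BV0 mtyping_closed_weaken)
  from eq_cong[OF assms(2) this assms(5)] show "proves \<Phi> (Eq (MProd X Y) (Pair u' v) (Pair u' v'))"
    using assms by simp
qed (use assms in \<open>blast intro: typed_Pair\<close>)

lemma beta:
  "typed (Lam X b) (MFun X Y) \<Longrightarrow> typed v X \<Longrightarrow> proves \<Phi> (Eq Y (App (Lam X b) v) (inst_mterm 0 v b))"
  by (auto elim: mtyping.cases intro: M_beta)

text \<open>Undoes an abstraction at its own variable. This is the only form in which the body of an
  ST abstraction is ever reached; other arguments come in by generalizing the variable.\<close>

lemma beta_lam:
  assumes "typed w Y"
  shows "proves \<Phi> (Eq Y (App (lam x X w) (FV x X)) w)"
  using beta[OF mtyping_lam[OF assms, of x X, unfolded lam_def] typed_FV[of x X], of \<Phi>]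
  by (simp add: lam_def inst_bind[OF assms])

text \<open>Leibniz substitution at the place of the realizer. It lets a program be replaced by its
  computed value.\<close>

lemma sr_eq:
  assumes "proves \<Phi> (Eq (emb_ty (tau A)) u v)" "proves \<Phi> (sr e u A)"
    and "wf_mform \<Sigma> (length e) A" "closed_env e" "typed u (emb_ty (tau A))" "typed v (emb_ty (tau A))"
  shows "proves \<Phi> (sr e v A)"
proof -
  have inst: "inst_fm 0 w (sr e (BV 0) A) = sr e w A" if "typed w (emb_ty (tau A))" for w
    using sr_inst[OF that, of e A 0 "BV 0"] assms by (simp add: map_inst_closed_env)
  show ?thesis
    using M_subst[of \<Sigma> E \<Phi> "emb_ty (tau A)" u v "sr e (BV 0) A"] assms
    by (simp add: inst wf_sr mtyping_BV0 closed_env_weaken)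
qed

lemma sform_eq:
  assumes "proves \<Phi> (Eq MState s s')" "proves \<Phi> (emb_sform e \<alpha> s)"
    and "wf_sform \<Sigma> (length e) \<alpha>" "closed_env e"
  shows "proves \<Phi> (emb_sform e \<alpha> s')"
  using M_subst[of \<Sigma> E \<Phi> MState s s' "emb_sform e \<alpha> (BV 0)"] assms
  by (simp add: emb_sform_inst map_inst_closed_env wf_emb_sform mtyping_BV0 closed_env_weaken)

lemma sr_MImpD:
  assumes "proves \<Phi> (sr e f (MImp A \<alpha> B \<beta>))" "proves \<Phi> (sr e v A)"
    and "typed f (emb_ty (tau (MImp A \<alpha> B \<beta>)))" "typed v (emb_ty (tau A))"
    and "wf_mform \<Sigma> (length e) (MImp A \<alpha> B \<beta>)" "closed_env e"
  shows "proves \<Phi> (hsr e (App f v) \<alpha> B \<beta>)"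
proof -
  let ?\<phi> = "Imp (sr e (BV 0) A) (hsr e (App f (BV 0)) \<alpha> B \<beta>)"
  have "proves \<Phi> (All (emb_ty (tau A)) ?\<phi>)"
    using assms by (simp add: Let_def map_lift_closed_env del: hsr.simps)
  from M_allE[OF this assms(4)] have "proves \<Phi> (Imp (sr e v A) (hsr e (App f v) \<alpha> B \<beta>))"
    using assms by (simp add: map_inst_closed_env sr_inst hsr_inst del: hsr.simps)
  then show ?thesis using assms(2) by (rule M_impE)
qed

lemma sr_MAllD:
  assumes "proves \<Phi> (sr e f (MAll \<alpha> A \<beta>))"
    and "typed f (emb_ty (tau (MAll \<alpha> A \<beta>)))" "typed v MD"
    and "wf_mform \<Sigma> (length e) (MAll \<alpha> A \<beta>)" "closed_env e"
  shows "proves \<Phi> (hsr (v # e) (App f v) \<alpha> A \<beta>)"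
proof -
  have "proves \<Phi> (All MD (hsr (BV 0 # e) (App f (BV 0)) \<alpha> A \<beta>))"
    using assms by (simp add: Let_def map_lift_closed_env del: hsr.simps)
  from M_allE[OF this assms(3)] show ?thesis
    using assms by (simp add: map_inst_closed_env hsr_inst del: hsr.simps)
qed

text \<open>The conclusion of a triple for the outcome \<open>U\<close>, a pair of a value and a final state.\<close>

definition yields ::
  "('f, 'P, 'p, 'g) fm set \<Rightarrow> ('f, 'p, 'g) mterm list \<Rightarrow> ('f, 'p, 'g) mterm \<Rightarrow>
   ('f, 'P, 'p) mform \<Rightarrow> ('f, 'p) sform \<Rightarrow> bool" where
  "yields \<Phi> e U A \<beta> \<longleftrightarrow> proves \<Phi> (sr e (P0 U) A) \<and> proves \<Phi> (emb_sform e \<beta> (P1 U))"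

lemma hsrD:
  assumes "proves \<Phi> (hsr e u \<alpha> A \<beta>)" "\<Phi> \<subseteq> \<Psi>" "proves \<Psi> (emb_sform e \<alpha> s)" "typed s MState"
    and "typed u (MFun MState (MProd (emb_ty (tau A)) MState))"
    and "wf_sform \<Sigma> (length e) \<alpha>" "wf_mform \<Sigma> (length e) A" "wf_sform \<Sigma> (length e) \<beta>" "closed_env e"
  shows "yields \<Psi> e (App u s) A \<beta>"
proof -
  let ?\<phi> = "Imp (emb_sform e \<alpha> (BV 0))
    (And (sr e (P0 (App u (BV 0))) A) (emb_sform e \<beta> (P1 (App u (BV 0)))))"
  have "proves \<Psi> (All MState ?\<phi>)"
    using M_weaken[OF assms(1,2)] assms(5,9) by (simp add: Let_def map_lift_closed_env)
  from M_allE[OF this assms(4)]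
  have "proves \<Psi> (Imp (emb_sform e \<alpha> s) (And (sr e (P0 (App u s)) A) (emb_sform e \<beta> (P1 (App u s)))))"
    using assms by (simp add: map_inst_closed_env sr_inst emb_sform_inst)
  from M_impE[OF this assms(3)] show ?thesis
    by (auto simp: yields_def intro: M_andE1 M_andE2)
qed

lemma fresh_name:
  assumes "finite (S :: (name \<times> mty) set)"
  obtains x where "(x, X) \<notin> S"
proof -
  have "finite (fst ` S)" using assms by simp
  then obtain x where "x \<notin> fst ` S" using ex_new_if_finite infinite_UNIV_nat by blast
  then show ?thesis using that by force
qed

text \<open>A state variable fresh for \<open>\<Phi>\<close> stands for an arbitrary state;
  finiteness of \<open>\<Phi>\<close> provides its name. Its precondition joins the assumptions,
  which is why \<open>hyp\<close> must speak of extensions of \<open>\<Phi>\<close> and not of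
  \<open>\<Phi>\<close> alone.\<close>

lemma hsrI:
  assumes fin: "finite \<Phi>"
    and hyp: "\<And>\<Psi> s. finite \<Psi> \<Longrightarrow> \<Phi> \<subseteq> \<Psi> \<Longrightarrow> typed s MState \<Longrightarrow> proves \<Psi> (emb_sform e \<alpha> s) \<Longrightarrow>
      yields \<Psi> e (App u s) A \<beta>"
    and u: "typed u (MFun MState (MProd (emb_ty (tau A)) MState))"
    and wf: "wf_sform \<Sigma> (length e) \<alpha>" "wf_mform \<Sigma> (length e) A" "wf_sform \<Sigma> (length e) \<beta>"
      "closed_env e"
  shows "proves \<Phi> (hsr e u \<alpha> A \<beta>)"
proof -
  let ?\<phi> = "Imp (emb_sform e \<alpha> (BV 0))
    (And (sr e (P0 (App u (BV 0))) A) (emb_sform e \<beta> (P1 (App u (BV 0)))))"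
  obtain p where p: "(p, MState) \<notin> fv_fm ?\<phi> \<union> (\<Union>\<psi>\<in>\<Phi>. fv_fm \<psi>)"
    using fresh_name[of "fv_fm ?\<phi> \<union> (\<Union>\<psi>\<in>\<Phi>. fv_fm \<psi>)" MState] fin by auto
  let ?s = "FV p MState :: ('f, 'p, 'g) mterm"
  let ?\<Psi> = "insert (emb_sform e \<alpha> ?s) \<Phi>"
  have s: "typed ?s MState" by (rule typed_FV)
  have wf\<alpha>: "wf_fm \<Sigma> E [] (emb_sform e \<alpha> ?s)"
    using wf s by (intro wf_emb_sform) auto
  have "yields ?\<Psi> e (App u ?s) A \<beta>"
    using fin wf\<alpha> s by (intro hyp) (auto intro: M_assm)
  then have "proves \<Phi> (Imp (emb_sform e \<alpha> ?s)
      (And (sr e (P0 (App u ?s)) A) (emb_sform e \<beta> (P1 (App u ?s)))))"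
    using wf\<alpha> by (auto simp: yields_def intro: M_impI M_andI)
  then have "proves \<Phi> (inst_fm 0 ?s ?\<phi>)"
    using u wf s sr_inst[OF s] by (simp add: map_inst_closed_env emb_sform_inst)
  then have "proves \<Phi> (All MState ?\<phi>)"
    using p by (rule M_allI)
  then show ?thesis
    using u wf by (simp add: Let_def map_lift_closed_env)
qed

text \<open>Separates computation from logic: a run is evaluated by equations, and realizability is
  checked for the resulting outcome.\<close>

lemma yields_eq:
  assumes "proves \<Phi> (Eq (MProd (emb_ty (tau A)) MState) U U')" "yields \<Phi> e U' A \<beta>"
    and "typed U (MProd (emb_ty (tau A)) MState)" "typed U' (MProd (emb_ty (tau A)) MState)"
    and "wf_mform \<Sigma> (length e) A" "wf_sform \<Sigma> (length e) \<beta>" "closed_env e"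
  shows "yields \<Phi> e U A \<beta>"
proof -
  have eq: "proves \<Phi> (Eq (MProd (emb_ty (tau A)) MState) U' U)"
    using assms by (blast intro: eq_sym)
  show ?thesis
    unfolding yields_def
  proof
    show "proves \<Phi> (sr e (P0 U) A)"
      using assms eq_P0[OF eq assms(4)] typed_P0[OF assms(3)] typed_P0[OF assms(4)]
      by (auto simp: yields_def intro: sr_eq)
    show "proves \<Phi> (emb_sform e \<beta> (P1 U))"
      using assms eq_P1[OF eq assms(4)] by (auto simp: yields_def intro: sform_eq)
  qed
qed

lemma yields_Pair:
  assumes "proves \<Phi> (sr e v A)" "proves \<Phi> (emb_sform e \<beta> s)"
    and "typed v (emb_ty (tau A))" "typed s MState"
    and "wf_mform \<Sigma> (length e) A" "wf_sform \<Sigma> (length e) \<beta>" "closed_env e"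
  shows "yields \<Phi> e (Pair v s) A \<beta>"
  unfolding yields_def
proof
  have p: "typed (Pair v s) (MProd (emb_ty (tau A)) MState)"
    using assms by (blast intro: typed_Pair)
  show "proves \<Phi> (sr e (P0 (Pair v s)) A)"
    by (rule sr_eq[OF eq_sym[OF M_proj0] assms(1)]) (use assms p in \<open>blast intro: typed_P0\<close>)+
  show "proves \<Phi> (emb_sform e \<beta> (P1 (Pair v s)))"
    by (rule sform_eq[OF eq_sym[OF M_proj1] assms(2)]) (use assms p in \<open>blast intro: typed_P1\<close>)+
qed

text \<open>The state stays fixed throughout, but \<open>\<Psi>\<close> varies, since disjunction
  elimination and implication introduction discharge assumptions. Excluded middle is exactly
  \<open>M_state_dec\<close>.\<close>

lemma HL_sound:
  assumes "HL \<Sigma> \<Delta>H \<Gamma> \<alpha>"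
    and ax: "\<forall>(\<gamma>s, \<alpha>') \<in> \<Delta>H. \<exists>p.
           Imp (conj_list (map (\<lambda>\<gamma>. emb_sform [] \<gamma> (FV p MState)) \<gamma>s))
               (emb_sform [] \<alpha>' (FV p MState)) \<in> meta_ax E"
    and s: "typed s MState"
    and "\<forall>\<gamma>\<in>\<Gamma>. proves \<Psi> (emb_sform [] \<gamma> s)"
  shows "proves \<Psi> (emb_sform [] \<alpha> s)"
  using assms(1,4)
proof (induction arbitrary: \<Psi> rule: HL.induct)
  have emb_wf: "wf_fm \<Sigma> E [] (emb_sform [] \<alpha> s)" if "wf_sform \<Sigma> 0 \<alpha>" for \<alpha>
    using that s by (intro wf_emb_sform) auto
  have hyps: "\<forall>\<gamma>\<in>insert \<alpha> \<Gamma>. proves (insert (emb_sform [] \<alpha> s) \<Psi>) (emb_sform [] \<gamma> s)"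
    if "\<forall>\<gamma>\<in>\<Gamma>. proves \<Psi> (emb_sform [] \<gamma> s)" "wf_sform \<Sigma> 0 \<alpha>" for \<alpha> \<Gamma> \<Psi>
    using that emb_wf by (auto intro: M_assm M_weaken)
  {
    case (H_assm \<alpha> \<Gamma>)
    then show ?case by blast
  next
    case H_topI
    show ?case by (simp add: M_topI)
  next
    case (H_botE \<Gamma> \<alpha>)
    then show ?case using emb_wf by (auto intro: M_botE)
  next
    case (H_andI \<Gamma> \<alpha> \<beta>)
    then show ?case by (auto intro: M_andI)
  next
    case (H_andE1 \<Gamma> \<alpha> \<beta>)
    then show ?case by (auto intro: M_andE1)
  next
    case (H_andE2 \<Gamma> \<alpha> \<beta>)
    then show ?case by (auto intro: M_andE2)
  next
    case (H_orI1 \<Gamma> \<alpha> \<beta>)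
    then show ?case using emb_wf by (auto intro: M_orI1)
  next
    case (H_orI2 \<Gamma> \<alpha> \<beta>)
    then show ?case using emb_wf by (auto intro: M_orI2)
  next
    case (H_orE \<Gamma> \<alpha> \<beta> \<gamma>)
    have wf: "wf_sform \<Sigma> 0 \<alpha>" "wf_sform \<Sigma> 0 \<beta>"
      using HL_wf[OF H_orE.hyps(1)] by auto
    show ?case
    proof (rule M_orE)
      show "proves \<Psi> (Or (emb_sform [] \<alpha> s) (emb_sform [] \<beta> s))"
        using H_orE.IH(1)[OF H_orE.prems] by simp
    qed (use H_orE.IH(2,3) hyps[OF H_orE.prems] wf in blast)+
  next
    case (H_impI \<alpha> \<Gamma> \<beta>)
    have wf: "wf_sform \<Sigma> 0 \<alpha>"
      using HL_wf[OF H_impI.hyps(1)] by auto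
    then show ?case
      using H_impI.IH[OF hyps[OF H_impI.prems]] emb_wf by (auto intro: M_impI)
  next
    case (H_impE \<Gamma> \<alpha> \<beta>)
    then show ?case by (auto intro: M_impE)
  next
    case (H_lem \<Gamma> \<alpha>)
    then show ?case using s by (auto intro: M_state_dec)
  next
    case (H_ax \<gamma>s \<alpha> \<Gamma>)
    have wf: "\<forall>\<gamma>\<in>set \<gamma>s. wf_sform \<Sigma> 0 \<gamma>" "wf_sform \<Sigma> 0 \<alpha>"
      using H_ax.hyps by auto
    let ?\<phi> = "\<lambda>\<pi>. Imp (conj_list (map (\<lambda>\<gamma>. emb_sform [] \<gamma> \<pi>) \<gamma>s)) (emb_sform [] \<alpha> \<pi>)"
    have inst: "inst_fm 0 w (?\<phi> (BV 0)) = ?\<phi> w" for w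
    proof -
      have "inst_fm 0 w (conj_list (map (\<lambda>\<gamma>. emb_sform [] \<gamma> (BV 0)) \<gamma>s)) =
          conj_list (map (\<lambda>\<gamma>. emb_sform [] \<gamma> w) \<gamma>s)"
        using wf(1) by (induction \<gamma>s rule: induct_list012) (auto simp: emb_sform_inst)
      then show ?thesis using wf(2) by (simp add: emb_sform_inst)
    qed
    obtain p where p: "?\<phi> (FV p MState) \<in> meta_ax E"
      using ax H_ax.hyps(1) by blast
    \<comment> \<open>Whatever name \<open>p\<close> the axiom uses, its embedded formulas contain
      that name at sort \<open>MState\<close> only as the state argument. All their other variables
      have sort \<open>MD\<close>, so \<open>p\<close> can be generalized.\<close>
    have "fv_fm (conj_list (map (\<lambda>\<gamma>. emb_sform [] \<gamma> (BV 0)) \<gamma>s)) \<subseteq> UNIV \<times> {MD}"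
      using wf(1)
    proof (induction \<gamma>s rule: induct_list012)
      case (2 \<gamma>)
      then show ?case using fv_emb_sform[of \<Sigma> "[]" \<gamma> "BV 0"] by auto
    next
      case (3 \<gamma> \<gamma>' \<gamma>s)
      then show ?case using fv_emb_sform[of \<Sigma> "[]" \<gamma> "BV 0"] by auto
    qed simp
    then have "(p, MState) \<notin> fv_fm (?\<phi> (BV 0))"
      using wf(2) fv_emb_sform[of \<Sigma> "[]" \<alpha> "BV 0"] by auto
    \<comment> \<open>The empty set of assumptions leaves no further condition on \<open>p\<close>;
      the generalized axiom is instantiated with \<open>s\<close> and weakened afterwards.\<close>
    moreover have "proves {} (?\<phi> (FV p MState))"
      using p wf_ext by (auto simp: wf_extension_def intro: M_ax)
    ultimately have "proves {} (All MState (?\<phi> (BV 0)))"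
      using M_allI[of \<Sigma> E "{}" p MState "?\<phi> (BV 0)"] unfolding inst by simp
    from M_allE[OF this s] have "proves \<Psi> (?\<phi> s)"
      unfolding inst by (rule M_weaken) simp
    moreover have "\<forall>\<gamma>\<in>set \<gamma>s. proves \<Psi> (emb_sform [] \<gamma> s)"
      using H_ax by blast
    then have "proves \<Psi> (conj_list (map (\<lambda>\<gamma>. emb_sform [] \<gamma> s) \<gamma>s))"
      by (induction \<gamma>s rule: induct_list012) (auto intro: M_topI M_andI)
    ultimately show ?case by (rule M_impE)
  }
qed

end

section \<open>Closed formulas and vacuous instances\<close>

lemma mtyping_emb_term_closed: "wf_term \<Sigma> 0 t \<Longrightarrow> mtyping \<Sigma> E bs (emb_term [] t) MD"
  using mtyping_emb_term[of \<Sigma> "[]"] by simp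

lemma emb_sform_append:
  "wf_sform \<Sigma> (length e) \<alpha> \<Longrightarrow> emb_sform (e @ e') \<alpha> \<pi> = emb_sform e \<alpha> \<pi>"
  by (induction \<alpha>) (auto simp: emb_term_append)

text \<open>Together with \<open>sr_closed\<close>, this moves closed formulas into and out of the
  environment that holds an existential witness.\<close>

lemma emb_sform_closed: "wf_sform \<Sigma> 0 \<alpha> \<Longrightarrow> emb_sform e \<alpha> \<pi> = emb_sform [] \<alpha> \<pi>"
  using emb_sform_append[of \<Sigma> "[]"] by simp

lemma sr_append: "wf_mform \<Sigma> (length e) A \<Longrightarrow> sr (e @ e') u A = sr e u A"
proof (induction A arbitrary: e e' u)
  case (MEx A)
  then show ?case using MEx.IH[of "P0 u # e"] by simp
next
  case (MImp A \<alpha> B \<beta>)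
  then show ?case
    by (simp add: Let_def emb_sform_append[of \<Sigma> "map g e" for g, simplified])
next
  case (MAll \<alpha> A \<beta>)
  let ?e = "BV (Suc 0) # map (lift 0) (map (lift 0) e)"
  show ?case
    using MAll.prems MAll.IH[of ?e]
    by (simp add: Let_def emb_sform_append[of \<Sigma> ?e, simplified])
qed (auto simp: emb_term_append)

lemma sr_closed: "wf_mform \<Sigma> 0 A \<Longrightarrow> sr e u A = sr [] u A"
  using sr_append[of \<Sigma> "[]"] by simp

lemma inst_term_id: "wf_term \<Sigma> k t \<Longrightarrow> inst_term k s t = t"
  by (induction t) (auto intro!: map_idI)

lemma inst_sform_id: "wf_sform \<Sigma> k \<alpha> \<Longrightarrow> inst_sform k s \<alpha> = \<alpha>"
  by (induction \<alpha>) (auto intro!: map_idI inst_term_id)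

text \<open>Makes vacuous quantification available: a closed formula taken as the body of a
  quantifier has only itself as an instance. The elimination of \<exists> and the removal of
  additional variables both rest on this.\<close>

lemma inst_mform_id: "wf_mform \<Sigma> k A \<Longrightarrow> inst_mform k s A = A"
  by (induction A arbitrary: k) (auto intro!: map_idI inst_term_id inst_sform_id)

subsection \<open>First-order terms as programs\<close>

fun comp_list :: "('f, 'p, 'k) st_term list \<Rightarrow> ('f, 'p, 'k) st_term" where
  "comp_list [] = Skip"
| "comp_list [t] = t"
| "comp_list (t # u # ts) = Comp t (comp_list (u # ts))"

text \<open>Only index-free terms are translated, so \<open>Skip\<close> is an arbitrary value for
  indices. A constant symbol is not applied, in accordance with the reading of
  \<open>tpow_fun\<close> at 0.\<close>

fun st_of_fo :: "'f fo_term \<Rightarrow> ('f, 'p, 'k) st_term" where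
  "st_of_fo (Free x) = Var x"
| "st_of_fo (Bound i) = Skip"
| "st_of_fo (Fn f ts) = (if ts = [] then Fun f else Ap (Fun f) (comp_list (map st_of_fo ts)))"

lemma st_typing_comp_list:
  "\<forall>t\<in>set ts. st_typing \<Sigma> E \<Delta> t TD \<Longrightarrow> st_typing \<Sigma> E \<Delta> (comp_list ts) (tpow (length ts))"
  by (induction ts rule: comp_list.induct) (auto intro: st_typing.intros)

lemma st_typing_st_of_fo:
  "wf_term \<Sigma> 0 t \<Longrightarrow> \<forall>x\<in>fv_term t. \<Delta> x = Some TD \<Longrightarrow> st_typing \<Sigma> E \<Delta> (st_of_fo t) TD"
proof (induction t)
  case (Fn f ts)
  have f: "st_typing \<Sigma> E \<Delta> (Fun f) (tpow_fun (length ts) TD)"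
    using Fn.prems by (auto intro: st_typing.intros)
  have ts: "st_typing \<Sigma> E \<Delta> (comp_list (map st_of_fo ts)) (tpow (length ts))"
    using Fn by (intro st_typing_comp_list[of "map st_of_fo ts", simplified]) auto
  show ?case using f st_typing_Ap[OF _ ts] by (auto simp: tpow_fun_def)
qed (auto intro: st_typing.intros)

context metatheory
begin

lemma run:
  assumes "st_typing \<Sigma> E \<Delta> t X" "emb \<Sigma> E \<Delta> t = Lam MState b" "typed s MState"
  shows "proves \<Phi> (Eq (MProd (emb_ty X) MState) (App (emb \<Sigma> E \<Delta> t) s) (inst_mterm 0 s b))"
    and "typed (inst_mterm 0 s b) (MProd (emb_ty X) MState)"
proof -
  have t: "typed (Lam MState b) (MFun MState (MProd (emb_ty X) MState))"
    using typed_emb[OF assms(1)] assms(2) by simp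
  then have "mtyping \<Sigma> E [MState] b (MProd (emb_ty X) MState)"
    by (auto elim: mtyping.cases)
  then show "typed (inst_mterm 0 s b) (MProd (emb_ty X) MState)"
    using assms(3) by (rule mtyping_inst)
  show "proves \<Phi> (Eq (MProd (emb_ty X) MState) (App (emb \<Sigma> E \<Delta> t) s) (inst_mterm 0 s b))"
    using beta[OF t assms(3)] assms(2) by simp
qed

lemma typed_run:
  "st_typing \<Sigma> E \<Delta> t X \<Longrightarrow> typed s MState \<Longrightarrow>
    typed (App (emb \<Sigma> E \<Delta> t) s) (MProd (emb_ty X) MState)"
  by (rule typed_App[OF typed_emb])

lemma eq_PairD:
  assumes "proves \<Phi> (Eq (MProd X Y) U (Pair a b))" "typed U (MProd X Y)" "typed a X" "typed b Y"
  shows "proves \<Phi> (Eq X (P0 U) a)" "proves \<Phi> (Eq Y (P1 U) b)"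
proof -
  show "proves \<Phi> (Eq X (P0 U) a)"
    by (rule eq_trans[OF eq_P0[OF assms(1,2)] M_proj0]) (use assms in \<open>blast intro: typed_P0\<close>)+
  show "proves \<Phi> (Eq Y (P1 U) b)"
    by (rule eq_trans[OF eq_P1[OF assms(1,2)] M_proj1]) (use assms in \<open>blast intro: typed_P1\<close>)+
qed

text \<open>The call at the end of \<open>Ap\<close> uses the value and the final state of the
  argument; once the argument has been evaluated to \<open>v\<close> and \<open>s\<close>, these can
  be inserted.\<close>

lemma eq_App_App:
  assumes "proves \<Phi> (Eq (MProd X MState) V (Pair v s))" "typed V (MProd X MState)"
    and "typed v X" "typed s MState" "typed f (MFun X (MFun MState Y))"
  shows "proves \<Phi> (Eq Y (App (App f (P0 V)) (P1 V)) (App (App f v) s))"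
proof (rule eq_App)
  show "proves \<Phi> (Eq (MFun MState Y) (App f (P0 V)) (App f v))"
    by (rule eq_App[OF M_refl[OF assms(5)] eq_PairD(1)[OF assms(1-4)] assms(5,5)
      typed_P0[OF assms(2)]])
qed (use assms eq_PairD(2)[OF assms(1-4)] in \<open>blast intro: typed_App typed_P0 typed_P1\<close>)+

lemma run_Comp:
  assumes "st_typing \<Sigma> E \<Delta> t X" "st_typing \<Sigma> E \<Delta> u Y" "typed s MState"
    and t: "proves \<Phi> (Eq (MProd (emb_ty X) MState) (App (emb \<Sigma> E \<Delta> t) s) (Pair a s1))"
    and u: "proves \<Phi> (Eq (MProd (emb_ty Y) MState) (App (emb \<Sigma> E \<Delta> u) s1) (Pair b s2))"
    and ty: "typed a (emb_ty X)" "typed b (emb_ty Y)" "typed s1 MState" "typed s2 MState"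
  shows "proves \<Phi> (Eq (MProd (emb_ty (TProd X Y)) MState)
    (App (emb \<Sigma> E \<Delta> (Comp t u)) s) (Pair (Pair a b) s2))"
proof -
  let ?U = "App (emb \<Sigma> E \<Delta> t) s" let ?V = "App (emb \<Sigma> E \<Delta> u) (P1 ?U)"
  note te = typed_emb[OF assms(1)] and ue = typed_emb[OF assms(2)]
  have U: "typed ?U (MProd (emb_ty X) MState)"
    by (rule typed_run) fact+
  have V: "typed ?V (MProd (emb_ty Y) MState)"
    by (rule typed_run[OF assms(2) typed_P1[OF U]])
  note eU = eq_PairD[OF t U ty(1,3)]
  have "proves \<Phi> (Eq (MProd (emb_ty Y) MState) ?V (App (emb \<Sigma> E \<Delta> u) s1))"
    by (rule eq_App[OF M_refl[OF ue] eU(2) ue ue typed_P1[OF U]])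
  from eq_trans[OF this u V]
  have "proves \<Phi> (Eq (MProd (emb_ty Y) MState) ?V (Pair b s2))" .
  note eV = eq_PairD[OF this V ty(2,4)]
  have tc: "st_typing \<Sigma> E \<Delta> (Comp t u) (TProd X Y)"
    by (rule st_typing.intros) fact+
  have 1: "proves \<Phi> (Eq (MProd (MProd (emb_ty X) (emb_ty Y)) MState)
      (App (emb \<Sigma> E \<Delta> (Comp t u)) s) (Pair (Pair (P0 ?U) (P0 ?V)) (P1 ?V)))"
    using run(1)[OF tc emb.simps(6) assms(3)] te ue by (simp add: Let_def)
  have 2: "proves \<Phi> (Eq (MProd (MProd (emb_ty X) (emb_ty Y)) MState)
      (Pair (Pair (P0 ?U) (P0 ?V)) (P1 ?V)) (Pair (Pair a b) s2))"
    by (rule eq_Pair[OF eq_Pair[OF eU(1) eV(1)] eV(2)])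
      (use U V ty in \<open>blast intro: typed_P0 typed_P1 typed_Pair\<close>)+
  show ?thesis
    using eq_trans[OF 1 2] typed_run[OF tc assms(3)] by simp
qed

lemma run_Ap:
  assumes "st_typing \<Sigma> E \<Delta> t (TFun X Y)" "st_typing \<Sigma> E \<Delta> u X" "typed s MState"
  defines "U \<equiv> App (emb \<Sigma> E \<Delta> t) s"
  defines "V \<equiv> App (emb \<Sigma> E \<Delta> u) (P1 U)"
  shows "proves \<Phi>
    (Eq (MProd (emb_ty Y) MState) (App (emb \<Sigma> E \<Delta> (Ap t u)) s) (App (App (P0 U) (P0 V)) (P1 V)))"
  using run(1)[OF st_typing_Ap[OF assms(1,2)] emb.simps(13) assms(3)]
    typed_emb[OF assms(1)] typed_emb[OF assms(2)]
  by (simp add: Let_def U_def V_def)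

text \<open>First-order terms are pure: they leave the state alone. An exact equation is required,
  because \<open>t\<close> also enters formulas by substitution, where its value has to be
  \<open>emb_term [] t\<close>.\<close>

lemma run_st_of_fo:
  "wf_term \<Sigma> 0 t \<Longrightarrow> \<forall>x\<in>fv_term t. \<Delta> x = Some TD \<Longrightarrow> typed s MState \<Longrightarrow>
    proves \<Phi> (Eq (MProd MD MState) (App (emb \<Sigma> E \<Delta> (st_of_fo t)) s) (Pair (emb_term [] t) s))"
proof (induction t)
  case (Free x)
  have "st_typing \<Sigma> E \<Delta> (Var x) TD" using Free by (auto intro: st_typing.intros)
  from run(1)[OF this emb.simps(1) Free(3)] show ?case using Free by simp
next
  case (Fn f ts)
  have n: "fun_ar \<Sigma> f = Some (length ts)" using Fn.prems by simp
  have fty: "st_typing \<Sigma> E \<Delta> (Fun f) (tpow_fun (length ts) TD)"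
    using n by (rule st_typing.intros)
  note run_f = run(1)[OF fty emb.simps(5)[unfolded Let_def] Fn.prems(3)]
  have fc: "typed (FunC f) (mpow_fun (length ts) MD)"
    using n by (rule mtyping.intros)
  show ?case
  proof (cases "ts = []")
    case True
    with run_f n show ?thesis by (simp add: Let_def tpow_fun_def app_tuple_def)
  next
    case False
    let ?c = "comp_list (map st_of_fo ts) :: ('f, 'p, 'k) st_term"
    let ?a = "tuple (map (emb_term []) ts) :: ('f, 'p, 'g) mterm"
    let ?F = "Lam (mpow (length ts)) (Lam MState (Pair (App (FunC f) (BV 1)) (BV 0)))"
    have IH: "\<forall>t\<in>set ts. wf_term \<Sigma> 0 t \<and> st_typing \<Sigma> E \<Delta> (st_of_fo t :: ('f, 'p, 'k) st_term) TD \<and>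
        proves \<Phi> (Eq (MProd MD MState) (App (emb \<Sigma> E \<Delta> (st_of_fo t)) s) (Pair (emb_term [] t) s))"
      using Fn by (auto intro: st_typing_st_of_fo)
    have aty: "typed ?a (mpow (length ts))"
      using mtyping_tuple[of "map (emb_term []) ts" \<Sigma> E "[]"] Fn.prems(1)
      by (auto intro: mtyping_emb_term_closed)
    have cty: "st_typing \<Sigma> E \<Delta> ?c (tpow (length ts))"
      using st_typing_comp_list[of "map st_of_fo ts"] IH by auto
    \<comment> \<open>The arguments are evaluated from left to right, and none of them changes the
      state, so \<open>run_Comp\<close> applies with \<open>s\<close> in all three places.\<close>
    have run_c: "proves \<Phi> (Eq (MProd (mpow (length ts)) MState) (App (emb \<Sigma> E \<Delta> ?c) s) (Pair ?a s))"
      using False IH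
    proof (induction ts rule: induct_list012)
      case (3 t u ts)
      have c: "st_typing \<Sigma> E \<Delta> (comp_list (map st_of_fo (u # ts)) :: ('f, 'p, 'k) st_term)
        (tpow (length (u # ts)))"
        using st_typing_comp_list[of "map st_of_fo (u # ts)"] 3(4) by auto
      have a: "typed (tuple (map (emb_term []) (u # ts))) (emb_ty (tpow (length (u # ts))))"
        using mtyping_tuple[of "map (emb_term []) (u # ts)" \<Sigma> E "[]"] 3(4)
        by (auto intro: mtyping_emb_term_closed simp: emb_ty_tpow)
      show ?case
        using run_Comp[OF _ c Fn.prems(3) _ _ _ a Fn.prems(3,3), of "st_of_fo t" TD \<Phi> "emb_term [] t"]
          3 mtyping_emb_term[of \<Sigma> "[]" t E "[]"]
        by (simp add: emb_ty_tpow)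
    qed simp_all
    have fty: "st_typing \<Sigma> E \<Delta> (Fun f) (TFun (tpow (length ts)) TD)"
      using fty False by (simp add: tpow_fun_def)
    let ?U = "App (emb \<Sigma> E \<Delta> (Fun f)) s"
    let ?V = "App (emb \<Sigma> E \<Delta> ?c) (P1 ?U)"
    have U: "typed ?U (MProd (emb_ty (TFun (tpow (length ts)) TD)) MState)"
      by (rule typed_run[OF fty Fn.prems(3)])
    have V: "typed ?V (MProd (mpow (length ts)) MState)"
      using typed_run[OF cty typed_P1[OF U]] by (simp add: emb_ty_tpow)
    have fc: "typed (FunC f) (MFun (mpow (length ts)) MD)"
      using fc False by (simp add: mpow_fun_def)
    have F: "typed ?F (MFun (mpow (length ts)) (MFun MState (MProd MD MState)))"
      using mtyping_BV[of 0 "[MState, mpow (length ts)]" \<Sigma> E]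
        mtyping_BV[of 1 "[MState, mpow (length ts)]" \<Sigma> E]
      by (auto intro!: mtyping_Pair mtyping_Lam mtyping_App[OF mtyping_closed_weaken[OF fc]])
    have eU: "proves \<Phi>
      (Eq (MProd (MFun (mpow (length ts)) (MFun MState (MProd MD MState))) MState) ?U (Pair ?F s))"
      using run_f n False by (simp add: tpow_fun_def emb_ty_tpow)
    note U' = U[simplified emb_ty.simps emb_ty_tpow]
    note eU = eq_PairD[OF eU U' F Fn.prems(3)]
    note ce = typed_emb[OF cty, unfolded emb_ty_tpow]
    have "proves \<Phi> (Eq (MProd (mpow (length ts)) MState) ?V (App (emb \<Sigma> E \<Delta> ?c) s))"
      by (rule eq_App[OF M_refl[OF ce] eU(2) ce ce typed_P1[OF U]])
    from eq_trans[OF this run_c V]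
    have eV: "proves \<Phi> (Eq (MProd (mpow (length ts)) MState) ?V (Pair ?a s))" .
    \<comment> \<open>A chain of five equations: unfold \<open>Ap\<close>, insert the value of the
      argument tuple, insert the value \<open>?F\<close> of \<open>Fun f\<close>, and contract the
      two abstractions of \<open>?F\<close>, over the arguments and over the state.\<close>
    have 1: "proves \<Phi>
      (Eq (MProd MD MState) (App (emb \<Sigma> E \<Delta> (Ap (Fun f) ?c)) s) (App (App (P0 ?U) (P0 ?V)) (P1 ?V)))"
      using run_Ap[OF fty cty Fn.prems(3)] by simp
    have 2: "proves \<Phi>
      (Eq (MProd MD MState) (App (App (P0 ?U) (P0 ?V)) (P1 ?V)) (App (App (P0 ?U) ?a) s))"
      by (rule eq_App_App[OF eV V aty Fn.prems(3) typed_P0[OF U']])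
    have 3: "proves \<Phi> (Eq (MProd MD MState) (App (App (P0 ?U) ?a) s) (App (App ?F ?a) s))"
      by (rule eq_App[OF eq_App[OF eU(1) M_refl[OF aty] typed_P0[OF U'] F aty] M_refl[OF Fn.prems(3)]
            typed_App[OF typed_P0[OF U'] aty] typed_App[OF F aty] Fn.prems(3)])
    let ?G = "Lam MState (Pair (App (FunC f) ?a) (BV 0))"
    have G: "typed ?G (MFun MState (MProd MD MState))"
      by (rule mtyping_Pair mtyping_Lam mtyping_BV0 mtyping_closed_weaken[OF typed_App[OF fc aty]])+
    have 4: "proves \<Phi> (Eq (MProd MD MState) (App (App ?F ?a) s) (App ?G s))"
      using eq_App[OF beta[OF F aty] M_refl[OF Fn.prems(3)] typed_App[OF F aty] _ Fn.prems(3)] G aty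
      by simp
    have 5: "proves \<Phi> (Eq (MProd MD MState) (App ?G s) (Pair (emb_term [] (Fn f ts)) s))"
      using beta[OF G Fn.prems(3)] False aty by (simp add: app_tuple_def)
    have W: "typed (App (emb \<Sigma> E \<Delta> (Ap (Fun f) ?c)) s) (MProd MD MState)"
      using typed_run[OF st_typing_Ap[OF fty cty] Fn.prems(3)] by simp
    show ?thesis
      using eq_trans[OF eq_trans[OF eq_trans[OF eq_trans[OF 1 2 W] 3 W] 4 W] 5 W] False by simp
  qed
qed simp

subsection \<open>Realizers for the rules of SL\<close>

text \<open>Finiteness and well-formedness are bundled with the realizer because \<open>hsrI\<close>
  asks for them; each rule below passes them on together with the term.\<close>

definition realizes ::
  "(name \<rightharpoonup> ty) \<Rightarrow> ('f, 'P, 'p, 'g) fm set \<Rightarrow> ('f, 'p, 'k) st_term \<Rightarrow>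
   ('f, 'p) sform \<Rightarrow> ('f, 'P, 'p) mform \<Rightarrow> ('f, 'p) sform \<Rightarrow> bool" where
  "realizes \<Delta> \<Phi> t \<alpha> A \<beta> \<longleftrightarrow>
     finite \<Phi> \<and> wf_sform \<Sigma> 0 \<alpha> \<and> wf_mform \<Sigma> 0 A \<and> wf_sform \<Sigma> 0 \<beta> \<and>
     st_typing \<Sigma> E \<Delta> t (tau A) \<and> proves \<Phi> (hsr [] (emb \<Sigma> E \<Delta> t) \<alpha> A \<beta>)"

lemma realizesD:
  assumes "realizes \<Delta> \<Phi> t \<alpha> A \<beta>"
  shows "finite \<Phi>" "wf_sform \<Sigma> 0 \<alpha>" "wf_mform \<Sigma> 0 A" "wf_sform \<Sigma> 0 \<beta>"
    "st_typing \<Sigma> E \<Delta> t (tau A)" "proves \<Phi> (hsr [] (emb \<Sigma> E \<Delta> t) \<alpha> A \<beta>)"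
  using assms by (auto simp: realizes_def simp del: hsr.simps)

lemma realizes_run:
  assumes "realizes \<Delta> \<Phi> t \<alpha> A \<beta>" "\<Phi> \<subseteq> \<Psi>" "proves \<Psi> (emb_sform [] \<alpha> s)" "typed s MState"
  shows "yields \<Psi> [] (App (emb \<Sigma> E \<Delta> t) s) A \<beta>"
  using realizesD[OF assms(1)] assms by (intro hsrD) (auto intro: typed_emb simp del: hsr.simps)

lemma realizes_typed_run:
  assumes "realizes \<Delta> \<Phi> t \<alpha> A \<beta>" "typed s MState"
  shows "typed (App (emb \<Sigma> E \<Delta> t) s) (MProd (emb_ty (tau A)) MState)"
  using typed_run[OF realizesD(5)] assms .

text \<open>Every ST constructor except \<open>Const\<close> is embedded as an abstraction over the
  state. One beta step therefore reduces the run to the body \<open>b\<close> with \<open>s\<close>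
  at index 0, and only this outcome remains to be examined.\<close>

lemma realizesI:
  assumes "finite \<Phi>" "wf_sform \<Sigma> 0 \<alpha>" "wf_mform \<Sigma> 0 A" "wf_sform \<Sigma> 0 \<beta>"
    and "st_typing \<Sigma> E \<Delta> t (tau A)" "emb \<Sigma> E \<Delta> t = Lam MState b"
    and "\<And>\<Psi> s. finite \<Psi> \<Longrightarrow> \<Phi> \<subseteq> \<Psi> \<Longrightarrow> typed s MState \<Longrightarrow> proves \<Psi> (emb_sform [] \<alpha> s) \<Longrightarrow>
      yields \<Psi> [] (inst_mterm 0 s b) A \<beta>"
  shows "realizes \<Delta> \<Phi> t \<alpha> A \<beta>"
proof -
  have "proves \<Phi> (hsr [] (emb \<Sigma> E \<Delta> t) \<alpha> A \<beta>)"
  proof (rule hsrI)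
    fix \<Psi> s
    assume *: "finite \<Psi>" "\<Phi> \<subseteq> \<Psi>" "typed s MState" "proves \<Psi> (emb_sform [] \<alpha> s)"
    show "yields \<Psi> [] (App (emb \<Sigma> E \<Delta> t) s) A \<beta>"
      by (rule yields_eq[OF run(1)[OF assms(5,6) *(3)] assms(7)[OF *]
            typed_run[OF assms(5) *(3)] run(2)[OF assms(5,6) *(3)]]) (use assms in simp_all)
  qed (use assms(1-4) typed_emb[OF assms(5)] in simp_all)
  then show ?thesis using assms unfolding realizes_def by blast
qed

lemma realizes_weaken:
  assumes "realizes \<Delta> \<Phi> t \<alpha> A \<beta>" "\<Delta> \<subseteq>\<^sub>m \<Delta>'" "\<Phi> \<subseteq> \<Psi>" "finite \<Psi>"
  shows "realizes \<Delta>' \<Psi> t \<alpha> A \<beta>"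
  using realizesD[OF assms(1)] st_typing_weaken[OF realizesD(5)[OF assms(1)] assms(2)]
    emb_weaken[OF realizesD(5)[OF assms(1)] assms(2)] assms(3,4)
      M_weaken[OF realizesD(6)[OF assms(1)] assms(3)]
  by (simp add: realizes_def del: hsr.simps)

lemma yields_orE:
  "proves \<Phi> (Or \<phi> \<psi>) \<Longrightarrow> yields (insert \<phi> \<Phi>) e U A \<beta> \<Longrightarrow> yields (insert \<psi> \<Phi>) e U A \<beta> \<Longrightarrow> yields \<Phi> e U A \<beta>"
  by (auto simp: yields_def intro: M_orE)

lemma yieldsD:
  assumes "yields \<Phi> e U A \<beta>"
  shows "proves \<Phi> (sr e (P0 U) A)" "proves \<Phi> (emb_sform e \<beta> (P1 U))"
  using assms by (auto simp: yields_def)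

lemma yields_botE:
  assumes "proves \<Phi> Bot" "typed U (MProd (emb_ty (tau A)) MState)"
    and "wf_mform \<Sigma> 0 A" "wf_sform \<Sigma> 0 \<beta>"
  shows "yields \<Phi> [] U A \<beta>"
  unfolding yields_def using assms
  by (auto intro!: M_botE wf_sr wf_emb_sform intro: typed_P0 typed_P1)

text \<open>The left conjunct comes from the realizer \<open>a\<close>. The right one is vacuous, as
  its premise would identify \<open>TT\<close> with \<open>FF\<close>; hence \<open>b\<close> can be
  any term of the right type, such as a \<open>zero\<close>.\<close>

lemma proves_sr_Inj0:
  assumes "proves \<Phi> (sr e a A)" "typed a (emb_ty (tau A))" "typed b (emb_ty (tau B))"
    and "wf_mform \<Sigma> (length e) A" "wf_mform \<Sigma> (length e) B" "closed_env e"
  shows "proves \<Phi> (sr e (Pair FF (Pair a b)) (MOr A B))"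
proof -
  let ?c = "Pair a b" let ?v = "Pair FF ?c"
  have FF: "typed FF MBool" and TT: "typed TT MBool" by (auto intro: mtyping.intros)
  have c: "typed ?c (MProd (emb_ty (tau A)) (emb_ty (tau B)))"
    using assms by (blast intro: typed_Pair)
  have v: "typed ?v (MProd MBool (MProd (emb_ty (tau A)) (emb_ty (tau B))))"
    using c FF by (blast intro: typed_Pair)
  have refl: "proves \<Psi> (Eq (MProd MBool (MProd (emb_ty (tau A)) (emb_ty (tau B)))) ?v ?v)" for \<Psi>
    by (rule M_refl[OF v])
  note e = eq_PairD[OF refl v FF c]
  note e1 = eq_PairD[OF e(2) typed_P1[OF v] assms(2,3)]
  have a: "proves \<Phi> (sr e (P0 (P1 ?v)) A)"
    by (rule sr_eq[OF eq_sym[OF e1(1)] assms(1)])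
      (use assms v in \<open>blast intro: typed_P0 typed_P1\<close>)+
  have wf: "wf_fm \<Sigma> E [] (Eq MBool (P0 ?v) FF)" "wf_fm \<Sigma> E [] (Eq MBool (P0 ?v) TT)"
    using typed_P0[OF v] TT FF by simp_all
  let ?\<Psi> = "insert (Eq MBool (P0 ?v) TT) \<Phi>"
  have "proves ?\<Psi> (Eq MBool (P0 ?v) TT)"
    using wf by (auto intro: M_assm)
  from eq_trans[OF eq_sym[OF this typed_P0[OF v]] e(1) TT]
  have "proves ?\<Psi> (Eq MBool TT FF)" .
  from M_impE[OF M_distinct this] have "proves ?\<Psi> (sr e (P1 (P1 ?v)) B)"
    by (rule M_botE, intro wf_sr) (use assms typed_P1[OF typed_P1[OF v]] in auto)
  then show ?thesis
    using a wf by (auto intro!: M_andI M_impI intro: M_weaken)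
qed

lemma proves_sr_Inj1:
  assumes "proves \<Phi> (sr e b B)" "typed a (emb_ty (tau A))" "typed b (emb_ty (tau B))"
    and "wf_mform \<Sigma> (length e) A" "wf_mform \<Sigma> (length e) B" "closed_env e"
  shows "proves \<Phi> (sr e (Pair TT (Pair a b)) (MOr A B))"
proof -
  let ?c = "Pair a b" let ?v = "Pair TT ?c"
  have FF: "typed FF MBool" and TT: "typed TT MBool" by (auto intro: mtyping.intros)
  have c: "typed ?c (MProd (emb_ty (tau A)) (emb_ty (tau B)))"
    using assms by (blast intro: typed_Pair)
  have v: "typed ?v (MProd MBool (MProd (emb_ty (tau A)) (emb_ty (tau B))))"
    using c TT by (blast intro: typed_Pair)
  have refl: "proves \<Psi> (Eq (MProd MBool (MProd (emb_ty (tau A)) (emb_ty (tau B)))) ?v ?v)" for \<Psi>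
    by (rule M_refl[OF v])
  note e = eq_PairD[OF refl v TT c]
  note e1 = eq_PairD[OF e(2) typed_P1[OF v] assms(2,3)]
  have b: "proves \<Phi> (sr e (P1 (P1 ?v)) B)"
    by (rule sr_eq[OF eq_sym[OF e1(2)] assms(1)])
      (use assms v in \<open>blast intro: typed_P0 typed_P1\<close>)+
  have wf: "wf_fm \<Sigma> E [] (Eq MBool (P0 ?v) FF)" "wf_fm \<Sigma> E [] (Eq MBool (P0 ?v) TT)"
    using typed_P0[OF v] TT FF by simp_all
  let ?\<Psi> = "insert (Eq MBool (P0 ?v) FF) \<Phi>"
  have "proves ?\<Psi> (Eq MBool (P0 ?v) FF)"
    using wf by (auto intro: M_assm)
  from eq_trans[OF eq_sym[OF e(1) typed_P0[OF v]] this TT]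
  have "proves ?\<Psi> (Eq MBool TT FF)" .
  from M_impE[OF M_distinct this] have "proves ?\<Psi> (sr e (P0 (P1 ?v)) A)"
    by (rule M_botE, intro wf_sr) (use assms typed_P0[OF typed_P1[OF v]] in auto)
  then show ?thesis
    using b wf by (auto intro!: M_andI M_impI intro: M_weaken)
qed

lemma realizes_assm:
  assumes "finite \<Phi>" "\<Delta> x = Some (tau A)" "sr [] (FV x (emb_ty (tau A))) A \<in> \<Phi>"
    and "wf_mform \<Sigma> 0 A" "wf_sform \<Sigma> 0 \<alpha>"
  shows "realizes \<Delta> \<Phi> (Var x) \<alpha> A \<alpha>"
proof (rule realizesI[OF _ _ _ _ _ emb.simps(1)])
  fix \<Psi> s
  assume *: "finite \<Psi>" "\<Phi> \<subseteq> \<Psi>" "typed s MState" "proves \<Psi> (emb_sform [] \<alpha> s)"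
  have "proves \<Psi> (sr [] (FV x (emb_ty (tau A))) A)"
    using assms * by (auto intro!: M_assm wf_sr typed_FV)
  then show "yields \<Psi> [] (inst_mterm 0 s (Pair (FV x (emb_ty (the (\<Delta> x)))) (BV 0))) A \<alpha>"
    using assms * by (auto intro!: yields_Pair typed_FV)
qed (use assms in \<open>auto intro: st_typing.intros\<close>)

lemma realizes_top:
  assumes "finite \<Phi>" "wf_sform \<Sigma> 0 \<alpha>"
  shows "realizes \<Delta> \<Phi> Skip \<alpha> MTop \<alpha>"
proof (rule realizesI[OF _ _ _ _ _ emb.simps(2)])
  fix \<Psi> s
  assume "typed s MState" "proves \<Psi> (emb_sform [] \<alpha> s)"
  then show "yields \<Psi> [] (inst_mterm 0 s (Pair Unt (BV 0))) MTop \<alpha>"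
    using assms by (auto intro!: yields_Pair M_topI intro: mtyping.intros)
qed (use assms in \<open>auto intro: st_typing.intros\<close>)

text \<open>\<open>Comp\<close> runs \<open>u\<close> in the final state of \<open>t\<close>, where
  \<open>\<beta>\<close> holds.\<close>

lemma realizes_andI:
  assumes t: "realizes \<Delta> \<Phi> t \<alpha> A \<beta>" and u: "realizes \<Delta> \<Phi> u \<beta> B \<gamma>"
  shows "realizes \<Delta> \<Phi> (Comp t u) \<alpha> (MAnd A B) \<gamma>"
proof (rule realizesI[OF _ _ _ _ _ emb.simps(6)])
  note t' = realizesD[OF t] and u' = realizesD[OF u]
  fix \<Psi> s
  assume *: "finite \<Psi>" "\<Phi> \<subseteq> \<Psi>" "typed s MState" "proves \<Psi> (emb_sform [] \<alpha> s)"
  let ?U = "App (emb \<Sigma> E \<Delta> t) s" let ?V = "App (emb \<Sigma> E \<Delta> u) (P1 ?U)"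
  have U: "typed ?U (MProd (emb_ty (tau A)) MState)"
    by (rule realizes_typed_run[OF t *(3)])
  have V: "typed ?V (MProd (emb_ty (tau B)) MState)"
    by (rule realizes_typed_run[OF u typed_P1[OF U]])
  note yU = yieldsD[OF realizes_run[OF t *(2,4,3)]]
  note yV = yieldsD[OF realizes_run[OF u *(2) yU(2) typed_P1[OF U]]]
  have p: "typed (Pair (P0 ?U) (P0 ?V)) (MProd (emb_ty (tau A)) (emb_ty (tau B)))"
    by (rule typed_Pair[OF typed_P0[OF U] typed_P0[OF V]])
  note e = eq_PairD[OF M_refl[OF p] p typed_P0[OF U] typed_P0[OF V]]
  have "proves \<Psi> (sr [] (P0 (Pair (P0 ?U) (P0 ?V))) A)"
    by (rule sr_eq[OF eq_sym[OF e(1) typed_P0[OF p]] yU(1)])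
      (use t' typed_P0[OF U] typed_P0[OF p] in auto)
  moreover have "proves \<Psi> (sr [] (P1 (Pair (P0 ?U) (P0 ?V))) B)"
    by (rule sr_eq[OF eq_sym[OF e(2) typed_P1[OF p]] yV(1)])
      (use u' typed_P0[OF V] typed_P1[OF p] in auto)
  ultimately have "proves \<Psi> (sr [] (Pair (P0 ?U) (P0 ?V)) (MAnd A B))"
    by (auto intro: M_andI)
  from yields_Pair[OF this yV(2) _ typed_P1[OF V]]
  have "yields \<Psi> [] (Pair (Pair (P0 ?U) (P0 ?V)) (P1 ?V)) (MAnd A B) \<gamma>"
    using t' u' p by simp
  then show "yields \<Psi> [] (inst_mterm 0 s
      (let u' = App (emb \<Sigma> E \<Delta> t) (BV 0); a = P0 u'; \<pi>1 = P1 u';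
          v = App (emb \<Sigma> E \<Delta> u) \<pi>1; b = P0 v; \<pi>2 = P1 v
      in Pair (Pair a b) \<pi>2)) (MAnd A B) \<gamma>"
    using typed_emb[OF t'(5)] typed_emb[OF u'(5)] by (simp add: Let_def)
qed (use realizesD[OF t] realizesD[OF u] in \<open>auto intro: st_typing.intros\<close>)

lemma realizes_andE1:
  assumes t: "realizes \<Delta> \<Phi> t \<alpha> (MAnd A B) \<beta>"
  shows "realizes \<Delta> \<Phi> (Prj0 t) \<alpha> A \<beta>"
proof (rule realizesI[OF _ _ _ _ _ emb.simps(7)])
  note t' = realizesD[OF t]
  fix \<Psi> s
  assume *: "finite \<Psi>" "\<Phi> \<subseteq> \<Psi>" "typed s MState" "proves \<Psi> (emb_sform [] \<alpha> s)"
  let ?U = "App (emb \<Sigma> E \<Delta> t) s"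
  have U: "typed ?U (MProd (MProd (emb_ty (tau A)) (emb_ty (tau B))) MState)"
    using realizes_typed_run[OF t *(3)] by simp
  note yU = yieldsD[OF realizes_run[OF t *(2,4,3)]]
  have "yields \<Psi> [] (Pair (P0 (P0 ?U)) (P1 ?U)) A \<beta>"
    by (rule yields_Pair[OF _ yU(2) typed_P0[OF typed_P0[OF U]] typed_P1[OF U]])
      (use t' yU(1) in \<open>auto intro: M_andE1\<close>)
  then show "yields \<Psi> [] (inst_mterm 0 s
      (let u = App (emb \<Sigma> E \<Delta> t) (BV 0) in Pair (P0 (P0 u)) (P1 u))) A \<beta>"
    using typed_emb[OF t'(5)] by (simp add: Let_def)
qed (use realizesD[OF t] in \<open>auto intro: st_typing.intros\<close>)

lemma realizes_andE2:
  assumes t: "realizes \<Delta> \<Phi> t \<alpha> (MAnd A B) \<beta>"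
  shows "realizes \<Delta> \<Phi> (Prj1 t) \<alpha> B \<beta>"
proof (rule realizesI[OF _ _ _ _ _ emb.simps(8)])
  note t' = realizesD[OF t]
  fix \<Psi> s
  assume *: "finite \<Psi>" "\<Phi> \<subseteq> \<Psi>" "typed s MState" "proves \<Psi> (emb_sform [] \<alpha> s)"
  let ?U = "App (emb \<Sigma> E \<Delta> t) s"
  have U: "typed ?U (MProd (MProd (emb_ty (tau A)) (emb_ty (tau B))) MState)"
    using realizes_typed_run[OF t *(3)] by simp
  note yU = yieldsD[OF realizes_run[OF t *(2,4,3)]]
  have "yields \<Psi> [] (Pair (P1 (P0 ?U)) (P1 ?U)) B \<beta>"
    by (rule yields_Pair[OF _ yU(2) typed_P1[OF typed_P0[OF U]] typed_P1[OF U]])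
      (use t' yU(1) in \<open>auto intro: M_andE2\<close>)
  then show "yields \<Psi> [] (inst_mterm 0 s
      (let u = App (emb \<Sigma> E \<Delta> t) (BV 0) in Pair (P1 (P0 u)) (P1 u))) B \<beta>"
    using typed_emb[OF t'(5)] by (simp add: Let_def)
qed (use realizesD[OF t] in \<open>auto intro: st_typing.intros\<close>)

lemma typed_zero: "typed (zero \<Sigma> X) (emb_ty X)"
  by (rule mtyping_zero[OF wf_sig])

lemma realizes_orI1:
  assumes t: "realizes \<Delta> \<Phi> t \<alpha> A \<beta>" and B: "wf_mform \<Sigma> 0 B"
  shows "realizes \<Delta> \<Phi> (Inj0 (tau B) t) \<alpha> (MOr A B) \<beta>"
proof (rule realizesI[OF _ _ _ _ _ emb.simps(9)])
  note t' = realizesD[OF t]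
  fix \<Psi> s
  assume *: "finite \<Psi>" "\<Phi> \<subseteq> \<Psi>" "typed s MState" "proves \<Psi> (emb_sform [] \<alpha> s)"
  let ?U = "App (emb \<Sigma> E \<Delta> t) s"
  have U: "typed ?U (MProd (emb_ty (tau A)) MState)"
    by (rule realizes_typed_run[OF t *(3)])
  note yU = yieldsD[OF realizes_run[OF t *(2,4,3)]]
  have "proves \<Psi> (sr [] (Pair FF (Pair (P0 ?U) (zero \<Sigma> (tau B)))) (MOr A B))"
    by (rule proves_sr_Inj0[OF yU(1) typed_P0[OF U] typed_zero]) (use t' B in auto)
  from yields_Pair[OF this yU(2) _ typed_P1[OF U]]
  have "yields \<Psi> [] (Pair (Pair FF (Pair (P0 ?U) (zero \<Sigma> (tau B)))) (P1 ?U)) (MOr A B) \<beta>"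
    using t' B typed_P0[OF U] typed_zero by (auto intro!: typed_Pair intro: mtyping_FF)
  then show "yields \<Psi> [] (inst_mterm 0 s
      (let u = App (emb \<Sigma> E \<Delta> t) (BV 0); a = P0 u; \<pi>1 = P1 u
      in Pair (Pair FF (Pair a (zero \<Sigma> (tau B)))) \<pi>1)) (MOr A B) \<beta>"
    using typed_emb[OF t'(5)] typed_zero[of "tau B"] by (simp add: Let_def)
qed (use realizesD[OF t] B in \<open>auto intro: st_typing.intros\<close>)

lemma realizes_orI2:
  assumes t: "realizes \<Delta> \<Phi> t \<alpha> B \<beta>" and A: "wf_mform \<Sigma> 0 A"
  shows "realizes \<Delta> \<Phi> (Inj1 (tau A) t) \<alpha> (MOr A B) \<beta>"
proof (rule realizesI[OF _ _ _ _ _ emb.simps(10)])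
  note t' = realizesD[OF t]
  fix \<Psi> s
  assume *: "finite \<Psi>" "\<Phi> \<subseteq> \<Psi>" "typed s MState" "proves \<Psi> (emb_sform [] \<alpha> s)"
  let ?U = "App (emb \<Sigma> E \<Delta> t) s"
  have U: "typed ?U (MProd (emb_ty (tau B)) MState)"
    by (rule realizes_typed_run[OF t *(3)])
  note yU = yieldsD[OF realizes_run[OF t *(2,4,3)]]
  have "proves \<Psi> (sr [] (Pair TT (Pair (zero \<Sigma> (tau A)) (P0 ?U))) (MOr A B))"
    by (rule proves_sr_Inj1[OF yU(1) typed_zero typed_P0[OF U]]) (use t' A in auto)
  from yields_Pair[OF this yU(2) _ typed_P1[OF U]]
  have "yields \<Psi> [] (Pair (Pair TT (Pair (zero \<Sigma> (tau A)) (P0 ?U))) (P1 ?U)) (MOr A B) \<beta>"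
    using t' A typed_P0[OF U] typed_zero by (auto intro!: typed_Pair intro: mtyping_TT)
  then show "yields \<Psi> [] (inst_mterm 0 s
      (let u = App (emb \<Sigma> E \<Delta> t) (BV 0); a = P0 u; \<pi>1 = P1 u
      in Pair (Pair TT (Pair (zero \<Sigma> (tau A)) a)) \<pi>1)) (MOr A B) \<beta>"
    using typed_emb[OF t'(5)] typed_zero[of "tau A"] by (simp add: Let_def)
qed (use realizesD[OF t] A in \<open>auto intro: st_typing.intros\<close>)

text \<open>\<open>CaseOf\<close> evaluates both branches to functions, each from the final state of
  \<open>r\<close>, and calls only the selected one, in the state that its evaluation has left. The
  implications are therefore realized from \<open>\<beta>\<close> to \<open>\<beta>\<close>, so that
  the precondition of the call is still true.\<close>

lemma realizes_orE:
  assumes r: "realizes \<Delta> \<Phi> r \<alpha> (MOr A B) \<beta>"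
    and t: "realizes \<Delta> \<Phi> t \<beta> (MImp A \<beta> C \<gamma>) \<beta>" and u: "realizes \<Delta> \<Phi> u \<beta> (MImp B \<beta> C \<gamma>) \<beta>"
  shows "realizes \<Delta> \<Phi> (CaseOf (tau C) r t u) \<alpha> C \<gamma>"
proof (rule realizesI[OF _ _ _ _ _ emb.simps(11)])
  note r' = realizesD[OF r] and t' = realizesD[OF t] and u' = realizesD[OF u]
  let ?Z = "MProd (emb_ty (tau C)) MState"
  fix \<Psi> s
  assume *: "finite \<Psi>" "\<Phi> \<subseteq> \<Psi>" "typed s MState" "proves \<Psi> (emb_sform [] \<alpha> s)"
  let ?R = "App (emb \<Sigma> E \<Delta> r) s"
  let ?T = "App (emb \<Sigma> E \<Delta> t) (P1 ?R)" let ?U = "App (emb \<Sigma> E \<Delta> u) (P1 ?R)"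
  let ?d = "P0 (P0 ?R)" let ?a = "P0 (P1 (P0 ?R))" let ?b = "P1 (P1 (P0 ?R))"
  let ?l = "App (App (P0 ?T) ?a) (P1 ?T)" let ?m = "App (App (P0 ?U) ?b) (P1 ?U)"
  let ?W = "\<lambda>d. App (App (App (Case ?Z) d) ?l) ?m"
  have R: "typed ?R (MProd (MProd MBool (MProd (emb_ty (tau A)) (emb_ty (tau B)))) MState)"
    using realizes_typed_run[OF r *(3)] by simp
  note R1 = typed_P1[OF R]
  note d = typed_P0[OF typed_P0[OF R]]
  note a = typed_P0[OF typed_P1[OF typed_P0[OF R]]]
  note b = typed_P1[OF typed_P1[OF typed_P0[OF R]]]
  have T: "typed ?T (MProd (MFun (emb_ty (tau A)) (MFun MState ?Z)) MState)"
    using realizes_typed_run[OF t R1] by simp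
  have U: "typed ?U (MProd (MFun (emb_ty (tau B)) (MFun MState ?Z)) MState)"
    using realizes_typed_run[OF u R1] by simp
  note l = typed_App[OF typed_App[OF typed_P0[OF T] a] typed_P1[OF T]]
  note m = typed_App[OF typed_App[OF typed_P0[OF U] b] typed_P1[OF U]]
  note case_ty = mtyping_Case[of \<Sigma> E "[]" ?Z]
  note W = typed_App[OF typed_App[OF typed_App[OF case_ty] l] m]
  have TT: "typed TT MBool" and FF: "typed FF MBool" by (auto intro: mtyping.intros)
  note yR = yieldsD[OF realizes_run[OF r *(2,4,3)]]
  note yT = yieldsD[OF realizes_run[OF t *(2) yR(2) R1]]
  note yU = yieldsD[OF realizes_run[OF u *(2) yR(2) R1]]
  have branch: "proves \<Psi>' (Eq ?Z (?W ?d) (?W v))" if "proves \<Psi>' (Eq MBool ?d v)" "typed v MBool" for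
    v \<Psi>'
    by (rule eq_App[OF eq_App[OF eq_App[OF M_refl[OF case_ty] that(1)] M_refl[OF l]] M_refl[OF m]])
      (use case_ty d l m that(2) in \<open>blast intro: typed_App\<close>)+
  have "yields \<Psi> [] (?W ?d) C \<gamma>"
  proof (rule yields_orE[OF M_bool[OF d]])
    let ?\<Psi> = "insert (Eq MBool ?d FF) \<Psi>"
    have eq: "proves ?\<Psi> (Eq MBool ?d FF)"
      using d FF by (auto intro: M_assm)
    have "proves \<Psi> (Imp (Eq MBool ?d FF) (sr [] ?a A))"
      using yR(1) by (auto intro: M_andE1)
    from M_impE[OF M_weaken[OF this] eq] have A: "proves ?\<Psi> (sr [] ?a A)"
      by blast
    have "proves ?\<Psi> (hsr [] (App (P0 ?T) ?a) \<beta> C \<gamma>)"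
      by (rule sr_MImpD[OF M_weaken[OF yT(1)] A]) (use t' typed_P0[OF T] a in auto)
    then have "yields ?\<Psi> [] ?l C \<gamma>"
      by (rule hsrD[OF _ subset_refl M_weaken[OF yT(2)] typed_P1[OF T]
        typed_App[OF typed_P0[OF T] a]])
        (use t' in auto)
    then show "yields ?\<Psi> [] (?W ?d) C \<gamma>"
      by (rule yields_eq[OF eq_trans[OF branch[OF eq FF] M_case_FF[OF l m] W[OF d]] _ W[OF d] l])
        (use t' in auto)
  next
    let ?\<Psi> = "insert (Eq MBool ?d TT) \<Psi>"
    have eq: "proves ?\<Psi> (Eq MBool ?d TT)"
      using d TT by (auto intro: M_assm)
    have "proves \<Psi> (Imp (Eq MBool ?d TT) (sr [] ?b B))"
      using yR(1) by (auto intro: M_andE2)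
    from M_impE[OF M_weaken[OF this] eq] have B: "proves ?\<Psi> (sr [] ?b B)"
      by blast
    have "proves ?\<Psi> (hsr [] (App (P0 ?U) ?b) \<beta> C \<gamma>)"
      by (rule sr_MImpD[OF M_weaken[OF yU(1)] B]) (use u' typed_P0[OF U] b in auto)
    then have "yields ?\<Psi> [] ?m C \<gamma>"
      by (rule hsrD[OF _ subset_refl M_weaken[OF yU(2)] typed_P1[OF U]
        typed_App[OF typed_P0[OF U] b]])
        (use u' in auto)
    then show "yields ?\<Psi> [] (?W ?d) C \<gamma>"
      by (rule yields_eq[OF eq_trans[OF branch[OF eq TT] M_case_TT[OF l m] W[OF d]] _ W[OF d] m])
        (use u' in auto)
  qed
  then show "yields \<Psi> [] (inst_mterm 0 s
     (let u' = App (emb \<Sigma> E \<Delta> r) (BV 0);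
          e = P0 (P0 u'); a = P0 (P1 (P0 u')); b = P1 (P1 (P0 u')); \<pi>1 = P1 u';
          v = App (emb \<Sigma> E \<Delta> t) \<pi>1; f = P0 v; \<pi>2 = P1 v;
          w = App (emb \<Sigma> E \<Delta> u) \<pi>1; g = P0 w; \<pi>3 = P1 w
      in App (App (App (Case (MProd (emb_ty (tau C)) MState)) e) (App (App f a) \<pi>2))
        (App (App g b) \<pi>3))) C \<gamma>"
    using typed_emb[OF r'(5)] typed_emb[OF t'(5)] typed_emb[OF u'(5)] by (simp add: Let_def)
qed (use realizesD[OF r] realizesD[OF t] realizesD[OF u] in \<open>auto intro: st_typing.intros\<close>)

text \<open>The evaluation order of \<open>Ap\<close> fits the rule: the function leads from
  \<open>\<alpha>\<close> to \<open>\<beta>\<close>, the argument from \<open>\<beta>\<close> to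
  \<open>\<gamma>\<close>, and the call from \<open>\<gamma>\<close> to
  \<open>\<delta>\<close>.\<close>

lemma realizes_impE:
  assumes t: "realizes \<Delta> \<Phi> t \<alpha> (MImp A \<gamma> B \<delta>) \<beta>" and u: "realizes \<Delta> \<Phi> u \<beta> A \<gamma>"
  shows "realizes \<Delta> \<Phi> (Ap t u) \<alpha> B \<delta>"
proof (rule realizesI[OF _ _ _ _ _ emb.simps(13)])
  note t' = realizesD[OF t] and u' = realizesD[OF u]
  fix \<Psi> s
  assume *: "finite \<Psi>" "\<Phi> \<subseteq> \<Psi>" "typed s MState" "proves \<Psi> (emb_sform [] \<alpha> s)"
  let ?U = "App (emb \<Sigma> E \<Delta> t) s" let ?V = "App (emb \<Sigma> E \<Delta> u) (P1 ?U)"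
  have U: "typed ?U
    (MProd (MFun (emb_ty (tau A)) (MFun MState (MProd (emb_ty (tau B)) MState))) MState)"
    using realizes_typed_run[OF t *(3)] by simp
  have V: "typed ?V (MProd (emb_ty (tau A)) MState)"
    by (rule realizes_typed_run[OF u typed_P1[OF U]])
  note yU = yieldsD[OF realizes_run[OF t *(2,4,3)]]
  note yV = yieldsD[OF realizes_run[OF u *(2) yU(2) typed_P1[OF U]]]
  have "proves \<Psi> (hsr [] (App (P0 ?U) (P0 ?V)) \<gamma> B \<delta>)"
    by (rule sr_MImpD[OF yU(1) yV(1)]) (use t' typed_P0[OF U] typed_P0[OF V] in auto)
  then have "yields \<Psi> [] (App (App (P0 ?U) (P0 ?V)) (P1 ?V)) B \<delta>"
    by (rule hsrD[OF _ subset_refl yV(2) typed_P1[OF V] typed_App[OF typed_P0[OF U] typed_P0[OF V]]])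
      (use t' in auto)
  then show "yields \<Psi> [] (inst_mterm 0 s
     (let u' = App (emb \<Sigma> E \<Delta> t) (BV 0); f = P0 u'; \<pi>1 = P1 u';
          v = App (emb \<Sigma> E \<Delta> u) \<pi>1; a = P0 v; \<pi>2 = P1 v
      in App (App f a) \<pi>2)) B \<delta>"
    using typed_emb[OF t'(5)] typed_emb[OF u'(5)] by (simp add: Let_def)
qed (use realizesD[OF t] realizesD[OF u] in \<open>auto intro: st_typing.intros\<close>)

text \<open>The run of \<open>t\<close> shows that the assumptions together with the precondition
  are contradictory, so a default value with an unchanged state realizes anything of its
  type.\<close>

lemma realizes_botE:
  assumes t: "realizes \<Delta> \<Phi> t \<alpha> MBot \<beta>" and wf: "wf_mform \<Sigma> 0 A" "wf_sform \<Sigma> 0 \<gamma>"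
  shows "realizes \<Delta> \<Phi> (Default (tau A)) \<alpha> A \<gamma>"
proof (rule realizesI[OF _ _ _ _ _ emb.simps(3)])
  fix \<Psi> s
  assume *: "finite \<Psi>" "\<Phi> \<subseteq> \<Psi>" "typed s MState" "proves \<Psi> (emb_sform [] \<alpha> s)"
  have "proves \<Psi> Bot"
    using yieldsD(1)[OF realizes_run[OF t *(2,4,3)]] by simp
  then show "yields \<Psi> [] (inst_mterm 0 s (Pair (zero \<Sigma> (tau A)) (BV 0))) A \<gamma>"
    using wf typed_Pair[OF typed_zero *(3)] typed_zero[of "tau A"] by (auto intro!: yields_botE)
qed (use realizesD[OF t] wf in \<open>auto intro: st_typing.intros\<close>)

text \<open>Applied to its own variable, the abstraction runs like \<open>t\<close>. The assumption
  about \<open>x\<close> is discharged and \<open>x\<close> is generalized, which is where freshness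
  enters.\<close>

lemma realizes_impI:
  assumes t: "realizes (\<Delta>(x \<mapsto> tau A)) (insert (sr [] (FV x (emb_ty (tau A))) A) \<Phi>) t \<alpha> B \<beta>"
    and wf: "wf_mform \<Sigma> 0 A" "wf_sform \<Sigma> 0 \<gamma>"
    and fresh: "x \<notin> fv_mform A \<union> fv_sform \<alpha> \<union> fv_mform B \<union> fv_sform \<beta>"
      "(x, emb_ty (tau A)) \<notin> (\<Union>\<phi>\<in>\<Phi>. fv_fm \<phi>)"
  shows "realizes \<Delta> \<Phi> (Abs x (tau A) t) \<gamma> (MImp A \<alpha> B \<beta>) \<gamma>"
proof (rule realizesI[OF _ _ _ _ _ emb.simps(12)])
  note t' = realizesD[OF t]
  let ?X = "emb_ty (tau A)" let ?w = "emb \<Sigma> E (\<Delta>(x \<mapsto> tau A)) t"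
  let ?f = "lam x ?X ?w" let ?x = "FV x ?X :: ('f, 'p, 'g) mterm"
  have w: "typed ?w (MFun MState (MProd (emb_ty (tau B)) MState))"
    by (rule typed_emb[OF t'(5)])
  have f: "typed ?f (MFun ?X (MFun MState (MProd (emb_ty (tau B)) MState)))"
    by (rule mtyping_lam[OF w])
  let ?\<phi> = "Imp (sr [] (BV 0) A) (hsr [] (App ?f (BV 0)) \<alpha> B \<beta>)"
  let ?\<Phi> = "insert (sr [] ?x A) \<Phi>"
  have "proves ?\<Phi> (hsr [] (App ?f ?x) \<alpha> B \<beta>)"
  proof (rule hsrI)
    fix \<Psi> s
    assume *: "finite \<Psi>" "?\<Phi> \<subseteq> \<Psi>" "typed s MState" "proves \<Psi> (emb_sform [] \<alpha> s)"
    note fx = typed_App[OF f typed_FV]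
    show "yields \<Psi> [] (App (App ?f ?x) s) B \<beta>"
      by (rule yields_eq[OF eq_App[OF beta_lam[OF w] M_refl[OF *(3)] fx w *(3)]
            realizes_run[OF t *(2,4,3)] typed_App[OF fx *(3)] typed_App[OF w *(3)]])
        (use t' in auto)
  qed (use t' typed_App[OF f typed_FV] in auto)
  moreover have "wf_fm \<Sigma> E [] (sr [] ?x A)"
    using wf by (auto intro!: wf_sr typed_FV)
  ultimately have "proves \<Phi> (Imp (sr [] ?x A) (hsr [] (App ?f ?x) \<alpha> B \<beta>))"
    by (rule M_impI)
  then have "proves \<Phi> (inst_fm 0 ?x ?\<phi>)"
    using sr_inst[OF typed_FV[of x ?X], of "[]" A 0 "BV 0"] f wf t'
      hsr_inst[OF typed_FV[of x ?X], of "[]" \<alpha> B \<beta> 0 "App ?f (BV 0)"]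
    by (simp del: hsr.simps)
  moreover have "(x, ?X) \<notin> fv_fm ?\<phi>"
  proof -
    have "(x, ?X) \<notin> fv_mterm ?f"
      by (simp add: lam_def fv_bind)
    then show ?thesis
      using fv_sr[of \<Sigma> "[]" A "BV 0"] fv_hsr[of \<Sigma> "[]" \<alpha> B \<beta> "App ?f (BV 0)"] wf t' fresh(1)
      by (auto simp del: hsr.simps)
  qed
  ultimately have "proves \<Phi> (All ?X ?\<phi>)"
    using fresh(2) by (intro M_allI) auto
  then have sr: "proves \<Phi> (sr [] ?f (MImp A \<alpha> B \<beta>))"
    using f by (simp add: Let_def del: hsr.simps)
  fix \<Psi> s
  assume *: "finite \<Psi>" "\<Phi> \<subseteq> \<Psi>" "typed s MState" "proves \<Psi> (emb_sform [] \<gamma> s)"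
  \<comment> \<open>An abstraction is a value: its evaluation keeps the state, hence the same
    arbitrary \<open>\<gamma>\<close> before and after.\<close>
  have "yields \<Psi> [] (Pair ?f s) (MImp A \<alpha> B \<beta>) \<gamma>"
    by (rule yields_Pair[OF M_weaken[OF sr *(2)] *(4) _ *(3)]) (use f t' wf in auto)
  then show "yields \<Psi> [] (inst_mterm 0 s (Pair ?f (BV 0))) (MImp A \<alpha> B \<beta>) \<gamma>"
    using f by simp
qed (use realizesD[OF t] wf in \<open>auto intro: st_typing.intros\<close>)

lemma realizes_allI:
  assumes t: "realizes (\<Delta>(y \<mapsto> TD)) \<Phi> t
      (inst_sform 0 (Free y) \<alpha>) (inst_mform 0 (Free y) A) (inst_sform 0 (Free y) \<beta>)"
    and \<gamma>: "wf_sform \<Sigma> 0 \<gamma>"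
    and fresh: "y \<notin> fv_mform A \<union> fv_sform \<alpha> \<union> fv_sform \<beta>" "(y, MD) \<notin> (\<Union>\<phi>\<in>\<Phi>. fv_fm \<phi>)"
  shows "realizes \<Delta> \<Phi> (Abs y TD t) \<gamma> (MAll \<alpha> A \<beta>) \<gamma>"
proof (rule realizesI[OF _ _ _ _ _ emb.simps(12)])
  note t' = realizesD[OF t]
  have wf: "wf_sform \<Sigma> (Suc 0) \<alpha>" "wf_mform \<Sigma> (Suc 0) A" "wf_sform \<Sigma> (Suc 0) \<beta>"
    using t' by (auto simp: wf_inst_sform wf_inst_mform)
  let ?w = "emb \<Sigma> E (\<Delta>(y \<mapsto> TD)) t"
  let ?f = "lam y MD ?w" let ?y = "FV y MD :: ('f, 'p, 'g) mterm"
  have w: "typed ?w (MFun MState (MProd (emb_ty (tau A)) MState))"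
    using typed_emb[OF t'(5)] by simp
  have f: "typed ?f (MFun MD (MFun MState (MProd (emb_ty (tau A)) MState)))"
    by (rule mtyping_lam[OF w])
  let ?\<phi> = "hsr [BV 0] (App ?f (BV 0)) \<alpha> A \<beta>"
  have "proves \<Phi>
    (hsr [] ?w (inst_sform 0 (Free y) \<alpha>) (inst_mform 0 (Free y) A) (inst_sform 0 (Free y) \<beta>))"
    by (rule t'(6))
  \<comment> \<open>The eigenvariable moves from the substitution into the environment, where it can
    be generalized to an index.\<close>
  then have w_hsr: "proves \<Phi> (hsr [?y] ?w \<alpha> A \<beta>)"
    using hsr_inst_mform[of \<Sigma> "Free y" \<alpha> A \<beta> ?w] wf by (simp del: hsr.simps)
  have "proves \<Phi> (hsr [?y] (App ?f ?y) \<alpha> A \<beta>)"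
  proof (rule hsrI)
    fix \<Psi> s
    assume *: "finite \<Psi>" "\<Phi> \<subseteq> \<Psi>" "typed s MState" "proves \<Psi> (emb_sform [?y] \<alpha> s)"
    note fy = typed_App[OF f typed_FV]
    have "yields \<Psi> [?y] (App ?w s) A \<beta>"
      by (rule hsrD[OF w_hsr *(2,4,3) w]) (use wf typed_FV in auto)
    then show "yields \<Psi> [?y] (App (App ?f ?y) s) A \<beta>"
      by (rule yields_eq[OF eq_App[OF beta_lam[OF w] M_refl[OF *(3)] fy w *(3)]
            _ typed_App[OF fy *(3)] typed_App[OF w *(3)]])
        (use wf typed_FV in auto)
  qed (use t' wf typed_FV typed_App[OF f typed_FV] in auto)
  then have "proves \<Phi> (inst_fm 0 ?y ?\<phi>)"
    using f wf hsr_inst[OF typed_FV[of y MD], of "[BV 0]" \<alpha> A \<beta> 0 "App ?f (BV 0)"]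
    by (simp del: hsr.simps)
  moreover have "(y, MD) \<notin> fv_fm ?\<phi>"
  proof -
    have "(y, MD) \<notin> fv_mterm ?f"
      by (simp add: lam_def fv_bind)
    then show ?thesis
      using fv_hsr[of \<Sigma> "[BV 0]" \<alpha> A \<beta> "App ?f (BV 0)"] wf fresh(1)
      by (auto simp del: hsr.simps)
  qed
  ultimately have "proves \<Phi> (All MD ?\<phi>)"
    using fresh(2) by (intro M_allI) auto
  then have sr: "proves \<Phi> (sr [] ?f (MAll \<alpha> A \<beta>))"
    using f by (simp add: Let_def del: hsr.simps)
  fix \<Psi> s
  assume *: "finite \<Psi>" "\<Phi> \<subseteq> \<Psi>" "typed s MState" "proves \<Psi> (emb_sform [] \<gamma> s)"
  have "yields \<Psi> [] (Pair ?f s) (MAll \<alpha> A \<beta>) \<gamma>"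
    by (rule yields_Pair[OF M_weaken[OF sr *(2)] *(4) _ *(3)]) (use f wf \<gamma> in auto)
  then show "yields \<Psi> [] (inst_mterm 0 s (Pair (lam y (emb_ty TD) ?w) (BV 0))) (MAll \<alpha> A \<beta>) \<gamma>"
    using f by simp
qed (use realizesD[OF t] \<gamma> in \<open>auto intro: st_typing.intros simp: wf_inst_sform wf_inst_mform\<close>)

text \<open>After \<open>q\<close> has run, the instance of \<open>\<beta>\<close> at
  \<open>t\<close> holds. Evaluating \<open>t\<close> does not touch the state, so this instance is
  still true when the function is called.\<close>

lemma realizes_allE:
  assumes q: "realizes \<Delta> \<Phi> q \<alpha> (MAll \<beta> A \<gamma>) (inst_sform 0 t \<beta>)"
    and t: "wf_term \<Sigma> 0 t" "\<forall>x\<in>fv_term t. \<Delta> x = Some TD"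
  shows "realizes \<Delta> \<Phi> (Ap q (st_of_fo t)) \<alpha> (inst_mform 0 t A) (inst_sform 0 t \<gamma>)"
proof (rule realizesI[OF _ _ _ _ _ emb.simps(13)])
  note q' = realizesD[OF q]
  have wf: "wf_sform \<Sigma> (Suc 0) \<beta>" "wf_mform \<Sigma> (Suc 0) A" "wf_sform \<Sigma> (Suc 0) \<gamma>"
    using q' by auto
  note tt = st_typing_st_of_fo[OF t, of E]
  let ?t = "emb_term [] t :: ('f, 'p, 'g) mterm"
  have t': "typed ?t MD" by (rule mtyping_emb_term_closed[OF t(1)])
  fix \<Psi> s
  assume *: "finite \<Psi>" "\<Phi> \<subseteq> \<Psi>" "typed s MState" "proves \<Psi> (emb_sform [] \<alpha> s)"
  let ?U = "App (emb \<Sigma> E \<Delta> q) s" let ?V = "App (emb \<Sigma> E \<Delta> (st_of_fo t)) (P1 ?U)"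
  have U: "typed ?U (MProd (MFun MD (MFun MState (MProd (emb_ty (tau A)) MState))) MState)"
    using realizes_typed_run[OF q *(3)] by simp
  have V: "typed ?V (MProd MD MState)"
    using typed_run[OF tt typed_P1[OF U]] by simp
  note yU = yieldsD[OF realizes_run[OF q *(2,4,3)]]
  have "proves \<Psi> (hsr [?t] (App (P0 ?U) ?t) \<beta> A \<gamma>)"
    using sr_MAllD[OF yU(1) _ t'] q' typed_P0[OF U] by (simp del: hsr.simps)
  moreover have "proves \<Psi> (emb_sform [?t] \<beta> (P1 ?U))"
    using yU(2) wf by (simp add: emb_sform_inst_sform[OF t(1), of "[]", simplified])
  ultimately have "yields \<Psi> [?t] (App (App (P0 ?U) ?t) (P1 ?U)) A \<gamma>"
    by (rule hsrD[OF _ subset_refl _ typed_P1[OF U] typed_App[OF typed_P0[OF U] t']])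
      (use wf t' in auto)
  then have "yields \<Psi> [] (App (App (P0 ?U) ?t) (P1 ?U)) (inst_mform 0 t A) (inst_sform 0 t \<gamma>)"
    using wf
    by (simp add: yields_def emb_sform_inst_sform[OF t(1), of "[]", simplified]
        sr_inst_mform[OF t(1), of "[]", simplified])
  then have "yields \<Psi> [] (App (App (P0 ?U) (P0 ?V)) (P1 ?V)) (inst_mform 0 t A) (inst_sform 0 t \<gamma>)"
    \<comment> \<open>\<open>eq_App_App\<close> replaces the outcome of \<open>st_of_fo t\<close> by
      the value of \<open>t\<close> and the unchanged state. Folding \<open>tau_inst\<close> gives
      the equation the type that belongs to the instance of \<open>A\<close>.\<close>
    by (rule yields_eq[rotated, OF _ _ _ _ _ _
      eq_App_App[OF run_st_of_fo[OF t typed_P1[OF U]] V t' typed_P1[OF U]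
            typed_P0[OF U], folded tau_inst[of 0 t A]]])
      (use typed_App[OF typed_App[OF typed_P0[OF U] t'] typed_P1[OF U]]
          typed_App[OF typed_App[OF typed_P0[OF U] typed_P0[OF V]] typed_P1[OF V]] wf t in
        \<open>auto simp: wf_inst_mform wf_inst_sform\<close>)
  then show "yields \<Psi> [] (inst_mterm 0 s
     (let u = App (emb \<Sigma> E \<Delta> q) (BV 0); f = P0 u; \<pi>1 = P1 u;
          v = App (emb \<Sigma> E \<Delta> (st_of_fo t)) \<pi>1; a = P0 v; \<pi>2 = P1 v
      in App (App f a) \<pi>2)) (inst_mform 0 t A) (inst_sform 0 t \<gamma>)"
    using typed_emb[OF q'(5)] typed_emb[OF tt] by (simp add: Let_def)
qed (use realizesD[OF q] t st_typing_st_of_fo[OF t, of E] in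
    \<open>auto intro: st_typing.intros simp: wf_inst_mform wf_inst_sform\<close>)

lemma proves_sr_Pair:
  assumes "proves \<Phi> (sr (a # e) b A)" "typed a MD" "typed b (emb_ty (tau A))"
    and "wf_mform \<Sigma> (Suc (length e)) A" "closed_env e"
  shows "proves \<Phi> (sr e (Pair a b) (MEx A))"
proof -
  let ?v = "Pair a b"
  have v: "typed ?v (MProd MD (emb_ty (tau A)))"
    using assms by (blast intro: typed_Pair)
  note eq = eq_PairD[OF M_refl[OF v] v assms(2,3)]
  note v0 = typed_P0[OF v] and v1 = typed_P1[OF v]
  have "proves \<Phi> (sr (a # e) (P1 ?v) A)"
    by (rule sr_eq[OF eq_sym[OF eq(2) v1] assms(1)]) (use assms v1 in auto)
  moreover have inst: "inst_fm 0 w (sr (BV 0 # e) (P1 ?v) A) = sr (w # e) (P1 ?v) A" if "typed w MD"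
    for w
    using sr_inst[OF that, of "BV 0 # e" A 0 "P1 ?v"] assms
    by (simp add: map_inst_closed_env)
  moreover have "wf_fm \<Sigma> E [MD] (sr (BV 0 # e) (P1 ?v) A)"
    using assms(4,5) by (intro wf_sr)
      (auto simp: mtyping_BV0 closed_env_weaken mtyping_closed_weaken[OF v1])
  \<comment> \<open>The witness sits in the environment, so the equation between
    \<open>P0 ?v\<close> and \<open>a\<close> is applied to its head, exposed as the index 0 in the
    formula given to \<open>M_subst\<close>.\<close>
  ultimately have "proves \<Phi> (sr (P0 ?v # e) (P1 ?v) A)"
    using M_subst[OF eq_sym[OF eq(1) v0], where \<phi> = "sr (BV 0 # e) (P1 ?v) A"] assms(2) v0
    by (simp del: inst_mterm.simps)
  then show ?thesis by simp
qed

text \<open>The witness is computed before \<open>r\<close>. Since this leaves the state alone,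
  \<open>r\<close> still starts in a state that satisfies \<open>\<alpha>\<close>.\<close>

lemma realizes_exI:
  assumes r: "realizes \<Delta> \<Phi> r \<alpha> (inst_mform 0 t A) \<beta>"
    and t: "wf_term \<Sigma> 0 t" "\<forall>x\<in>fv_term t. \<Delta> x = Some TD"
  shows "realizes \<Delta> \<Phi> (Comp (st_of_fo t) r) \<alpha> (MEx A) \<beta>"
proof -
  note r' = realizesD[OF r]
  have wf: "wf_mform \<Sigma> (Suc 0) A"
    using r' t by (simp add: wf_inst_mform)
  note tt = st_typing_st_of_fo[OF t, of E]
  let ?t = "emb_term [] t :: ('f, 'p, 'g) mterm"
  have t': "typed ?t MD" by (rule mtyping_emb_term_closed[OF t(1)])
  have rt: "st_typing \<Sigma> E \<Delta> r (tau A)" using r'(5) by simp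
  have ct: "st_typing \<Sigma> E \<Delta> (Comp (st_of_fo t) r) (tau (MEx A))"
    using st_typing_Comp[OF tt rt] by simp
  have "proves \<Phi> (hsr [] (emb \<Sigma> E \<Delta> (Comp (st_of_fo t) r)) \<alpha> (MEx A) \<beta>)"
  proof (rule hsrI)
    fix \<Psi> s
    assume *: "finite \<Psi>" "\<Phi> \<subseteq> \<Psi>" "typed s MState" "proves \<Psi> (emb_sform [] \<alpha> s)"
    let ?U = "App (emb \<Sigma> E \<Delta> r) s"
    have U: "typed ?U (MProd (emb_ty (tau A)) MState)"
      using realizes_typed_run[OF r *(3)] by simp
    note yU = yieldsD[OF realizes_run[OF r *(2,4,3)]]
    have "proves \<Psi> (sr [?t] (P0 ?U) A)"
      using yU(1) wf by (simp add: sr_inst_mform[OF t(1), of "[]", simplified])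
    then have "proves \<Psi> (sr [] (Pair ?t (P0 ?U)) (MEx A))"
      by (rule proves_sr_Pair[OF _ t' typed_P0[OF U]]) (use wf in auto)
    moreover have v: "typed (Pair ?t (P0 ?U)) (emb_ty (tau (MEx A)))"
      using typed_Pair[OF t' typed_P0[OF U]] by simp
    ultimately have y: "yields \<Psi> [] (Pair (Pair ?t (P0 ?U)) (P1 ?U)) (MEx A) \<beta>"
      using yU(2) typed_P1[OF U] wf r' by (intro yields_Pair) auto
    \<comment> \<open>\<open>run_Comp\<close> expects the outcome of \<open>r\<close> as an explicit
      pair; surjective pairing presents it as the pair of its projections.\<close>
    have "proves \<Psi> (Eq (MProd (emb_ty (tau (MEx A))) MState)
        (App (emb \<Sigma> E \<Delta> (Comp (st_of_fo t) r)) s) (Pair (Pair ?t (P0 ?U)) (P1 ?U)))"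
      using run_Comp[OF tt rt *(3) _ eq_sym[OF M_pair[OF U]], where a = ?t]
        run_st_of_fo[OF t *(3)] t' typed_P0[OF U] typed_P1[OF U] *(3)
          typed_Pair[OF typed_P0[OF U] typed_P1[OF U]]
      by simp
    then show "yields \<Psi> [] (App (emb \<Sigma> E \<Delta> (Comp (st_of_fo t) r)) s) (MEx A) \<beta>"
      by (rule yields_eq[OF _ y typed_run[OF ct *(3)] typed_Pair[OF v typed_P1[OF U]]])
        (use wf r' in auto)
  qed (use r' wf ct typed_emb[OF ct] in auto)
  then show ?thesis
    using r' wf ct by (auto simp: realizes_def simp del: hsr.simps)
qed

text \<open>The variable \<open>z\<close> holds the pair of a witness and its realizer. These are not first-order
  terms, so the elimination of the quantifier in \<open>q\<close> is carried out in an environment.\<close>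

lemma realizes_ex_apply:
  assumes q: "realizes \<Delta> \<Phi> q \<beta> (MAll \<beta> (MImp A \<beta> C \<gamma>) \<beta>) \<beta>"
    and z: "\<Delta> z = Some (tau (MEx A))" "sr [] (FV z (emb_ty (tau (MEx A)))) (MEx A) \<in> \<Phi>"
    and C: "wf_mform \<Sigma> 0 C" "wf_sform \<Sigma> 0 \<gamma>"
  shows "realizes \<Delta> \<Phi> (Ap (Ap q (Prj0 (Var z))) (Prj1 (Var z))) \<beta> C \<gamma>"
proof -
  note q' = realizesD[OF q]
  have wf: "wf_sform \<Sigma> (Suc 0) \<beta>" "wf_mform \<Sigma> (Suc 0) A" "wf_mform \<Sigma> (Suc 0) C" "wf_sform \<Sigma> (Suc 0) \<gamma>"
    using q' by auto
  let ?z = "FV z (MProd MD (emb_ty (tau A))) :: ('f, 'p, 'g) mterm"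
  have Z: "typed ?z (MProd MD (emb_ty (tau A)))" by (rule typed_FV)
  note Z0 = typed_P0[OF Z] and Z1 = typed_P1[OF Z]
  have zt: "st_typing \<Sigma> E \<Delta> (Var z) (TProd TD (tau A))"
    using z by (auto intro: st_typing.intros)
  note p0 = st_typing_Prj0[OF zt] and p1 = st_typing_Prj1[OF zt]
  have run_z: "proves \<Psi>
    (Eq (MProd (MProd MD (emb_ty (tau A))) MState) (App (emb \<Sigma> E \<Delta> (Var z)) s) (Pair ?z s))"
    if "typed s MState" for \<Psi> s
    using run(1)[OF zt emb.simps(1) that] z by simp
  note vz = typed_emb[OF zt]
  have run_p0: "proves \<Psi> (Eq (MProd MD MState) (App (emb \<Sigma> E \<Delta> (Prj0 (Var z))) s) (Pair (P0 ?z) s))"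
    and run_p1: "proves \<Psi>
      (Eq (MProd (emb_ty (tau A)) MState) (App (emb \<Sigma> E \<Delta> (Prj1 (Var z))) s) (Pair (P1 ?z) s))"
    if s: "typed s MState" for \<Psi> s
  proof -
    let ?U = "App (emb \<Sigma> E \<Delta> (Var z)) s"
    have U: "typed ?U (MProd (MProd MD (emb_ty (tau A))) MState)"
      using typed_run[OF zt s] by simp
    note e = eq_PairD[OF run_z[OF s] U Z s]
    have "proves \<Psi>
      (Eq (MProd MD MState) (App (emb \<Sigma> E \<Delta> (Prj0 (Var z))) s) (Pair (P0 (P0 ?U)) (P1 ?U)))"
      using run(1)[OF p0 emb.simps(7) s] vz by (simp add: Let_def del: emb.simps(1))
    from eq_trans[OF this
      eq_Pair[OF eq_P0[OF e(1) typed_P0[OF U]] e(2) typed_P0[OF typed_P0[OF U]] Z0 typed_P1[OF U]]]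
    show "proves \<Psi> (Eq (MProd MD MState) (App (emb \<Sigma> E \<Delta> (Prj0 (Var z))) s) (Pair (P0 ?z) s))"
      using typed_run[OF p0 s] by (simp del: emb.simps)
    have "proves \<Psi>
      (Eq (MProd (emb_ty (tau A)) MState) (App (emb \<Sigma> E \<Delta> (Prj1 (Var z))) s)
        (Pair (P1 (P0 ?U)) (P1 ?U)))"
      using run(1)[OF p1 emb.simps(8) s] vz by (simp add: Let_def del: emb.simps(1))
    from eq_trans[OF this
      eq_Pair[OF eq_P1[OF e(1) typed_P0[OF U]] e(2) typed_P1[OF typed_P0[OF U]] Z1 typed_P1[OF U]]]
    show "proves \<Psi>
      (Eq (MProd (emb_ty (tau A)) MState) (App (emb \<Sigma> E \<Delta> (Prj1 (Var z))) s) (Pair (P1 ?z) s))"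
      using typed_run[OF p1 s] by (simp del: emb.simps)
  qed
  have qt: "st_typing \<Sigma> E \<Delta> q (TFun TD (TFun (tau A) (tau C)))" using q'(5) by simp
  note qp = st_typing_Ap[OF qt p0]
  note qpp = st_typing_Ap[OF qp p1]
  have "proves \<Phi> (hsr [] (emb \<Sigma> E \<Delta> (Ap (Ap q (Prj0 (Var z))) (Prj1 (Var z)))) \<beta> C \<gamma>)"
  proof (rule hsrI)
    fix \<Psi> s
    assume *: "finite \<Psi>" "\<Phi> \<subseteq> \<Psi>" "typed s MState" "proves \<Psi> (emb_sform [] \<beta> s)"
    let ?e = "[P0 ?z]" let ?I = "MImp A \<beta> C \<gamma>"
    let ?Y = "MFun (emb_ty (tau A)) (MFun MState (MProd (emb_ty (tau C)) MState))"
    let ?U = "App (emb \<Sigma> E \<Delta> q) s"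
    have U: "typed ?U (MProd (MFun MD (MFun MState (MProd ?Y MState))) MState)"
      using typed_run[OF qt *(3)] by simp
    note U1 = typed_P1[OF U]
    note yU = yieldsD[OF realizes_run[OF q *(2,4,3)]]
    let ?V = "App (emb \<Sigma> E \<Delta> (Prj0 (Var z))) (P1 ?U)"
    have V: "typed ?V (MProd MD MState)"
      using typed_run[OF p0 U1] by (simp del: emb.simps)
    have "proves \<Psi> (hsr ?e (App (P0 ?U) (P0 ?z)) \<beta> ?I \<beta>)"
      using sr_MAllD[OF yU(1) _ Z0] q' typed_P0[OF U] by (simp del: hsr.simps)
    \<comment> \<open>The postcondition of \<open>q\<close> is the closed \<open>\<beta>\<close>,
      which doubles as the precondition of the quantified triple in the environment
      \<open>?e\<close>.\<close>
    moreover have "proves \<Psi> (emb_sform ?e \<beta> (P1 ?U))"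
      using yU(2) by (simp add: emb_sform_closed[OF q'(2), of ?e])
    ultimately have y: "yields \<Psi> ?e (App (App (P0 ?U) (P0 ?z)) (P1 ?U)) ?I \<beta>"
      by (rule hsrD[OF _ subset_refl _ U1]) (use typed_App[OF typed_P0[OF U] Z0] wf Z0 in simp_all)
    let ?U2 = "App (emb \<Sigma> E \<Delta> (Ap q (Prj0 (Var z)))) s"
    have U2: "typed ?U2 (MProd ?Y MState)"
      using typed_run[OF qp *(3)] by (simp del: emb.simps)
    note W = typed_App[OF typed_App[OF typed_P0[OF U] Z0] U1]
    have "proves \<Psi> (Eq (MProd ?Y MState) ?U2 (App (App (P0 ?U) (P0 ?V)) (P1 ?V)))"
      using run_Ap[OF qt p0 *(3)] by (simp del: emb.simps)
    from eq_trans[OF this eq_App_App[OF run_p0[OF U1] V Z0 U1 typed_P0[OF U]] U2]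
    have "proves \<Psi> (Eq (MProd ?Y MState) ?U2 (App (App (P0 ?U) (P0 ?z)) (P1 ?U)))" .
    then have "yields \<Psi> ?e ?U2 ?I \<beta>"
      by (intro yields_eq[OF _ y]) (use U2 W wf Z0 in \<open>simp_all del: emb.simps\<close>)
    note yU2 = yieldsD[OF this]
    note U21 = typed_P1[OF U2]
    let ?V2 = "App (emb \<Sigma> E \<Delta> (Prj1 (Var z))) (P1 ?U2)"
    have V2: "typed ?V2 (MProd (emb_ty (tau A)) MState)"
      using typed_run[OF p1 U21] by (simp del: emb.simps)
    have "sr [] ?z (MEx A) \<in> \<Psi>" using z(2) *(2) by auto
    moreover have "wf_fm \<Sigma> E [] (sr [] ?z (MEx A))"
      using wf Z by (intro wf_sr) auto
    ultimately have "proves \<Psi> (sr [] ?z (MEx A))" by (rule M_assm)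
    then have "proves \<Psi> (sr ?e (P1 ?z) A)" by simp
    from sr_MImpD[OF yU2(1) this] have "proves \<Psi> (hsr ?e (App (P0 ?U2) (P1 ?z)) \<beta> C \<gamma>)"
      using wf Z0 Z1 typed_P0[OF U2] by (simp del: hsr.simps emb.simps)
    then have "yields \<Psi> ?e (App (App (P0 ?U2) (P1 ?z)) (P1 ?U2)) C \<gamma>"
      by (rule hsrD[OF _ subset_refl yU2(2) U21 typed_App[OF typed_P0[OF U2] Z1]]) (use wf Z0 in auto)
    \<comment> \<open>The witness leaves the environment here: \<open>C\<close> and
      \<open>\<gamma>\<close> do not depend on it.\<close>
    then have y2: "yields \<Psi> [] (App (App (P0 ?U2) (P1 ?z)) (P1 ?U2)) C \<gamma>"
      using sr_closed[OF C(1)] emb_sform_closed[OF C(2)] unfolding yields_def by metis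
    let ?U3 = "App (emb \<Sigma> E \<Delta> (Ap (Ap q (Prj0 (Var z))) (Prj1 (Var z)))) s"
    have U3: "typed ?U3 (MProd (emb_ty (tau C)) MState)"
      by (rule typed_run[OF qpp *(3)])
    have "proves \<Psi> (Eq (MProd (emb_ty (tau C)) MState) ?U3 (App (App (P0 ?U2) (P0 ?V2)) (P1 ?V2)))"
      by (rule run_Ap[OF qp p1 *(3)])
    from eq_trans[OF this eq_App_App[OF run_p1[OF U21] V2 Z1 U21 typed_P0[OF U2]] U3]
    show "yields \<Psi> [] ?U3 C \<gamma>"
      by (rule yields_eq[OF _ y2 U3 typed_App[OF typed_App[OF typed_P0[OF U2] Z1] U21]])
        (use C in auto)
  qed (use q' C typed_emb[OF qpp] in \<open>simp_all del: emb.simps\<close>)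
  then show ?thesis
    using q' C qpp by (simp add: realizes_def del: hsr.simps emb.simps)
qed

lemma realizes_cons:
  assumes t: "realizes \<Delta> \<Phi> t \<beta> A \<gamma>"
    and wf: "wf_sform \<Sigma> 0 \<alpha>" "wf_sform \<Sigma> 0 \<delta>"
    and pre: "\<And>\<Psi> s. typed s MState \<Longrightarrow> proves \<Psi> (emb_sform [] \<alpha> s) \<Longrightarrow> proves \<Psi> (emb_sform [] \<beta> s)"
    and post: "\<And>\<Psi> s. typed s MState \<Longrightarrow> proves \<Psi> (emb_sform [] \<gamma> s) \<Longrightarrow> proves \<Psi> (emb_sform [] \<delta> s)"
  shows "realizes \<Delta> \<Phi> t \<alpha> A \<delta>"
proof -
  note t' = realizesD[OF t]
  have "proves \<Phi> (hsr [] (emb \<Sigma> E \<Delta> t) \<alpha> A \<delta>)"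
  proof (rule hsrI)
    fix \<Psi> s
    assume *: "finite \<Psi>" "\<Phi> \<subseteq> \<Psi>" "typed s MState" "proves \<Psi> (emb_sform [] \<alpha> s)"
    show "yields \<Psi> [] (App (emb \<Sigma> E \<Delta> t) s) A \<delta>"
      using realizes_run[OF t *(2) pre[OF *(3,4)] *(3)]
        post[OF typed_P1[OF realizes_typed_run[OF t *(3)]]]
      by (auto simp: yields_def)
  qed (use t' wf typed_emb[OF t'(5)] in auto)
  then show ?thesis using t' wf by (simp add: realizes_def del: hsr.simps)
qed

text \<open>The program tests \<open>\<alpha>\<close> alone. In a state where
  \<open>\<alpha>\<close> fails, the provable disjunction leaves \<open>\<beta>\<close>, which is
  what the other branch needs.\<close>

lemma realizes_cond:
  assumes t: "realizes \<Delta> \<Phi> t (SAnd \<alpha> \<gamma>) A \<delta>" and u: "realizes \<Delta> \<Phi> u (SAnd \<beta> \<gamma>) A \<delta>"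
    and cases: "\<And>\<Psi> s. typed s MState \<Longrightarrow> proves \<Psi> (emb_sform [] (SOr \<alpha> \<beta>) s)"
    and fv: "\<forall>x\<in>fv_sform \<alpha>. \<Delta> x = Some TD"
  shows "realizes \<Delta> \<Phi> (Ite (tau A) \<alpha> t u) \<gamma> A \<delta>"
proof (rule realizesI[OF _ _ _ _ _ emb.simps(14)])
  note t' = realizesD[OF t] and u' = realizesD[OF u]
  let ?Z = "MProd (emb_ty (tau A)) MState"
  have wf: "wf_sform \<Sigma> 0 \<alpha>" "wf_sform \<Sigma> 0 \<beta>" using t' u' by auto
  fix \<Psi> s
  assume *: "finite \<Psi>" "\<Phi> \<subseteq> \<Psi>" "typed s MState" "proves \<Psi> (emb_sform [] \<gamma> s)"
  let ?T = "App (emb \<Sigma> E \<Delta> t) s" let ?U = "App (emb \<Sigma> E \<Delta> u) s"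
  let ?W = "chi_app \<alpha> ?Z s ?T ?U"
  have T: "typed ?T ?Z" by (rule realizes_typed_run[OF t *(3)])
  have U: "typed ?U ?Z" by (rule realizes_typed_run[OF u *(3)])
  have W: "typed ?W ?Z" by (rule mtyping_chi_app[OF wf(1) *(3) T U])
  let ?a = "emb_sform [] \<alpha> s" let ?b = "emb_sform [] \<beta> s"
  have wf_ab: "wf_fm \<Sigma> E [] ?a" "wf_fm \<Sigma> E [] ?b"
    using wf *(3) by (auto intro: wf_emb_sform)
  have "yields \<Psi> [] ?W A \<delta>"
  proof (rule yields_orE[OF M_state_dec[OF wf(1) *(3)]])
    let ?\<Psi> = "insert ?a \<Psi>"
    have a: "proves ?\<Psi> ?a" using wf_ab by (auto intro: M_assm)
    then have "proves ?\<Psi> (emb_sform [] (SAnd \<alpha> \<gamma>) s)"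
      using M_weaken[OF *(4), of ?\<Psi>] by (auto intro: M_andI)
    then have y: "yields ?\<Psi> [] ?T A \<delta>"
      using *(2,3) by (intro realizes_run[OF t]) auto
    show "yields ?\<Psi> [] ?W A \<delta>"
      by (rule yields_eq[OF M_impE[OF M_chi_pos[OF wf(1) *(3) T U] a] y W T]) (use t' in auto)
  next
    let ?\<Psi> = "insert (Neg ?a) \<Psi>"
    have na: "proves ?\<Psi> (Neg ?a)" using wf_ab by (auto intro: M_assm)
    note e = M_impE[OF M_chi_neg[OF wf(1) *(3) T U] na]
    show "yields ?\<Psi> [] ?W A \<delta>"
    proof (rule yields_orE)
      show "proves ?\<Psi> (Or ?a ?b)" using cases[OF *(3)] by simp
      let ?\<Theta> = "insert ?a ?\<Psi>"
      have "proves ?\<Theta> Bot"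
        using M_impE[OF M_weaken[OF na, of ?\<Theta>] M_assm[of ?a ?\<Theta>]] wf_ab by auto
      then show "yields ?\<Theta> [] ?W A \<delta>"
        by (rule yields_botE[OF _ W]) (use t' in auto)
      let ?\<Theta>' = "insert ?b ?\<Psi>"
      have "proves ?\<Theta>' ?b" using wf_ab by (auto intro: M_assm)
      then have "proves ?\<Theta>' (emb_sform [] (SAnd \<beta> \<gamma>) s)"
        using M_weaken[OF *(4), of ?\<Theta>'] by (auto intro: M_andI)
      then have y: "yields ?\<Theta>' [] ?U A \<delta>"
        using *(2,3) by (intro realizes_run[OF u]) auto
      show "yields ?\<Theta>' [] ?W A \<delta>"
        by (rule yields_eq[OF M_weaken[OF e] y W U]) (use t' in auto)
    qed
  qed
  then show "yields \<Psi> [] (inst_mterm 0 s (chi_app \<alpha> (MProd (emb_ty (tau A)) MState) (BV 0)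
        (App (emb \<Sigma> E \<Delta> t) (BV 0)) (App (emb \<Sigma> E \<Delta> u) (BV 0)))) A \<delta>"
    using typed_emb[OF t'(5)] typed_emb[OF u'(5)] by (simp add: inst_chi_app)
qed (use realizesD[OF t] realizesD[OF u] fv in \<open>auto intro: st_typing.intros\<close>)

end

subsection \<open>Contexts of realizers\<close>

lemma finite_realizer_assms [simp]:
  fixes As :: "('f, 'P, 'p) mform list"
  shows "finite (realizer_assms xs As :: ('f, 'P, 'p, 'g) fm set)"
proof -
  have "(realizer_assms xs As :: ('f, 'P, 'p, 'g) fm set) =
      (\<lambda>(x, A). sr [] (FV x (emb_ty (tau A))) A) ` set (zip xs As)"
    by (auto simp: realizer_assms_def)
  then show ?thesis by simp
qed

lemma realizer_assms_Cons [simp]: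
  "realizer_assms (x # xs) (A # As) = insert (sr [] (FV x (emb_ty (tau A))) A) (realizer_assms xs As)"
  by (auto simp: realizer_assms_def)

lemma realizer_assms_Nil [simp]: "realizer_assms [] [] = {}"
  by (simp add: realizer_assms_def)

lemma realizer_ctx_Cons [simp]:
  "realizer_ctx V (x # xs) (A # As) = (realizer_ctx V xs As)(x \<mapsto> tau A)"
  by (simp add: realizer_ctx_def)

lemma realizer_ctx_fo:
  assumes "x \<in> V" "set xs \<inter> V = {}"
  shows "realizer_ctx V xs As x = Some TD"
proof -
  have "x \<notin> set xs" using assms by blast
  then have "map_of (zip xs (map tau As)) x = None"
    by (auto simp: map_of_eq_None_iff dest: set_zip_leftD)
  then show ?thesis using assms(1) by (simp add: realizer_ctx_def map_add_def)
qed

lemma realizer_ctx_nth: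
  assumes "length xs = length As" "distinct xs" "i < length As"
  shows "realizer_ctx V xs As (xs ! i) = Some (tau (As ! i))"
  using assms by (simp add: realizer_ctx_def map_of_zip_nth)

lemma realizer_ctx_mono:
  assumes "V \<subseteq> V'" "set xs \<inter> V' = {}"
  shows "realizer_ctx V xs As \<subseteq>\<^sub>m realizer_ctx V' xs As"
  using assms by (auto simp: map_le_def realizer_ctx_def map_add_def split: option.splits if_splits)

text \<open>The free variables of an assumption are the name of its realizer, which lies in
  \<open>xs\<close>, and first-order variables, which have sort \<open>MD\<close>. At other sorts it
  is therefore enough to avoid \<open>xs\<close>.\<close>

lemma fv_realizer_assms:
  fixes As :: "('f, 'P, 'p) mform list"
  assumes "\<forall>A\<in>set As. wf_mform \<Sigma> 0 A"
    and "x \<notin> set xs" "X = MD \<Longrightarrow> x \<notin> (\<Union>A\<in>set As. fv_mform A)"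
  shows "(x, X) \<notin> (\<Union>\<phi>\<in>(realizer_assms xs As :: ('f, 'P, 'p, 'g) fm set). fv_fm \<phi>)"
proof
  assume "(x, X) \<in> (\<Union>\<phi>\<in>(realizer_assms xs As :: ('f, 'P, 'p, 'g) fm set). fv_fm \<phi>)"
  then obtain y A where yA: "(y, A) \<in> set (zip xs As)"
    "(x, X) \<in> fv_fm (sr [] (FV y (emb_ty (tau A))) A :: ('f, 'P, 'p, 'g) fm)"
    unfolding realizer_assms_def by blast
  have y: "y \<in> set xs" and A: "A \<in> set As"
    using yA(1) by (auto dest: set_zip_leftD set_zip_rightD)
  have "wf_mform \<Sigma> (length ([] :: ('f, 'p, 'g) mterm list)) A"
    using A assms(1) by simp
  from subsetD[OF fv_sr[OF this] yA(2)] show False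
    using y A assms by auto
qed

lemma fresh_names:
  fixes S :: "name set"
  assumes "finite S"
  obtains xs where "length xs = n" "distinct xs" "set xs \<inter> S = {}"
proof -
  obtain T where T: "finite T" "card T = n" "T \<subseteq> - S"
    using assms infinite_arbitrarily_large[of "- S" n] by (auto simp: Compl_eq_Diff_UNIV)
  obtain xs where "set xs = T" "distinct xs"
    using finite_distinct_list[OF T(1)] by blast
  then have "length xs = n" "set xs \<inter> S = {}" "distinct xs"
    using T by (auto simp: distinct_card)
  then show ?thesis using that by blast
qed

definition fv_triple :: "('f, 'p) sform \<Rightarrow> ('f, 'P, 'p) mform \<Rightarrow> ('f, 'p) sform \<Rightarrow> name set" where
  "fv_triple \<alpha> A \<beta> = fv_sform \<alpha> \<union> fv_mform A \<union> fv_sform \<beta>"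

context metatheory
begin

text \<open>\<open>V\<close> may contain first-order variables that do not occur in the sequent itself, such as the
  ones of a formula that is eliminated in its derivation.\<close>

definition realizable ::
  "name set \<Rightarrow> ('f, 'P, 'p) mform set \<Rightarrow> ('f, 'p) sform \<Rightarrow> ('f, 'P, 'p) mform \<Rightarrow> ('f, 'p) sform \<Rightarrow> bool"
    where
  "realizable V \<Gamma> \<alpha> A \<beta> \<longleftrightarrow> finite V \<and> (\<Union>B\<in>\<Gamma>. fv_mform B) \<union> fv_triple \<alpha> A \<beta> \<subseteq> V \<and>
    (\<forall>As xs. set As = \<Gamma> \<longrightarrow> length xs = length As \<longrightarrow> distinct xs \<longrightarrow> set xs \<inter> V = {} \<longrightarrow>
      (\<exists>t. realizes (realizer_ctx V xs As) (realizer_assms xs As) t \<alpha> A \<beta>))"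

text \<open>Passing to a larger \<open>V'\<close> brings the realizers of several premises into one
  common context.\<close>

lemma realizableD:
  assumes "realizable V \<Gamma> \<alpha> A \<beta>" "V \<subseteq> V'"
    and "set As = \<Gamma>" "length xs = length As" "distinct xs" "set xs \<inter> V' = {}"
  obtains t where "realizes (realizer_ctx V' xs As) (realizer_assms xs As) t \<alpha> A \<beta>"
proof -
  have disj: "set xs \<inter> V = {}" using assms by blast
  have all: "\<forall>As xs. set As = \<Gamma> \<longrightarrow> length xs = length As \<longrightarrow> distinct xs \<longrightarrow> set xs \<inter> V = {} \<longrightarrow>
      (\<exists>t. realizes (realizer_ctx V xs As) (realizer_assms xs As) t \<alpha> A \<beta>)"
    using assms(1) unfolding realizable_def by (elim conjE)
  obtain t where "realizes (realizer_ctx V xs As) (realizer_assms xs As) t \<alpha> A \<beta>"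
    using all[rule_format, OF assms(3-5) disj] ..
  from realizes_weaken[OF this realizer_ctx_mono[OF assms(2,6)] subset_refl] show ?thesis
    using that by simp
qed

text \<open>The variables of the sequent are added to \<open>V\<close>. The last premise of the
  inner implication guarantees that every name outside \<open>W\<close> and \<open>xs\<close> is
  fresh for the assumptions at all sorts; rules that discharge an assumption take its name from
  there.\<close>

lemma realizableI:
  assumes "finite V" "finite \<Gamma>" "\<forall>B\<in>\<Gamma>. wf_mform \<Sigma> 0 B"
    and "\<And>W As xs. V \<subseteq> W \<Longrightarrow> finite W \<Longrightarrow> (\<Union>B\<in>\<Gamma>. fv_mform B) \<subseteq> W \<Longrightarrow> fv_triple \<alpha> A \<beta> \<subseteq> W \<Longrightarrow>
      set As = \<Gamma> \<Longrightarrow> length xs = length As \<Longrightarrow> distinct xs \<Longrightarrow> set xs \<inter> W = {} \<Longrightarrow>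
      (\<And>x X. x \<notin> W \<union> set xs \<Longrightarrow> (x, X) \<notin> (\<Union>\<phi>\<in>realizer_assms xs As. fv_fm \<phi>)) \<Longrightarrow>
      \<exists>t. realizes (realizer_ctx W xs As) (realizer_assms xs As) t \<alpha> A \<beta>"
  shows "\<exists>V. realizable V \<Gamma> \<alpha> A \<beta>"
proof -
  let ?W = "V \<union> (\<Union>B\<in>\<Gamma>. fv_mform B) \<union> fv_triple \<alpha> A \<beta>"
  have "finite ?W" using assms by (simp add: fv_triple_def)
  moreover have "\<exists>t. realizes (realizer_ctx ?W xs As) (realizer_assms xs As) t \<alpha> A \<beta>"
    if "set As = \<Gamma>" "length xs = length As" "distinct xs" "set xs \<inter> ?W = {}" for As xs
  proof (rule assms(4)[OF _ \<open>finite ?W\<close> _ _ that])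
    show "(x, X) \<notin> (\<Union>\<phi>\<in>realizer_assms xs As. fv_fm \<phi>)" if "x \<notin> ?W \<union> set xs" for x X
      using that \<open>set As = \<Gamma>\<close> assms(3) by (intro fv_realizer_assms[where \<Sigma> = \<Sigma>]) auto
  qed auto
  moreover have "(\<Union>B\<in>\<Gamma>. fv_mform B) \<union> fv_triple \<alpha> A \<beta> \<subseteq> ?W" by blast
  ultimately have "realizable ?W \<Gamma> \<alpha> A \<beta>" unfolding realizable_def by blast
  then show ?thesis ..
qed

text \<open>The second premise is abstracted over its assumption \<open>x\<close> and its
  eigenvariable \<open>y\<close>, and the resulting function is applied to the two components of a
  variable \<open>z\<close>. Abstracting \<open>z\<close> gives an implication with antecedent
  \<open>MEx A\<close>, so the rule reduces to implication elimination, and \<open>r\<close> is run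
  only once although both components of its value are used.\<close>

lemma realizes_exE:
  assumes r: "realizes \<Delta> \<Phi> r \<alpha> (MEx A) \<beta>"
    and t: "realizes (\<Delta>(x \<mapsto> tau A))
      (insert (sr [] (FV x (emb_ty (tau A))) (inst_mform 0 (Free y) A)) \<Phi>) t \<beta> C \<gamma>"
    and y: "\<Delta> y = Some TD" "y \<notin> fv_mform A \<union> fv_mform C \<union> fv_sform \<beta> \<union> fv_sform \<gamma>"
      "(y, MD) \<notin> (\<Union>\<phi>\<in>\<Phi>. fv_fm \<phi>)"
    and x: "x \<notin> fv_mform (inst_mform 0 (Free y) A) \<union> fv_mform C \<union> fv_sform \<beta> \<union> fv_sform \<gamma>"
      "(x, emb_ty (tau A)) \<notin> (\<Union>\<phi>\<in>\<Phi>. fv_fm \<phi>)"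
    and z: "z \<notin> fv_mform A \<union> fv_mform C \<union> fv_sform \<beta> \<union> fv_sform \<gamma>" "\<Delta> z = None"
      "(z, emb_ty (tau (MEx A))) \<notin> (\<Union>\<phi>\<in>\<Phi>. fv_fm \<phi>)"
  shows "\<exists>u. realizes \<Delta> \<Phi> u \<alpha> C \<gamma>"
proof -
  note r' = realizesD[OF r] and t' = realizesD[OF t]
  let ?Ay = "inst_mform 0 (Free y) A"
  have wf: "wf_mform \<Sigma> (Suc 0) A" using r' by simp
  have "realizes \<Delta> \<Phi> (Abs x (tau ?Ay) t) \<beta> (MImp ?Ay \<beta> C \<gamma>) \<beta>"
    by (rule realizes_impI) (use t t' x wf in \<open>auto simp: wf_inst_mform\<close>)
  \<comment> \<open>The context already contains \<open>y\<close> as a first-order variable, so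
    abstracting it does not change the context.\<close>
  moreover have "\<Delta>(y \<mapsto> TD) = \<Delta>" using y(1) by (simp add: fun_upd_idem)
  moreover have "inst_sform 0 (Free y) \<beta> = \<beta>" "inst_sform 0 (Free y) \<gamma> = \<gamma>"
    "inst_mform 0 (Free y) C = C"
    using t' by (auto simp: inst_sform_id inst_mform_id)
  \<comment> \<open>Of the parts of the quantified formula only \<open>A\<close> depends on the
    bound variable: \<open>\<beta>\<close>, \<open>C\<close> and \<open>\<gamma>\<close> are their
    own instances at \<open>y\<close>.\<close>
  ultimately have q: "realizes \<Delta> \<Phi> (Abs y TD (Abs x (tau ?Ay) t)) \<beta> (MAll \<beta> (MImp A \<beta> C \<gamma>) \<beta>) \<beta>"
    using y t' by (intro realizes_allI) auto
  let ?Z = "tau (MEx A)"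
  let ?\<phi> = "sr [] (FV z (emb_ty ?Z)) (MEx A)"
  have "\<Delta> \<subseteq>\<^sub>m \<Delta>(z \<mapsto> ?Z)" using z(2) by (auto simp: map_le_def)
  from realizes_weaken[OF q this, of "insert ?\<phi> \<Phi>"]
  have "realizes (\<Delta>(z \<mapsto> ?Z)) (insert ?\<phi> \<Phi>) (Abs y TD (Abs x (tau ?Ay) t)) \<beta>
    (MAll \<beta> (MImp A \<beta> C \<gamma>) \<beta>) \<beta>"
    using r' by auto
  from realizes_ex_apply[OF this, of z] have "\<exists>u. realizes (\<Delta>(z \<mapsto> ?Z)) (insert ?\<phi> \<Phi>) u \<beta> C \<gamma>"
    using t' by auto
  then obtain u where "realizes (\<Delta>(z \<mapsto> ?Z)) (insert ?\<phi> \<Phi>) u \<beta> C \<gamma>" ..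
  then have "realizes \<Delta> \<Phi> (Abs z ?Z u) \<alpha> (MImp (MEx A) \<beta> C \<gamma>) \<alpha>"
    by (rule realizes_impI) (use z r' in auto)
  from realizes_impE[OF this r] show ?thesis ..
qed

text \<open>Even atomic formulas are realized at sort \<open>MUnit\<close>, so the sorts of
  realizers avoid the sort of first-order terms.\<close>

lemma emb_ty_tau: "emb_ty (tau A) \<noteq> MD"
  by (cases A) auto

text \<open>Names are only required to be fresh as variables of the sorts of realizers: a first-order
  variable of the same name is a different variable.\<close>

lemma realizes_cut:
  assumes "realizes (\<Delta> ++ map_of (zip ys (map tau Bs))) (\<Phi> \<union> realizer_assms ys Bs) t \<alpha> A \<beta>"
    and "length ys = length Bs" "distinct ys"
    and "\<forall>B\<in>set Bs. wf_mform \<Sigma> 0 B"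
    and "\<forall>B\<in>set Bs. \<exists>x. x \<notin> set ys \<and> \<Delta> x = Some (tau B) \<and> sr [] (FV x (emb_ty (tau B))) B \<in> \<Phi>"
    and "set ys \<inter> ((\<Union>B\<in>set Bs. fv_mform B) \<union> fv_triple \<alpha> A \<beta>) = {}"
    and "\<forall>y\<in>set ys. \<forall>X. X \<noteq> MD \<longrightarrow> (y, X) \<notin> (\<Union>\<phi>\<in>\<Phi>. fv_fm \<phi>)"
  shows "\<exists>t. realizes \<Delta> \<Phi> t \<alpha> A \<beta>"
  using assms
proof (induction ys arbitrary: Bs t)
  case Nil
  then show ?case by auto
next
  case (Cons y ys)
  then obtain B Bs' where Bs: "Bs = B # Bs'" by (cases Bs) auto
  let ?\<Delta> = "\<Delta> ++ map_of (zip ys (map tau Bs'))" let ?\<Phi> = "\<Phi> \<union> realizer_assms ys Bs'"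
  have ctx: "\<Delta> ++ map_of (zip (y # ys) (map tau (B # Bs'))) = ?\<Delta>(y \<mapsto> tau B)"
    by (rule ext) (simp add: map_add_def)
  have "realizes (?\<Delta>(y \<mapsto> tau B)) (insert (sr [] (FV y (emb_ty (tau B))) B) ?\<Phi>) t \<alpha> A \<beta>"
    using Cons.prems(1) unfolding Bs ctx by (simp only: realizer_assms_Cons Un_insert_right)
  moreover have "(y, X) \<notin> (\<Union>\<phi>\<in>realizer_assms ys Bs'. fv_fm \<phi>)" for X
    by (rule fv_realizer_assms[where \<Sigma> = \<Sigma>]) (use Cons.prems Bs in auto)
  ultimately have imp: "realizes ?\<Delta> ?\<Phi> (Abs y (tau B) t) \<alpha> (MImp B \<alpha> A \<beta>) \<alpha>"
    using Cons.prems realizesD(2)[OF Cons.prems(1)]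
    by (intro realizes_impI) (auto simp: Bs fv_triple_def emb_ty_tau)
  \<comment> \<open>As \<open>x\<close> lies outside all of \<open>y # ys\<close>, the context that
    still contains the remaining \<open>ys\<close> does not shadow it, and \<open>Var x\<close>
    realizes \<open>B\<close>.\<close>
  obtain x where x: "x \<notin> set (y # ys)" "\<Delta> x = Some (tau B)" "sr [] (FV x (emb_ty (tau B))) B \<in> \<Phi>"
    using Cons.prems(5) by (auto simp: Bs)
  have "map_of (zip ys (map tau Bs')) x = None"
    using x(1) by (auto simp: map_of_eq_None_iff dest: set_zip_leftD)
  then have "?\<Delta> x = Some (tau B)"
    using x(2) by (simp add: map_add_def)
  then have "realizes ?\<Delta> ?\<Phi> (Var x) \<alpha> B \<alpha>"
    by (rule realizes_assm[OF realizesD(1)[OF imp]])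
      (use x(3) Cons.prems(4) Bs realizesD(2)[OF imp] in auto)
  from realizes_impE[OF imp this] show ?case
    using Cons.prems by (intro Cons.IH) (auto simp: Bs)
qed

end

subsection \<open>Realizers from derivations\<close>

text \<open>The set \<open>V\<close> may exceed the free variables of the axiom, as its realizer may
  use further first-order variables, and it may even be infinite.\<close>

definition axiom_realizable ::
  "('f, 'P, 'p) signature \<Rightarrow> ('f, 'P, 'p, 'k, 'g) extension \<Rightarrow> ('f, 'P, 'p) main_axiom \<Rightarrow> bool" where
  "axiom_realizable \<Sigma> E = (\<lambda>(Bs, \<alpha>, B, \<beta>). \<exists>V ys u.
     fv_sequent Bs \<alpha> B \<beta> \<subseteq> V \<and> length ys = length Bs \<and> distinct ys \<and> set ys \<inter> V = {} \<and>
     st_typing \<Sigma> E (realizer_ctx V ys Bs) u (tau B) \<and>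
     prv \<Sigma> E (realizer_assms ys Bs) (hsr [] (emb \<Sigma> E (realizer_ctx V ys Bs) u) \<alpha> B \<beta>))"

context metatheory
begin

lemma SL_realizable_ax:
  assumes ax: "axiom_realizable \<Sigma> E (Bs, \<alpha>, A, \<beta>)"
    and "finite \<Gamma>" "set Bs \<subseteq> \<Gamma>" "\<forall>B\<in>\<Gamma>. wf_mform \<Sigma> 0 B"
    and wf: "wf_sform \<Sigma> 0 \<alpha>" "wf_mform \<Sigma> 0 A" "wf_sform \<Sigma> 0 \<beta>"
  shows "\<exists>V. realizable V \<Gamma> \<alpha> A \<beta>"
proof -
  obtain V ys u where u: "fv_sequent Bs \<alpha> A \<beta> \<subseteq> V" "length ys = length Bs" "distinct ys"
    "set ys \<inter> V = {}"
    "st_typing \<Sigma> E (realizer_ctx V ys Bs) u (tau A)"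
    "proves (realizer_assms ys Bs) (hsr [] (emb \<Sigma> E (realizer_ctx V ys Bs) u) \<alpha> A \<beta>)"
    using ax unfolding axiom_realizable_def prod.case by (elim exE conjE)
  \<comment> \<open>Intersecting with the variables of \<open>u\<close> restores finiteness. Adding
    \<open>ys\<close> forces the names \<open>xs\<close> of the assumptions at hand to differ from
    those of the axiom.\<close>
  let ?V = "(V \<inter> fv_st u) \<union> (set ys)"
  show ?thesis
  proof (rule realizableI)
    show "finite ?V" by (simp add: finite_fv_st)
    fix W As xs
    assume W: "?V \<subseteq> W" "finite W" "(\<Union>B\<in>\<Gamma>. fv_mform B) \<subseteq> W" "fv_triple \<alpha> A \<beta> \<subseteq> W"
      and xs: "set As = \<Gamma>" "length xs = length As" "distinct xs" "set xs \<inter> W = {}"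
    let ?W = "W - set ys"
    let ?\<Delta> = "realizer_ctx ?W xs As" let ?\<Phi> = "realizer_assms xs As"
    have disj: "set xs \<inter> set ys = {}" using W xs by blast
    \<comment> \<open>Only the free variables of \<open>u\<close> count for its typing and its
      embedding, so agreement on these carries \<open>u\<close> over to the new context.\<close>
    have agree: "(?\<Delta> ++ map_of (zip ys (map tau Bs))) x = realizer_ctx V ys Bs x" if "x \<in> fv_st u"
      for x
    proof (cases "x \<in> set ys")
      case True
      then have "x \<in> dom (map_of (zip ys (map tau Bs)))"
        using u(2) by (simp add: dom_map_of_zip)
      then show ?thesis by (auto simp: realizer_ctx_def map_add_dom_app_simps)
    next
      case False
      then have "map_of (zip ys (map tau Bs)) x = None"
        by (auto simp: map_of_eq_None_iff dest: set_zip_leftD)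
      moreover have "x \<in> V"
        using st_typing_fv[OF u(5)] that False calculation
        by (auto simp: realizer_ctx_def map_add_def split: if_splits)
      moreover have "x \<in> ?W" using calculation that False W by auto
      moreover have "?\<Delta> x = Some TD"
        by (rule realizer_ctx_fo) (use calculation xs in auto)
      ultimately show ?thesis by (simp add: realizer_ctx_def map_add_def)
    qed
    have "realizes (?\<Delta> ++ map_of (zip ys (map tau Bs))) (?\<Phi> \<union> realizer_assms ys Bs) u \<alpha> A \<beta>"
      unfolding realizes_def
    proof (intro conjI)
      show "st_typing \<Sigma> E (?\<Delta> ++ map_of (zip ys (map tau Bs))) u (tau A)"
        by (rule st_typing_cong[OF u(5)]) (simp add: agree)
      have "emb \<Sigma> E (?\<Delta> ++ map_of (zip ys (map tau Bs))) u = emb \<Sigma> E (realizer_ctx V ys Bs) u"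
        by (rule emb_cong) (simp add: agree)
      then show "proves (?\<Phi> \<union> realizer_assms ys Bs)
          (hsr [] (emb \<Sigma> E (?\<Delta> ++ map_of (zip ys (map tau Bs))) u) \<alpha> A \<beta>)"
        using M_weaken[OF u(6), of "?\<Phi> \<union> realizer_assms ys Bs"] by (simp del: hsr.simps)
    qed (use wf in auto)
    then have "\<exists>t. realizes ?\<Delta> ?\<Phi> t \<alpha> A \<beta>"
    proof (rule realizes_cut[OF _ u(2,3)])
      show "\<forall>B\<in>set Bs. \<exists>x. x \<notin> set ys \<and> ?\<Delta> x = Some (tau B) \<and> sr [] (FV x (emb_ty (tau B))) B \<in> ?\<Phi>"
      proof
        fix B assume "B \<in> set Bs"
        then have "B \<in> set As" using assms(3) xs(1) by blast
        then obtain i where i: "i < length As" "As ! i = B" by (auto simp: in_set_conv_nth)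
        then have "xs ! i \<in> set xs" using xs(2) by simp
        then have "xs ! i \<notin> set ys" using disj by blast
        moreover have "?\<Delta> (xs ! i) = Some (tau B)"
          using realizer_ctx_nth[OF xs(2,3) i(1)] i by simp
        moreover have "(xs ! i, B) \<in> set (zip xs As)"
          using i xs(2) by (auto simp: set_zip)
        then have "sr [] (FV (xs ! i) (emb_ty (tau B))) B \<in> ?\<Phi>"
          by (auto simp: realizer_assms_def)
        ultimately show "\<exists>x. x \<notin> set ys \<and> ?\<Delta> x = Some (tau B) \<and> sr [] (FV x (emb_ty (tau B))) B \<in> ?\<Phi>"
          by blast
      qed
      show "\<forall>B\<in>set Bs. wf_mform \<Sigma> 0 B" using assms by blast
      show "set ys \<inter> ((\<Union>B\<in>set Bs. fv_mform B) \<union> fv_triple \<alpha> A \<beta>) = {}"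
        using u(1,4) by (auto simp: fv_sequent_def fv_triple_def)
      show "\<forall>y\<in>set ys. \<forall>X. X \<noteq> MD \<longrightarrow> (y, X) \<notin> (\<Union>\<phi>\<in>?\<Phi>. fv_fm \<phi>)"
        using disj assms(4) xs(1) by (intro ballI allI impI fv_realizer_assms[where \<Sigma> = \<Sigma>]) auto
    qed
    then obtain t where "realizes ?\<Delta> ?\<Phi> t \<alpha> A \<beta>" ..
    from realizes_weaken[OF this realizer_ctx_mono[of ?W W xs As] subset_refl]
    show "\<exists>t. realizes (realizer_ctx W xs As) ?\<Phi> t \<alpha> A \<beta>"
      using xs(4) by auto
  qed (use assms in auto)
qed

lemma realizable_finite: "realizable V \<Gamma> \<alpha> A \<beta> \<Longrightarrow> finite V"
  and realizable_fv: "realizable V \<Gamma> \<alpha> A \<beta> \<Longrightarrow> (\<Union>B\<in>\<Gamma>. fv_mform B) \<union> fv_triple \<alpha> A \<beta> \<subseteq> V"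
  by (simp_all add: realizable_def)

text \<open>Rules with several premises unite the sets obtained for them, and eigenvariables and
  variables of instantiating terms are added where needed. Finiteness of \<open>\<Gamma>\<close>
  takes part in the induction, because premises with a discharged assumption have a larger
  context.\<close>

lemma SL_realizable:
  assumes "SL \<Sigma> \<Delta>H \<Delta>S \<Gamma> \<alpha> A \<beta>" "finite \<Gamma>"
    and axH: "\<forall>(\<gamma>s, \<alpha>') \<in> \<Delta>H. \<exists>p.
           Imp (conj_list (map (\<lambda>\<gamma>. emb_sform [] \<gamma> (FV p MState)) \<gamma>s))
               (emb_sform [] \<alpha>' (FV p MState)) \<in> meta_ax E"
    and axS: "\<forall>a\<in>\<Delta>S. axiom_realizable \<Sigma> E a"
  shows "\<exists>V. realizable V \<Gamma> \<alpha> A \<beta>"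
  using assms(1,2)
proof (induction rule: SL.induct)
  case (S_assm A \<Gamma> \<alpha>)
  show ?case
  proof (rule realizableI[of "{}"])
    fix W :: "name set" and As and xs :: "name list"
    assume xs: "set As = \<Gamma>" "length xs = length As" "distinct xs" "set xs \<inter> W = {}"
    obtain i where i: "i < length As" "As ! i = A"
      using S_assm.hyps(1) xs(1) by (auto simp: in_set_conv_nth)
    have "(xs ! i, A) \<in> set (zip xs As)"
      using i xs(2) by (auto simp: set_zip)
    then have "sr [] (FV (xs ! i) (emb_ty (tau A))) A \<in> realizer_assms xs As"
      by (auto simp: realizer_assms_def)
    moreover have "realizer_ctx W xs As (xs ! i) = Some (tau A)"
      using realizer_ctx_nth[OF xs(2,3) i(1)] i by simp
    ultimately have "realizes (realizer_ctx W xs As) (realizer_assms xs As) (Var (xs ! i)) \<alpha> A \<alpha>"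
      using S_assm.hyps by (intro realizes_assm) auto
    then show "\<exists>t. realizes (realizer_ctx W xs As) (realizer_assms xs As) t \<alpha> A \<alpha>" ..
  qed (use S_assm in auto)
next
  case (S_topI \<Gamma> \<alpha>)
  show ?case
  proof (rule realizableI[of "{}"])
    fix W :: "name set" and As and xs :: "name list"
    have "realizes (realizer_ctx W xs As) (realizer_assms xs As) Skip \<alpha> MTop \<alpha>"
      using S_topI by (intro realizes_top) auto
    then show "\<exists>t. realizes (realizer_ctx W xs As) (realizer_assms xs As) t \<alpha> MTop \<alpha>" ..
  qed (use S_topI in auto)
next
  case (S_andI \<Gamma> \<alpha> A \<beta> B \<gamma>)
  obtain V V' where V: "realizable V \<Gamma> \<alpha> A \<beta>" and V': "realizable V' \<Gamma> \<beta> B \<gamma>"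
    using S_andI by blast
  show ?case
  proof (rule realizableI[of "V \<union> V'"])
    fix W :: "name set" and As and xs :: "name list"
    assume W: "V \<union> V' \<subseteq> W"
      and xs: "set As = \<Gamma>" "length xs = length As" "distinct xs" "set xs \<inter> W = {}"
    obtain t where t: "realizes (realizer_ctx W xs As) (realizer_assms xs As) t \<alpha> A \<beta>"
      using realizableD[OF V _ xs] W by blast
    obtain u where u: "realizes (realizer_ctx W xs As) (realizer_assms xs As) u \<beta> B \<gamma>"
      using realizableD[OF V' _ xs] W by blast
    from realizes_andI[OF t u]
    show "\<exists>t. realizes (realizer_ctx W xs As) (realizer_assms xs As) t \<alpha> (MAnd A B) \<gamma>" ..
  qed (use V[THEN realizable_finite] V'[THEN realizable_finite] S_andI.prems
    SL_wf_ctx[OF S_andI.hyps(1)] in auto)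
next
  case (S_andE1 \<Gamma> \<alpha> A B \<beta>)
  obtain V where V: "realizable V \<Gamma> \<alpha> (MAnd A B) \<beta>" using S_andE1 by blast
  show ?case
  proof (rule realizableI[of V])
    fix W :: "name set" and As and xs :: "name list"
    assume W: "V \<subseteq> W"
      and xs: "set As = \<Gamma>" "length xs = length As" "distinct xs" "set xs \<inter> W = {}"
    obtain t where "realizes (realizer_ctx W xs As) (realizer_assms xs As) t \<alpha> (MAnd A B) \<beta>"
      using realizableD[OF V W xs] .
    from realizes_andE1[OF this]
    show "\<exists>t. realizes (realizer_ctx W xs As) (realizer_assms xs As) t \<alpha> A \<beta>" ..
  qed (use V[THEN realizable_finite] S_andE1.prems SL_wf_ctx[OF S_andE1.hyps(1)] in auto)
next
  case (S_andE2 \<Gamma> \<alpha> A B \<beta>)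
  obtain V where V: "realizable V \<Gamma> \<alpha> (MAnd A B) \<beta>" using S_andE2 by blast
  show ?case
  proof (rule realizableI[of V])
    fix W :: "name set" and As and xs :: "name list"
    assume W: "V \<subseteq> W"
      and xs: "set As = \<Gamma>" "length xs = length As" "distinct xs" "set xs \<inter> W = {}"
    obtain t where "realizes (realizer_ctx W xs As) (realizer_assms xs As) t \<alpha> (MAnd A B) \<beta>"
      using realizableD[OF V W xs] .
    from realizes_andE2[OF this]
    show "\<exists>t. realizes (realizer_ctx W xs As) (realizer_assms xs As) t \<alpha> B \<beta>" ..
  qed (use V[THEN realizable_finite] S_andE2.prems SL_wf_ctx[OF S_andE2.hyps(1)] in auto)
next
  case (S_orI1 \<Gamma> \<alpha> A \<beta> B)
  obtain V where V: "realizable V \<Gamma> \<alpha> A \<beta>" using S_orI1 by blast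
  show ?case
  proof (rule realizableI[of V])
    fix W :: "name set" and As and xs :: "name list"
    assume W: "V \<subseteq> W"
      and xs: "set As = \<Gamma>" "length xs = length As" "distinct xs" "set xs \<inter> W = {}"
    obtain t where "realizes (realizer_ctx W xs As) (realizer_assms xs As) t \<alpha> A \<beta>"
      using realizableD[OF V W xs] .
    from realizes_orI1[OF this S_orI1.hyps(2)]
    show "\<exists>t. realizes (realizer_ctx W xs As) (realizer_assms xs As) t \<alpha> (MOr A B) \<beta>" ..
  qed (use V[THEN realizable_finite] S_orI1.prems SL_wf_ctx[OF S_orI1.hyps(1)] in auto)
next
  case (S_orI2 \<Gamma> \<alpha> B \<beta> A)
  obtain V where V: "realizable V \<Gamma> \<alpha> B \<beta>" using S_orI2 by blast
  show ?case
  proof (rule realizableI[of V])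
    fix W :: "name set" and As and xs :: "name list"
    assume W: "V \<subseteq> W"
      and xs: "set As = \<Gamma>" "length xs = length As" "distinct xs" "set xs \<inter> W = {}"
    obtain t where "realizes (realizer_ctx W xs As) (realizer_assms xs As) t \<alpha> B \<beta>"
      using realizableD[OF V W xs] .
    from realizes_orI2[OF this S_orI2.hyps(2)]
    show "\<exists>t. realizes (realizer_ctx W xs As) (realizer_assms xs As) t \<alpha> (MOr A B) \<beta>" ..
  qed (use V[THEN realizable_finite] S_orI2.prems SL_wf_ctx[OF S_orI2.hyps(1)] in auto)
next
  case (S_orE \<Gamma> \<alpha> A B \<beta> C \<gamma>)
  obtain V V' V'' where V: "realizable V \<Gamma> \<alpha> (MOr A B) \<beta>"
    and V': "realizable V' (insert A \<Gamma>) \<beta> C \<gamma>" and V'': "realizable V'' (insert B \<Gamma>) \<beta> C \<gamma>"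
    using S_orE by blast
  show ?case
  proof (rule realizableI[of "V \<union> V' \<union> V''"])
    fix W :: "name set" and As and xs :: "name list"
    assume W: "V \<union> V' \<union> V'' \<subseteq> W" "finite W"
      and xs: "set As = \<Gamma>" "length xs = length As" "distinct xs" "set xs \<inter> W = {}"
      and fresh: "\<And>x X. x \<notin> W \<union> set xs \<Longrightarrow>
        (x, X) \<notin> (\<Union>\<phi>\<in>(realizer_assms xs As :: ('f, 'P, 'p, 'g) fm set). fv_fm \<phi>)"
    let ?\<Delta> = "realizer_ctx W xs As" let ?\<Phi> = "realizer_assms xs As"
    obtain x where x: "x \<notin> W \<union> set xs"
      using ex_new_if_finite[OF infinite_UNIV_nat, of "W \<union> set xs"] W by blast
    obtain r where r: "realizes ?\<Delta> ?\<Phi> r \<alpha> (MOr A B) \<beta>"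
      using realizableD[OF V _ xs] W by blast
    \<comment> \<open>If \<open>A\<close> already belongs to \<open>\<Gamma>\<close>, the list
      \<open>A # As\<close> repeats it under a second name. \<open>realizable\<close> permits this,
      as it restricts lists of assumptions only by their sets.\<close>
    obtain t where "realizes (realizer_ctx W (x # xs) (A # As)) (realizer_assms (x # xs) (A # As)) t
      \<beta> C \<gamma>"
      using realizableD[OF V', of W "A # As" "x # xs"] W xs x by auto
    then have t: "realizes ?\<Delta> ?\<Phi> (Abs x (tau A) t) \<beta> (MImp A \<beta> C \<gamma>) \<beta>"
      unfolding realizer_ctx_Cons realizer_assms_Cons
      by (rule realizes_impI)
        (use fresh[OF x] x W realizesD[OF r] V[THEN realizable_fv] V'[THEN realizable_fv] in
          \<open>auto simp: fv_triple_def\<close>)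
    obtain u where "realizes (realizer_ctx W (x # xs) (B # As)) (realizer_assms (x # xs) (B # As)) u
      \<beta> C \<gamma>"
      using realizableD[OF V'', of W "B # As" "x # xs"] W xs x by auto
    then have u: "realizes ?\<Delta> ?\<Phi> (Abs x (tau B) u) \<beta> (MImp B \<beta> C \<gamma>) \<beta>"
      unfolding realizer_ctx_Cons realizer_assms_Cons
      by (rule realizes_impI)
        (use fresh[OF x] x W realizesD[OF r] V[THEN realizable_fv] V''[THEN realizable_fv] in
          \<open>auto simp: fv_triple_def\<close>)
    from realizes_orE[OF r t u] show "\<exists>t. realizes ?\<Delta> ?\<Phi> t \<alpha> C \<gamma>" ..
  qed (use V[THEN realizable_finite] V'[THEN realizable_finite] V''[THEN realizable_finite]
    S_orE.prems SL_wf_ctx[OF S_orE.hyps(1)] in auto)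
next
  case (S_impI A \<Gamma> \<alpha> B \<beta> \<gamma>)
  obtain V where V: "realizable V (insert A \<Gamma>) \<alpha> B \<beta>" using S_impI by blast
  have wfA: "wf_mform \<Sigma> 0 A" "\<forall>B\<in>\<Gamma>. wf_mform \<Sigma> 0 B"
    using SL_wf_ctx[OF S_impI.hyps(1)] by auto
  show ?case
  proof (rule realizableI[of V])
    fix W :: "name set" and As and xs :: "name list"
    assume W: "V \<subseteq> W" "finite W"
      and xs: "set As = \<Gamma>" "length xs = length As" "distinct xs" "set xs \<inter> W = {}"
      and fresh: "\<And>x X. x \<notin> W \<union> set xs \<Longrightarrow>
        (x, X) \<notin> (\<Union>\<phi>\<in>(realizer_assms xs As :: ('f, 'P, 'p, 'g) fm set). fv_fm \<phi>)"
    let ?\<Delta> = "realizer_ctx W xs As" let ?\<Phi> = "realizer_assms xs As"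
    obtain x where x: "x \<notin> W \<union> set xs"
      using ex_new_if_finite[OF infinite_UNIV_nat, of "W \<union> set xs"] W by blast
    obtain t where "realizes (realizer_ctx W (x # xs) (A # As)) (realizer_assms (x # xs) (A # As)) t
      \<alpha> B \<beta>"
      using realizableD[OF V, of W "A # As" "x # xs"] W xs x by auto
    then have "realizes ?\<Delta> ?\<Phi> (Abs x (tau A) t) \<gamma> (MImp A \<alpha> B \<beta>) \<gamma>"
      unfolding realizer_ctx_Cons realizer_assms_Cons
      by (rule realizes_impI)
        (use fresh[OF x] x W wfA S_impI.hyps(2) V[THEN realizable_fv] in \<open>auto simp: fv_triple_def\<close>)
    then show "\<exists>t. realizes ?\<Delta> ?\<Phi> t \<gamma> (MImp A \<alpha> B \<beta>) \<gamma>" ..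
  qed (use V[THEN realizable_finite] S_impI.prems wfA in auto)
next
  case (S_impE \<Gamma> \<alpha> A \<gamma> B \<delta> \<beta>)
  obtain V V' where V: "realizable V \<Gamma> \<alpha> (MImp A \<gamma> B \<delta>) \<beta>" and V': "realizable V' \<Gamma> \<beta> A \<gamma>"
    using S_impE by blast
  show ?case
  proof (rule realizableI[of "V \<union> V'"])
    fix W :: "name set" and As and xs :: "name list"
    assume W: "V \<union> V' \<subseteq> W"
      and xs: "set As = \<Gamma>" "length xs = length As" "distinct xs" "set xs \<inter> W = {}"
    obtain t where t: "realizes (realizer_ctx W xs As) (realizer_assms xs As) t \<alpha> (MImp A \<gamma> B \<delta>) \<beta>"
      using realizableD[OF V _ xs] W by blast
    obtain u where u: "realizes (realizer_ctx W xs As) (realizer_assms xs As) u \<beta> A \<gamma>"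
      using realizableD[OF V' _ xs] W by blast
    from realizes_impE[OF t u]
    show "\<exists>t. realizes (realizer_ctx W xs As) (realizer_assms xs As) t \<alpha> B \<delta>" ..
  qed (use V[THEN realizable_finite] V'[THEN realizable_finite] S_impE.prems
    SL_wf_ctx[OF S_impE.hyps(1)] in auto)
next
  case (S_botE \<Gamma> \<alpha> \<beta> A \<gamma>)
  obtain V where V: "realizable V \<Gamma> \<alpha> MBot \<beta>" using S_botE by blast
  show ?case
  proof (rule realizableI[of V])
    fix W :: "name set" and As and xs :: "name list"
    assume W: "V \<subseteq> W"
      and xs: "set As = \<Gamma>" "length xs = length As" "distinct xs" "set xs \<inter> W = {}"
    obtain t where "realizes (realizer_ctx W xs As) (realizer_assms xs As) t \<alpha> MBot \<beta>"
      using realizableD[OF V W xs] .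
    from realizes_botE[OF this S_botE.hyps(2,3)]
    show "\<exists>t. realizes (realizer_ctx W xs As) (realizer_assms xs As) t \<alpha> A \<gamma>" ..
  qed (use V[THEN realizable_finite] S_botE.prems SL_wf_ctx[OF S_botE.hyps(1)] in auto)
next
  case (S_allI \<Gamma> y \<alpha> A \<beta> \<gamma>)
  obtain V where V:
    "realizable V \<Gamma> (inst_sform 0 (Free y) \<alpha>) (inst_mform 0 (Free y) A) (inst_sform 0 (Free y) \<beta>)"
    using S_allI by blast
  have wf\<Gamma>: "\<forall>B\<in>\<Gamma>. wf_mform \<Sigma> 0 B"
    using SL_wf_ctx[OF S_allI.hyps(1)] .
  show ?case
  \<comment> \<open>Under a vacuous quantifier \<open>y\<close> need not occur in the premise;
    inserting it ensures that the context types it with \<open>TD\<close>.\<close>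
  proof (rule realizableI[of "insert y V"])
    fix W :: "name set" and As and xs :: "name list"
    assume W: "insert y V \<subseteq> W"
      and xs: "set As = \<Gamma>" "length xs = length As" "distinct xs" "set xs \<inter> W = {}"
    let ?\<Delta> = "realizer_ctx W xs As" let ?\<Phi> = "realizer_assms xs As"
    obtain t where t:
      "realizes ?\<Delta> ?\<Phi> t (inst_sform 0 (Free y) \<alpha>) (inst_mform 0 (Free y) A) (inst_sform 0 (Free y) \<beta>)"
      using realizableD[OF V _ xs] W by blast
    have "?\<Delta> y = Some TD" by (rule realizer_ctx_fo) (use W xs in auto)
    then have "?\<Delta>(y \<mapsto> TD) = ?\<Delta>" by (simp add: fun_upd_idem)
    moreover have "(y, MD) \<notin> (\<Union>\<phi>\<in>(?\<Phi> :: ('f, 'P, 'p, 'g) fm set). fv_fm \<phi>)"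
      using W xs S_allI.hyps(3) wf\<Gamma> by (intro fv_realizer_assms[where \<Sigma> = \<Sigma>]) auto
    ultimately have "realizes ?\<Delta> ?\<Phi> (Abs y TD t) \<gamma> (MAll \<alpha> A \<beta>) \<gamma>"
      using t S_allI.hyps(2,4) by (intro realizes_allI) auto
    then show "\<exists>t. realizes ?\<Delta> ?\<Phi> t \<gamma> (MAll \<alpha> A \<beta>) \<gamma>" ..
  qed (use V[THEN realizable_finite] S_allI.prems wf\<Gamma> in auto)
next
  case (S_allE \<Gamma> \<alpha> \<beta> A \<gamma> t)
  obtain V where V: "realizable V \<Gamma> \<alpha> (MAll \<beta> A \<gamma>) (inst_sform 0 t \<beta>)" using S_allE by blast
  show ?case
  \<comment> \<open>A vacuous quantifier makes \<open>t\<close> vanish from both sequents, but the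
    program still evaluates \<open>t\<close>, so its variables have to be typed.\<close>
  proof (rule realizableI[of "V \<union> fv_term t"])
    fix W :: "name set" and As and xs :: "name list"
    assume W: "V \<union> fv_term t \<subseteq> W"
      and xs: "set As = \<Gamma>" "length xs = length As" "distinct xs" "set xs \<inter> W = {}"
    let ?\<Delta> = "realizer_ctx W xs As" let ?\<Phi> = "realizer_assms xs As"
    obtain q where q: "realizes ?\<Delta> ?\<Phi> q \<alpha> (MAll \<beta> A \<gamma>) (inst_sform 0 t \<beta>)"
      using realizableD[OF V _ xs] W by blast
    have "\<forall>x\<in>fv_term t. ?\<Delta> x = Some TD"
      using W xs by (auto intro: realizer_ctx_fo)
    from realizes_allE[OF q S_allE.hyps(2) this]
    show "\<exists>t'. realizes ?\<Delta> ?\<Phi> t' \<alpha> (inst_mform 0 t A) (inst_sform 0 t \<gamma>)" ..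
  qed (use V[THEN realizable_finite] S_allE.prems SL_wf_ctx[OF S_allE.hyps(1)] in auto)
next
  case (S_exI \<Gamma> \<alpha> t A \<beta>)
  obtain V where V: "realizable V \<Gamma> \<alpha> (inst_mform 0 t A) \<beta>" using S_exI by blast
  show ?case
  proof (rule realizableI[of "V \<union> fv_term t"])
    fix W :: "name set" and As and xs :: "name list"
    assume W: "V \<union> fv_term t \<subseteq> W"
      and xs: "set As = \<Gamma>" "length xs = length As" "distinct xs" "set xs \<inter> W = {}"
    let ?\<Delta> = "realizer_ctx W xs As" let ?\<Phi> = "realizer_assms xs As"
    obtain r where r: "realizes ?\<Delta> ?\<Phi> r \<alpha> (inst_mform 0 t A) \<beta>"
      using realizableD[OF V _ xs] W by blast
    have "\<forall>x\<in>fv_term t. ?\<Delta> x = Some TD"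
      using W xs by (auto intro: realizer_ctx_fo)
    from realizes_exI[OF r S_exI.hyps(2) this]
    show "\<exists>t. realizes ?\<Delta> ?\<Phi> t \<alpha> (MEx A) \<beta>" ..
  qed (use V[THEN realizable_finite] S_exI.prems SL_wf_ctx[OF S_exI.hyps(1)] in auto)
next
  case (S_exE \<Gamma> \<alpha> A \<beta> y C \<gamma>)
  let ?Ay = "inst_mform 0 (Free y) A"
  obtain V V' where V: "realizable V \<Gamma> \<alpha> (MEx A) \<beta>" and V': "realizable V' (insert ?Ay \<Gamma>) \<beta> C \<gamma>"
    using S_exE by blast
  have wf\<Gamma>: "\<forall>B\<in>\<Gamma>. wf_mform \<Sigma> 0 B"
    using SL_wf_ctx[OF S_exE.hyps(1)] .
  show ?case
  proof (rule realizableI[of "insert y (V \<union> V')"])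
    fix W :: "name set" and As and xs :: "name list"
    assume W: "insert y (V \<union> V') \<subseteq> W" "finite W"
      and xs: "set As = \<Gamma>" "length xs = length As" "distinct xs" "set xs \<inter> W = {}"
      and fresh: "\<And>x X. x \<notin> W \<union> set xs \<Longrightarrow>
        (x, X) \<notin> (\<Union>\<phi>\<in>(realizer_assms xs As :: ('f, 'P, 'p, 'g) fm set). fv_fm \<phi>)"
    let ?\<Delta> = "realizer_ctx W xs As" let ?\<Phi> = "realizer_assms xs As"
    obtain x where x: "x \<notin> W \<union> set xs"
      using ex_new_if_finite[OF infinite_UNIV_nat, of "W \<union> set xs"] W by blast
    obtain r where r: "realizes ?\<Delta> ?\<Phi> r \<alpha> (MEx A) \<beta>"
      using realizableD[OF V _ xs] W by blast
    obtain t where "realizes (realizer_ctx W (x # xs) (?Ay # As))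
      (realizer_assms (x # xs) (?Ay # As)) t \<beta> C \<gamma>"
      using realizableD[OF V', of W "?Ay # As" "x # xs"] W xs x by auto
    then have t: "realizes (?\<Delta>(x \<mapsto> tau A)) (insert (sr [] (FV x (emb_ty (tau A))) ?Ay) ?\<Phi>) t \<beta> C \<gamma>"
      by (simp only: realizer_ctx_Cons realizer_assms_Cons tau_inst)
    have fvV: "fv_mform A \<union> fv_mform ?Ay \<union> fv_mform C \<union> fv_sform \<beta> \<union> fv_sform \<gamma> \<subseteq> W"
      using V[THEN realizable_fv] V'[THEN realizable_fv] W by (auto simp: fv_triple_def)
    show "\<exists>t. realizes ?\<Delta> ?\<Phi> t \<alpha> C \<gamma>"
    proof (rule realizes_exE[OF r t])
      show "?\<Delta> y = Some TD" by (rule realizer_ctx_fo) (use W xs in auto)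
      show "(y, MD) \<notin> (\<Union>\<phi>\<in>(?\<Phi> :: ('f, 'P, 'p, 'g) fm set). fv_fm \<phi>)"
        using W xs S_exE.hyps(4) wf\<Gamma> by (intro fv_realizer_assms[where \<Sigma> = \<Sigma>]) auto
      \<comment> \<open>The name \<open>x\<close> also serves as \<open>z\<close> in
        \<open>realizes_exE\<close>: there the assumption \<open>x\<close> has been abstracted
        before \<open>z\<close> is introduced.\<close>
      have "map_of (zip xs (map tau As)) x = None"
        using x by (auto simp: map_of_eq_None_iff dest: set_zip_leftD)
      then show "?\<Delta> x = None" using x by (simp add: realizer_ctx_def map_add_def)
    qed (use fresh[OF x] x fvV S_exE.hyps(3,4) in auto)
  qed (use V[THEN realizable_finite] V'[THEN realizable_finite] S_exE.prems wf\<Gamma> in auto)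
next
  case (S_cons \<alpha> \<beta> \<Gamma> A \<gamma> \<delta>)
  obtain V where V: "realizable V \<Gamma> \<beta> A \<gamma>" using S_cons by blast
  have wf: "wf_sform \<Sigma> 0 \<alpha>" "wf_sform \<Sigma> 0 \<delta>"
    using HL_wf[OF S_cons.hyps(1)] HL_wf[OF S_cons.hyps(3)] by auto
  show ?case
  proof (rule realizableI[of V])
    fix W :: "name set" and As and xs :: "name list"
    assume W: "V \<subseteq> W"
      and xs: "set As = \<Gamma>" "length xs = length As" "distinct xs" "set xs \<inter> W = {}"
    obtain t where t: "realizes (realizer_ctx W xs As) (realizer_assms xs As) t \<beta> A \<gamma>"
      using realizableD[OF V W xs] .
    have "realizes (realizer_ctx W xs As) (realizer_assms xs As) t \<alpha> A \<delta>"
      by (rule realizes_cons[OF t wf])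
        (use HL_sound[OF S_cons.hyps(1) axH] HL_sound[OF S_cons.hyps(3) axH] in auto)
    then show "\<exists>t. realizes (realizer_ctx W xs As) (realizer_assms xs As) t \<alpha> A \<delta>" ..
  qed (use V[THEN realizable_finite] S_cons.prems SL_wf_ctx[OF S_cons.hyps(2)] in auto)
next
  case (S_cond \<alpha> \<beta> \<Gamma> \<gamma> A \<delta>)
  obtain V V' where V: "realizable V \<Gamma> (SAnd \<alpha> \<gamma>) A \<delta>" and V': "realizable V' \<Gamma> (SAnd \<beta> \<gamma>) A \<delta>"
    using S_cond by blast
  show ?case
  proof (rule realizableI[of "V \<union> V'"])
    fix W :: "name set" and As and xs :: "name list"
    assume W: "V \<union> V' \<subseteq> W"
      and xs: "set As = \<Gamma>" "length xs = length As" "distinct xs" "set xs \<inter> W = {}"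
    let ?\<Delta> = "realizer_ctx W xs As" let ?\<Phi> = "realizer_assms xs As"
    obtain t where t: "realizes ?\<Delta> ?\<Phi> t (SAnd \<alpha> \<gamma>) A \<delta>"
      using realizableD[OF V _ xs] W by blast
    obtain u where u: "realizes ?\<Delta> ?\<Phi> u (SAnd \<beta> \<gamma>) A \<delta>"
      using realizableD[OF V' _ xs] W by blast
    have "fv_sform \<alpha> \<subseteq> V" using V[THEN realizable_fv] by (auto simp: fv_triple_def)
    then have "\<forall>x\<in>fv_sform \<alpha>. ?\<Delta> x = Some TD"
      using W xs by (auto intro: realizer_ctx_fo)
    then have "realizes ?\<Delta> ?\<Phi> (Ite (tau A) \<alpha> t u) \<gamma> A \<delta>"
      using HL_sound[OF S_cond.hyps(1) axH] by (intro realizes_cond[OF t u]) auto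
    then show "\<exists>t. realizes ?\<Delta> ?\<Phi> t \<gamma> A \<delta>" ..
  qed (use V[THEN realizable_finite] V'[THEN realizable_finite] S_cond.prems
    SL_wf_ctx[OF S_cond.hyps(2)] in auto)
next
  case (S_ax Bs \<alpha> A \<beta> \<Gamma>)
  then show ?case using axS by (intro SL_realizable_ax) auto
qed

text \<open>A first-order variable that does not occur in the sequent is replaced by the constant.\<close>

lemma realizes_remove_vars:
  fixes As :: "('f, 'P, 'p) mform list"
  assumes "finite Z" "realizes (realizer_ctx (W \<union> Z) xs As) (realizer_assms xs As) t \<alpha> A \<beta>"
    and "Z \<inter> set xs = {}" "Z \<inter> ((\<Union>B\<in>set As. fv_mform B) \<union> fv_triple \<alpha> A \<beta>) = {}"
    and "\<forall>B\<in>set As. wf_mform \<Sigma> 0 B"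
  shows "\<exists>t. realizes (realizer_ctx W xs As) (realizer_assms xs As) t \<alpha> A \<beta>"
  using assms
proof (induction Z arbitrary: t rule: finite_induct)
  case empty
  then show ?case by auto
next
  case (insert z Z)
  let ?\<Delta> = "realizer_ctx (W \<union> Z) xs As"
  have "realizer_ctx (W \<union> insert z Z) xs As \<subseteq>\<^sub>m ?\<Delta>(z \<mapsto> TD)"
    using insert.prems(2)
    by (auto simp: map_le_def realizer_ctx_def map_add_def map_of_eq_None_iff split: option.splits
        dest!: map_of_SomeD dest: set_zip_leftD)
  from realizes_weaken[OF insert.prems(1) this subset_refl]
  have t: "realizes (?\<Delta>(z \<mapsto> TD)) (realizer_assms xs As) t \<alpha> A \<beta>"
    by simp
  note t' = realizesD[OF t]
  \<comment> \<open>The quantifier over \<open>z\<close> is vacuous: the closed formulas are their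
    own instances, so eliminating it at the constant returns the same triple.\<close>
  have inst: "inst_sform 0 u \<alpha> = \<alpha>" "inst_mform 0 u A = A" "inst_sform 0 u \<beta> = \<beta>" for u
    using t' by (simp_all add: inst_sform_id inst_mform_id)
  have fr: "(z, MD) \<notin> (\<Union>\<phi>\<in>(realizer_assms xs As :: ('f, 'P, 'p, 'g) fm set). fv_fm \<phi>)"
    using insert.prems by (intro fv_realizer_assms[where \<Sigma> = \<Sigma>]) auto
  have "realizes ?\<Delta> (realizer_assms xs As) (Abs z TD t) \<alpha> (MAll \<alpha> A \<beta>) \<alpha>"
    using insert.prems t t'(2) fr by (intro realizes_allI) (auto simp: inst fv_triple_def)
  then have "realizes ?\<Delta> (realizer_assms xs As) (Abs z TD t) \<alpha> (MAll \<alpha> A \<beta>)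
      (inst_sform 0 (Fn (const \<Sigma>) []) \<alpha>)"
    by (simp add: inst)
  from realizes_allE[OF this]
  have "realizes ?\<Delta> (realizer_assms xs As) (Ap (Abs z TD t) (st_of_fo (Fn (const \<Sigma>) []))) \<alpha> A \<beta>"
    using wf_sig by (simp add: inst wf_signature_def del: st_of_fo.simps)
  then show ?case
    using insert.prems by (intro insert.IH) auto
qed

text \<open>The given names \<open>xs\<close> avoid the sequent but may clash with additional
  variables in \<open>V\<close>. The realizer is therefore built with names \<open>ys\<close> that
  avoid both \<open>V\<close> and \<open>xs\<close>; once the additional variables are gone,
  \<open>ys\<close> can be traded for \<open>xs\<close>.\<close>

lemma SL_realizes:
  assumes "SL \<Sigma> \<Delta>H \<Delta>S (set As) \<alpha> A \<beta>"
    and axH: "\<forall>(\<gamma>s, \<alpha>') \<in> \<Delta>H. \<exists>p.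
           Imp (conj_list (map (\<lambda>\<gamma>. emb_sform [] \<gamma> (FV p MState)) \<gamma>s))
               (emb_sform [] \<alpha>' (FV p MState)) \<in> meta_ax E"
    and axS: "\<forall>a\<in>\<Delta>S. axiom_realizable \<Sigma> E a"
    and xs: "length xs = length As" "distinct xs" "set xs \<inter> fv_sequent As \<alpha> A \<beta> = {}"
  shows "\<exists>t. realizes (realizer_ctx (fv_sequent As \<alpha> A \<beta>) xs As) (realizer_assms xs As) t \<alpha> A \<beta>"
proof -
  let ?W = "fv_sequent As \<alpha> A \<beta>"
  have W: "?W = (\<Union>B\<in>set As. fv_mform B) \<union> fv_triple \<alpha> A \<beta>"
    by (auto simp: fv_sequent_def fv_triple_def)
  have wf: "\<forall>B\<in>set As. wf_mform \<Sigma> 0 B" using SL_wf_ctx[OF assms(1)] .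
  obtain V where V: "realizable V (set As) \<alpha> A \<beta>"
    using SL_realizable[OF assms(1) _ axH axS] by auto
  then have finV: "finite V" and WV: "?W \<subseteq> V"
    unfolding W by (rule realizable_finite, rule realizable_fv)
  obtain ys where ys: "length ys = length As" "distinct ys" "set ys \<inter> (V \<union> set xs) = {}"
    using fresh_names[of "V \<union> set xs"] finV by auto
  obtain t where "realizes (realizer_ctx V ys As) (realizer_assms ys As) t \<alpha> A \<beta>"
    using realizableD[OF V subset_refl refl ys(1,2)] ys(3) by blast
  moreover have "V = ?W \<union> (V - ?W)" using WV by blast
  ultimately have "realizes (realizer_ctx (?W \<union> (V - ?W)) ys As) (realizer_assms ys As) t \<alpha> A \<beta>"
    by simp
  then have "\<exists>t. realizes (realizer_ctx ?W ys As) (realizer_assms ys As) t \<alpha> A \<beta>"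
    by (rule realizes_remove_vars[rotated]) (use finV ys wf W in auto)
  then obtain t where t: "realizes (realizer_ctx ?W ys As) (realizer_assms ys As) t \<alpha> A \<beta>" ..
  let ?\<Delta> = "realizer_ctx ?W xs As" let ?\<Phi> = "realizer_assms xs As"
  \<comment> \<open>The combined context extends the one for \<open>ys\<close>, because
    \<open>xs\<close> does not shadow any first-order variable of the sequent.\<close>
  have "realizer_ctx ?W ys As \<subseteq>\<^sub>m ?\<Delta> ++ map_of (zip ys (map tau As))"
    using xs(3)
    by (auto simp: map_le_def realizer_ctx_def map_add_def split: option.splits if_splits
        dest!: map_of_SomeD dest: set_zip_leftD)
  from realizes_weaken[OF t this, of "?\<Phi> \<union> realizer_assms ys As"]
  have "realizes (?\<Delta> ++ map_of (zip ys (map tau As))) (?\<Phi> \<union> realizer_assms ys As) t \<alpha> A \<beta>"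
    by simp
  then show ?thesis
  proof (rule realizes_cut[OF _ ys(1,2) wf])
    show "\<forall>B\<in>set As. \<exists>x. x \<notin> set ys \<and> ?\<Delta> x = Some (tau B) \<and> sr [] (FV x (emb_ty (tau B))) B \<in> ?\<Phi>"
    proof
      fix B assume "B \<in> set As"
      then obtain i where i: "i < length As" "As ! i = B" by (auto simp: in_set_conv_nth)
      then have "xs ! i \<in> set xs" using xs(1) by simp
      then have "xs ! i \<notin> set ys" using ys(3) by blast
      moreover have "?\<Delta> (xs ! i) = Some (tau B)"
        using realizer_ctx_nth[OF xs(1,2) i(1)] i by simp
      moreover have "(xs ! i, B) \<in> set (zip xs As)"
        using i xs(1) by (auto simp: set_zip)
      then have "sr [] (FV (xs ! i) (emb_ty (tau B))) B \<in> ?\<Phi>"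
        by (auto simp: realizer_assms_def)
      ultimately show "\<exists>x. x \<notin> set ys \<and> ?\<Delta> x = Some (tau B) \<and> sr [] (FV x (emb_ty (tau B))) B \<in> ?\<Phi>"
        by blast
    qed
    show "set ys \<inter> ((\<Union>B\<in>set As. fv_mform B) \<union> fv_triple \<alpha> A \<beta>) = {}"
      using ys(3) WV W by blast
    show "\<forall>y\<in>set ys. \<forall>X. X \<noteq> MD \<longrightarrow> (y, X) \<notin> (\<Union>\<phi>\<in>?\<Phi>. fv_fm \<phi>)"
      using ys(3) wf by (intro ballI allI impI fv_realizer_assms[where \<Sigma> = \<Sigma>]) auto
  qed
qed

end

lemma wf_no_extension: "wf_extension \<Sigma> no_extension"
  by (simp add: wf_extension_def no_extension_def)

lemma SL_realizer:
  fixes E :: "('f, 'P, 'p, 'k, 'g) extension"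
  assumes "wf_signature \<Sigma>" "wf_extension \<Sigma> E"
    and "\<forall>(\<gamma>s, \<alpha>') \<in> \<Delta>H. \<exists>p.
           Imp (conj_list (map (\<lambda>\<gamma>. emb_sform [] \<gamma> (FV p MState)) \<gamma>s))
               (emb_sform [] \<alpha>' (FV p MState)) \<in> meta_ax E"
    and "\<forall>a\<in>\<Delta>S. axiom_realizable \<Sigma> E a"
    and "SL \<Sigma> \<Delta>H \<Delta>S (set As) \<alpha> A \<beta>"
    and "length xs = length As \<and> distinct xs \<and> set xs \<inter> fv_sequent As \<alpha> A \<beta> = {}"
  shows "let \<Delta> = realizer_ctx (fv_sequent As \<alpha> A \<beta>) xs As
    in \<exists>t. st_typing \<Sigma> E \<Delta> t (tau A) \<and>
      prv \<Sigma> E (realizer_assms xs As) (hsr [] (emb \<Sigma> E \<Delta> t) \<alpha> A \<beta>)"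
proof -
  interpret metatheory \<Sigma> E by standard (fact assms)+
  obtain t where "realizes (realizer_ctx (fv_sequent As \<alpha> A \<beta>) xs As) (realizer_assms xs As) t \<alpha> A \<beta>"
    using SL_realizes[OF assms(5,3,4)] assms(6) by blast
  from realizesD(5,6)[OF this] show ?thesis unfolding Let_def by blast
qed

theorem theorem5p4:
  fixes \<Sigma> :: "('f, 'P, 'p) signature"
  assumes "wf_signature \<Sigma>"
  shows
    "(\<forall>As \<alpha> A \<beta> xs.
        SL \<Sigma> {} {} (set As) \<alpha> A \<beta> \<longrightarrow>
        length xs = length As \<and> distinct xs \<and> set xs \<inter> fv_sequent As \<alpha> A \<beta> = {} \<longrightarrow>
        (let E = (no_extension :: ('f, 'P, 'p, 'k, 'g) extension);
             \<Delta> = realizer_ctx (fv_sequent As \<alpha> A \<beta>) xs As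
         in \<exists>t. st_typing \<Sigma> E \<Delta> t (tau A) \<and>
                prv \<Sigma> E (realizer_assms xs As) (hsr [] (emb \<Sigma> E \<Delta> t) \<alpha> A \<beta>)))
     \<and>
     (\<forall>(E :: ('f, 'P, 'p, 'k, 'g) extension) \<Delta>H \<Delta>S.
        wf_extension \<Sigma> E \<longrightarrow>
        (\<forall>(\<gamma>s, \<alpha>') \<in> \<Delta>H. \<exists>p.
           Imp (conj_list (map (\<lambda>\<gamma>. emb_sform [] \<gamma> (FV p MState)) \<gamma>s))
               (emb_sform [] \<alpha>' (FV p MState)) \<in> meta_ax E) \<longrightarrow>
        (\<forall>(Bs, \<alpha>', B, \<beta>') \<in> \<Delta>S. \<exists>V ys u.
           fv_sequent Bs \<alpha>' B \<beta>' \<subseteq> V \<and>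
           length ys = length Bs \<and> distinct ys \<and> set ys \<inter> V = {} \<and>
           (let \<Delta> = realizer_ctx V ys Bs
            in st_typing \<Sigma> E \<Delta> u (tau B) \<and>
               prv \<Sigma> E (realizer_assms ys Bs) (hsr [] (emb \<Sigma> E \<Delta> u) \<alpha>' B \<beta>'))) \<longrightarrow>
        (\<forall>As \<alpha> A \<beta> xs.
           SL \<Sigma> \<Delta>H \<Delta>S (set As) \<alpha> A \<beta> \<longrightarrow>
           length xs = length As \<and> distinct xs \<and> set xs \<inter> fv_sequent As \<alpha> A \<beta> = {} \<longrightarrow>
           (let \<Delta> = realizer_ctx (fv_sequent As \<alpha> A \<beta>) xs As
            in \<exists>t. st_typing \<Sigma> E \<Delta> t (tau A) \<and>
                   prv \<Sigma> E (realizer_assms xs As) (hsr [] (emb \<Sigma> E \<Delta> t) \<alpha> A \<beta>))))"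
  (is "?pure \<and> ?extended")
proof
  show ?pure
  proof (intro allI impI)
    fix As :: "('f, 'P, 'p) mform list" and \<alpha> A \<beta> and xs :: "name list"
    assume "SL \<Sigma> {} {} (set As) \<alpha> A \<beta>"
      "length xs = length As \<and> distinct xs \<and> set xs \<inter> fv_sequent As \<alpha> A \<beta> = {}"
    from SL_realizer[OF assms wf_no_extension _ _ this]
    show "let E = (no_extension :: ('f, 'P, 'p, 'k, 'g) extension);
             \<Delta> = realizer_ctx (fv_sequent As \<alpha> A \<beta>) xs As
         in \<exists>t. st_typing \<Sigma> E \<Delta> t (tau A) \<and>
                prv \<Sigma> E (realizer_assms xs As) (hsr [] (emb \<Sigma> E \<Delta> t) \<alpha> A \<beta>)"
      by (simp add: Let_def del: hsr.simps)
  qed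
  show ?extended
    by (intro allI impI, rule SL_realizer[OF assms])
      (auto simp: axiom_realizable_def Let_def simp del: hsr.simps)
qed

end
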